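(* Let $T>0$, $R_0>0$, and let $f:\mathbb{R}\times[R_0,+\infty)\to\mathbb{R}$ be a continuous function, $T$-periodic in its first variable. Assume that there are constants $\check\mu,\hat\mu$ and an integer $N$ such that $$\check\mu\le\liminf_{\rho\to+\infty}\frac{f(t,\rho)}{\rho}\le\limsup_{\rho\to+\infty}\frac{f(t,\rho)}{\rho}\le\hat\mu\qquad\text{uniformly in } t,$$ with $$\left(\frac{N\pi}{T}\right)^2<\check\mu\le\hat\mu<\left(\frac{(N+1)\pi}{T}\right)^2.$$ Then, for every integer $\nu>0$, there exists an integer $k_\nu>0$ such that, for every integer $k\ge k_\nu$, there exist $L\in\mathbb{R}$ and an $R_0$-bouncing solution $(\rho,\vartheta)$, defined on $\mathbb{R}$, of the system $$\rho''-\frac{L^2}{\rho^3}+f(t,\rho)=0,\qquad \rho^2\vartheta'=L,$$ which is periodic with period $kT$ and makes exactly $\nu$ revolutions around the origin in the period time $kT$, in the sense that, for every $t\in\mathbb{R}$, $$\rho(t+T)=\rho(t),\qquad \vartheta(t+kT)=\vartheta(t)+2\pi\nu .$$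
   Context: **Bouncing solutions (scalar equation).** Let $w\in\mathbb{R}$ and let $p:\mathbb{R}\times[w,+\infty)\to\mathbb{R}$ be continuous. A $w$-bouncing solution of $x''+p(t,x)=0$ is a continuous function $x$ defined on some interval $(a,b)$ (possibly $\mathbb{R}$), with $x(t)\ge w$ for every $t\in(a,b)$, such that: (i) if $t_0\in(a,b)$ and $x(t_0)>w$, then $x$ is twice differentiable at $t_0$ and $x''(t_0)+p(t_0,x(t_0))=0$; (ii) if $t_0\in(a,b)$, $x(t_0)=w$ and, in a neighborhood of $t_0$, $x(t)>w$ for $t\ne t_0$, then the one-sided derivatives $x'(t_0^-)$ and $x'(t_0^+)$ exist and $x'(t_0^-)=-x'(t_0^+)$; (iii) if $t_0\in(a,b)$, $x(t_0)=w$ and either $x'(t_0^-)$ or $x'(t_0^+)$ exists and is different from $0$, then, in a neighborhood of $t_0$, $x(t)>w$ for $t\ne t_0$; (iv) if $x(t)=w$ for all $t$ in a non-trivial interval $I\subseteq(a,b)$, then $p(t,w)\ge 0$ for every $t\in I$. **Bouncing solutions of the system.** $(\rho,\vartheta)$ is an $R_0$-bouncing solution of the system $\rho''-L^2/\rho^3+f(t,\rho)=0$, $\rho^2\vartheta'=L$ if $\rho$ is an $R_0$-bouncing solution of the first equation, i.e. with $p(t,\rho)=-L^2/\rho^3+f(t,\rho)$ and $w=R_0$, and $\vartheta$ satisfies $\rho^2\vartheta'=L$. The number $L$ (the angular momentum) is not prescribed in advance. *)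

theory Defs
  imports "HOL-Analysis.Analysis"
begin

text \<open>
  The interval \<open>(a, b)\<close> is given by extended real endpoints, so that
  \<open>einterval (-\<infinity>) \<infinity> = UNIV\<close>. Functions on \<open>\<real> \<times> [w, \<infinity>)\<close> are
  total functions whose values below \<open>w\<close> are irrelevant: \<open>p\<close> is evaluated only at points
  \<open>(t, r)\<close> with \<open>r \<ge> w\<close>. Continuity of \<open>p\<close> is a hypothesis on the equation and is not
  part of the definition.
\<close>

definition bouncing_solution ::
    "real \<Rightarrow> (real \<Rightarrow> real \<Rightarrow> real) \<Rightarrow> ereal \<Rightarrow> ereal \<Rightarrow> (real \<Rightarrow> real) \<Rightarrow> bool" where
  "bouncing_solution w p a b x \<longleftrightarrow>
     a < b \<and> continuous_on (einterval a b) x \<and> (\<forall>t\<in>einterval a b. x t \<ge> w) \<and>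
     (\<forall>t0\<in>einterval a b. x t0 > w \<longrightarrow>
        (\<forall>\<^sub>F t in nhds t0. x differentiable (at t)) \<and>
        deriv x differentiable (at t0) \<and>
        deriv (deriv x) t0 + p t0 (x t0) = 0) \<and>
     (\<forall>t0\<in>einterval a b. x t0 = w \<and> (\<forall>\<^sub>F t in at t0. x t > w) \<longrightarrow>
        (\<exists>dl dr. (x has_real_derivative dl) (at_left t0) \<and>
                 (x has_real_derivative dr) (at_right t0) \<and> dl = - dr)) \<and>
     (\<forall>t0\<in>einterval a b. x t0 = w \<and>
        ((\<exists>d. (x has_real_derivative d) (at_left t0) \<and> d \<noteq> 0) \<or>
         (\<exists>d. (x has_real_derivative d) (at_right t0) \<and> d \<noteq> 0)) \<longrightarrow>
        (\<forall>\<^sub>F t in at t0. x t > w)) \<and>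
     (\<forall>I. is_interval I \<and> I \<subseteq> einterval a b \<and> (\<exists>s\<in>I. \<exists>t\<in>I. s < t) \<and> (\<forall>t\<in>I. x t = w) \<longrightarrow>
        (\<forall>t\<in>I. p t w \<ge> 0))"

definition bouncing_solution_system ::
    "real \<Rightarrow> real \<Rightarrow> (real \<Rightarrow> real \<Rightarrow> real) \<Rightarrow> ereal \<Rightarrow> ereal \<Rightarrow>
     (real \<Rightarrow> real) \<Rightarrow> (real \<Rightarrow> real) \<Rightarrow> bool" where
  "bouncing_solution_system R0 L f a b \<rho> \<theta> \<longleftrightarrow>
     bouncing_solution R0 (\<lambda>t r. - (L\<^sup>2 / r ^ 3) + f t r) a b \<rho> \<and>
     (\<forall>t\<in>einterval a b. \<theta> differentiable (at t) \<and> (\<rho> t)\<^sup>2 * deriv \<theta> t = L)"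

text \<open>
  \<open>c \<le> liminf g t r\<close> (resp. \<open>limsup g t r \<le> c\<close>) for \<open>r \<rightarrow> +\<infinity>\<close>, uniformly in \<open>t\<close>:
  the threshold for \<open>r\<close> depends on the tolerance \<open>e\<close> but not on \<open>t\<close>.
\<close>

definition le_liminf_uniformly :: "real \<Rightarrow> (real \<Rightarrow> real \<Rightarrow> real) \<Rightarrow> bool" where
  "le_liminf_uniformly c g \<longleftrightarrow> (\<forall>e>0. \<forall>\<^sub>F r in at_top. \<forall>t. c - e \<le> g t r)"

definition limsup_le_uniformly :: "(real \<Rightarrow> real \<Rightarrow> real) \<Rightarrow> real \<Rightarrow> bool" where
  "limsup_le_uniformly g c \<longleftrightarrow> (\<forall>e>0. \<forall>\<^sub>F r in at_top. \<forall>t. g t r \<le> c + e)"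

lemma le_liminf_uniformly_iff_Liminf:
  "le_liminf_uniformly c g \<longleftrightarrow> ereal c \<le> Liminf at_top (\<lambda>r. INF t. ereal (g t r))"
proof
  assume L: "le_liminf_uniformly c g"
  show "ereal c \<le> Liminf at_top (\<lambda>r. INF t. ereal (g t r))"
  proof (rule ereal_le_epsilon2)
    fix e :: real assume "0 < e"
    with L have "\<forall>\<^sub>F r in at_top. \<forall>t. c - e \<le> g t r"
      by (auto simp: le_liminf_uniformly_def)
    then have "\<forall>\<^sub>F r in at_top. ereal (c - e) \<le> (INF t. ereal (g t r))"
      by eventually_elim (auto intro!: INF_greatest)
    then have "ereal (c - e) \<le> Liminf at_top (\<lambda>r. INF t. ereal (g t r))"
      by (rule Liminf_bounded)
    then show "ereal c \<le> Liminf at_top (\<lambda>r. INF t. ereal (g t r)) + ereal e"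
      by (cases "Liminf at_top (\<lambda>r. INF t. ereal (g t r))") auto
  qed
next
  assume L: "ereal c \<le> Liminf at_top (\<lambda>r. INF t. ereal (g t r))"
  show "le_liminf_uniformly c g"
    unfolding le_liminf_uniformly_def
  proof (intro allI impI)
    fix e :: real assume "0 < e"
    then have "ereal (c - e) < ereal c" by simp
    with L have "\<forall>\<^sub>F r in at_top. ereal (c - e) < (INF t. ereal (g t r))"
      by (simp add: le_Liminf_iff)
    then show "\<forall>\<^sub>F r in at_top. \<forall>t. c - e \<le> g t r"
    proof eventually_elim
      case (elim r)
      show ?case
      proof
        fix t
        have "ereal (c - e) < ereal (g t r)"
          using elim by (rule less_le_trans) (rule INF_lower, simp)
        then show "c - e \<le> g t r" by simp
      qed
    qed
  qed
qed

lemma limsup_le_uniformly_iff_Limsup: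
  "limsup_le_uniformly g c \<longleftrightarrow> Limsup at_top (\<lambda>r. SUP t. ereal (g t r)) \<le> ereal c"
proof
  assume L: "limsup_le_uniformly g c"
  show "Limsup at_top (\<lambda>r. SUP t. ereal (g t r)) \<le> ereal c"
  proof (rule ereal_le_epsilon2)
    fix e :: real assume "0 < e"
    with L have "\<forall>\<^sub>F r in at_top. \<forall>t. g t r \<le> c + e"
      by (auto simp: limsup_le_uniformly_def)
    then have "\<forall>\<^sub>F r in at_top. (SUP t. ereal (g t r)) \<le> ereal (c + e)"
      by eventually_elim (auto intro!: SUP_least)
    then have "Limsup at_top (\<lambda>r. SUP t. ereal (g t r)) \<le> ereal (c + e)"
      by (rule Limsup_bounded)
    then show "Limsup at_top (\<lambda>r. SUP t. ereal (g t r)) \<le> ereal c + ereal e"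
      by simp
  qed
next
  assume L: "Limsup at_top (\<lambda>r. SUP t. ereal (g t r)) \<le> ereal c"
  show "limsup_le_uniformly g c"
    unfolding limsup_le_uniformly_def
  proof (intro allI impI)
    fix e :: real assume "0 < e"
    then have "ereal c < ereal (c + e)" by simp
    with L have "\<forall>\<^sub>F r in at_top. (SUP t. ereal (g t r)) < ereal (c + e)"
      by (simp add: Limsup_le_iff)
    then show "\<forall>\<^sub>F r in at_top. \<forall>t. g t r \<le> c + e"
    proof eventually_elim
      case (elim r)
      show ?case
      proof
        fix t
        have "ereal (g t r) < ereal (c + e)"
          by (rule le_less_trans[OF _ elim]) (rule SUP_upper, simp)
        then show "g t r \<le> c + e" by simp
      qed
    qed
  qed
qed

end

theory Submission
  imports Defs "HOL-Complex_Analysis.Great_Picard"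
begin

text \<open>
  To make \<open>\<nu>\<close> revolutions in time \<open>k T\<close> with \<open>T\<close>-periodic \<open>\<rho>\<close>, the angle must grow by
  \<open>\<epsilon> = 2 \<pi> \<nu> / k\<close> per period, which prescribes \<open>L = \<epsilon> / \<integral> \<rho>\<^sup>-\<^sup>2\<close>. So the radial equation is solved with
  \<open>L\<close> being this functional of \<open>\<rho>\<close>, truncated to \<open>[0, 1]\<close>. The truncation gives an a priori bound on \<open>\<rho>\<close>
  that does not depend on \<open>\<epsilon>\<close>, and therefore it is inactive once \<open>\<epsilon>\<close> is small.

  The obstacle is first replaced by a spring of stiffness \<open>b\<^sup>2\<close>. By the nonresonance condition, for
  large \<open>b\<close> a solution of large energy makes strictly more than \<open>N\<close> and strictly less than \<open>N + 1\<close> turns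
  around the origin of the phase plane in time \<open>T\<close>. Hence no large state is mapped by the flow over one
  period to a positive multiple of itself, and the Poincare-Bohl argument (Brouwer's theorem for the radially
  retracted flow, with \<open>L\<close> as an additional coordinate) yields a periodic solution whose energy is bounded
  independently of \<open>b\<close>. As \<open>b \<rightarrow> \<infinity>\<close> a subsequence converges to a bouncing solution.
\<close>

section \<open>Uniform limits\<close>

text \<open>As \<open>f\<close> is merely continuous, initial value problems may have several
  solutions, and there is no Poincare map to which a fixed point theorem applies. Hence a delayed
  equation is solved first, whose flow is single valued and continuous; the delay tends to 0 for
  each fixed stiffness, before the stiffness grows. A half turn in \<open>x > 0\<close> with
  stiffness \<open>a\<^sup>2\<close> takes time \<open>pi / a\<close>, one in \<open>x < 0\<close>
  takes \<open>pi / b\<close> and vanishes in the limit. So \<open>N\<close> turns in time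
  \<open>T\<close> resonate at \<open>a = N * pi / T\<close>, which is why the hypotheses contain
  \<open>N * pi\<close> and not \<open>2 * N * pi\<close>. For \<open>L\<close> in
  \<open>[0, 1]\<close> the centrifugal term lies between 0 and \<open>1 / R0 ^ 3\<close> and is
  part of a bounded perturbation. An orbit with radius at most \<open>B\<close> has an integral of
  \<open>1 / \<rho>\<^sup>2\<close> of at least \<open>T / B\<^sup>2\<close>, so increments
  \<epsilon> up to this value keep the quotient defining \<open>L\<close> below 1. Velocities jump
  at an impact in the limit; the quantity that does converge uniformly is
  \<open>v\<^sup>2 + (b * pos_part (- x))\<^sup>2\<close>, from whose derivative the wall force
  cancels.\<close>

lemma uniform_limit_indefinite_integral:
  fixes f :: "nat \<Rightarrow> real \<Rightarrow> real"
  assumes lim: "uniform_limit {a..b} f g sequentially"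
    and cont: "\<And>n. continuous_on {a..b} (f n)" and ab: "a \<le> b"
  shows "uniform_limit {a..b} (\<lambda>n t. integral {a..t} (f n)) (\<lambda>t. integral {a..t} g) sequentially"
proof (rule uniform_limitI)
  fix e :: real assume e: "e > 0"
  have g: "continuous_on {a..b} g"
    by (rule uniform_limit_theorem[OF _ lim]) (auto simp: cont)
  have "\<forall>\<^sub>F n in sequentially. \<forall>x\<in>{a..b}. dist (f n x) (g x) < e / (b - a + 1)"
    using e ab by (intro uniform_limitD[OF lim]) auto
  then show "\<forall>\<^sub>F n in sequentially. \<forall>t\<in>{a..b}. dist (integral {a..t} (f n)) (integral {a..t} g) < e"
  proof eventually_elim
    case (elim n)
    show ?case
    proof
      fix t assume t: "t \<in> {a..b}"
      have c1: "continuous_on {a..t} (f n)" "continuous_on {a..t} g"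
        using t cont[of n] g by (auto intro: continuous_on_subset)
      have "integral {a..t} (f n) - integral {a..t} g = integral {a..t} (\<lambda>s. f n s - g s)"
        using c1 by (simp add: integral_diff integrable_continuous_real)
      moreover have "norm (integral {a..t} (\<lambda>s. f n s - g s)) \<le> e / (b - a + 1) * (t - a)"
        using t elim c1 by (intro integral_bound)
          (auto simp: dist_real_def intro!: continuous_intros less_imp_le)
      moreover have "e * (t - a) < e * (b - a + 1)"
        using t e by (intro mult_strict_left_mono) auto
      then have "e / (b - a + 1) * (t - a) < e"
        using ab by (simp add: field_simps)
      ultimately show "dist (integral {a..t} (f n)) (integral {a..t} g) < e"
        by (simp add: dist_real_def)
    qed
  qed
qed

text \<open>The limit has bounded range, so eventually all \<open>X n\<close> stay in one closed
  ball, on which \<open>h\<close> is uniformly continuous.\<close>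

lemma uniform_limit_continuous_compose:
  fixes X :: "nat \<Rightarrow> 'a::metric_space \<Rightarrow> 'b::euclidean_space" and h :: "'b \<Rightarrow> real"
  assumes h: "continuous_on UNIV h" and S: "compact S"
    and lim: "uniform_limit S X x sequentially" and x: "continuous_on S x"
  shows "uniform_limit S (\<lambda>n s. h (X n s)) (\<lambda>s. h (x s)) sequentially"
proof -
  have "bounded (x ` S)"
    using S x by (simp add: compact_continuous_image compact_imp_bounded)
  then obtain r where r: "\<And>s. s \<in> S \<Longrightarrow> norm (x s) \<le> r"
    unfolding bounded_iff by blast
  show ?thesis
  proof (rule uniform_limit_compose_uniformly_continuous_on[OF lim])
    show "uniformly_continuous_on (cball 0 (r + 1)) h"
      using h by (intro compact_uniformly_continuous) (auto intro: continuous_on_subset)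
    have "\<forall>\<^sub>F n in sequentially. \<forall>s\<in>S. dist (X n s) (x s) < 1"
      by (rule uniform_limitD[OF lim]) simp
    then show "\<forall>\<^sub>F n in sequentially. \<forall>s\<in>S. X n s \<in> cball 0 (r + 1)"
    proof eventually_elim
      case (elim n)
      have "norm (X n s) \<le> r + 1" if "s \<in> S" for s
        using elim r[OF that] that norm_triangle_sub[of "X n s" "x s"] by (fastforce simp: dist_norm)
      then show ?case by simp
    qed
  qed simp
qed

lemma uniform_limit_Pair':
  assumes "uniform_limit S f f' F" "uniform_limit S g g' F"
  shows "uniform_limit S (\<lambda>n x. (f n x, g n x)) (\<lambda>x. (f' x, g' x)) F"
proof (rule uniform_limitI)
  fix e :: real assume e: "e > 0"
  have "\<forall>\<^sub>F n in F. \<forall>x\<in>S. dist (f n x) (f' x) < e / 2" "\<forall>\<^sub>F n in F. \<forall>x\<in>S. dist (g n x) (g' x) < e / 2"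
    using e by (auto intro: uniform_limitD[OF assms(1)] uniform_limitD[OF assms(2)] simp del: less_divide_eq_numeral1)
  then show "\<forall>\<^sub>F n in F. \<forall>x\<in>S. dist (f n x, g n x) (f' x, g' x) < e"
  proof eventually_elim
    case (elim n)
    have "dist (f n x, g n x) (f' x, g' x) < e" if "x \<in> S" for x
      using elim that sqrt_sum_squares_le_sum_abs[of "dist (f n x) (f' x)" "dist (g n x) (g' x)"]
      by (fastforce simp: dist_Pair_Pair)
    then show ?case by blast
  qed
qed

lemma uniform_limit_of_tendsto:
  assumes "(f \<longlongrightarrow> l) F"
  shows "uniform_limit S (\<lambda>n x. f n) (\<lambda>x. l) F"
  using assms by (auto intro!: uniform_limitI dest: tendstoD elim: eventually_mono)

lemma uniform_limit_superposition:
  fixes h :: "real \<Rightarrow> real \<Rightarrow> real \<Rightarrow> real"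
  assumes h: "continuous_on UNIV (\<lambda>(t, x, l). h t x l)"
    and lim: "uniform_limit S Y X sequentially" and X: "continuous_on S X"
    and l: "l \<longlonglongrightarrow> l'" and S: "compact S"
  shows "uniform_limit S (\<lambda>n s. h s (Y n s) (l n)) (\<lambda>s. h s (X s) l') sequentially"
proof -
  have "uniform_limit S (\<lambda>n s. (s, Y n s, l n)) (\<lambda>s. (s, X s, l')) sequentially"
    using lim l by (intro uniform_limit_Pair' uniform_limit_of_tendsto uniform_limit_const)
  then have "uniform_limit S (\<lambda>n s. (\<lambda>(t, x, l). h t x l) (s, Y n s, l n))
      (\<lambda>s. (\<lambda>(t, x, l). h t x l) (s, X s, l')) sequentially"
    using X S by (intro uniform_limit_continuous_compose[OF h]) (auto intro!: continuous_intros)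
  then show ?thesis by simp
qed

lemma Arzela_Ascoli_Lipschitz:
  fixes F :: "nat \<Rightarrow> real \<Rightarrow> 'a::euclidean_space"
  assumes B: "\<And>n t. t \<in> {a..b} \<Longrightarrow> norm (F n t) \<le> B"
    and K: "\<And>n s t. s \<in> {a..b} \<Longrightarrow> t \<in> {a..b} \<Longrightarrow> norm (F n s - F n t) \<le> K * \<bar>s - t\<bar>"
  obtains k f where "strict_mono (k :: nat \<Rightarrow> nat)" "continuous_on {a..b} f"
    "uniform_limit {a..b} (\<lambda>n. F (k n)) f sequentially"
proof -
  obtain f k where f: "continuous_on {a..b} f" and k: "strict_mono (k :: nat \<Rightarrow> nat)"
    and conv: "\<And>e. 0 < e \<Longrightarrow> \<exists>N. \<forall>n t. n \<ge> N \<and> t \<in> {a..b} \<longrightarrow> norm (F (k n) t - f t) < e"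
  proof (rule Arzela_Ascoli[of "{a..b}" F B])
    show "\<exists>\<delta>>0. \<forall>n s. s \<in> {a..b} \<and> norm (t - s) < \<delta> \<longrightarrow> norm (F n t - F n s) < e"
      if "t \<in> {a..b}" "e > 0" for t e
    proof (intro exI[of _ "e / (\<bar>K\<bar> + 1)"] conjI allI impI)
      show "e / (\<bar>K\<bar> + 1) > 0" using that by simp
      fix n s assume s: "s \<in> {a..b} \<and> norm (t - s) < e / (\<bar>K\<bar> + 1)"
      have "norm (F n t - F n s) \<le> K * \<bar>t - s\<bar>" using K that s by blast
      also have "\<dots> \<le> (\<bar>K\<bar> + 1) * \<bar>t - s\<bar>" by (intro mult_right_mono) auto
      also have "\<dots> < e" using s by (simp add: field_simps)
      finally show "norm (F n t - F n s) < e" .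
    qed
  qed (use B in auto)
  have "uniform_limit {a..b} (\<lambda>n. F (k n)) f sequentially"
    unfolding uniform_limit_sequentially_iff
  proof (intro allI impI)
    fix e :: real assume "e > 0"
    then show "\<exists>N. \<forall>n\<ge>N. \<forall>t\<in>{a..b}. dist (F (k n) t) (f t) < e"
      using conv[of e] unfolding dist_norm by blast
  qed
  then show thesis using that k f by blast
qed

section \<open>Shooting\<close>

text \<open>Together with \<open>trajectory\<close>, this solves \<open>x'' = - \<beta>\<close> with
  initial state \<open>z = (x 0, x' 0)\<close>. The integral form lets uniform convergence of
  \<open>\<beta>\<close> pass to position and velocity.\<close>

definition velocity :: "real \<times> real \<Rightarrow> (real \<Rightarrow> real) \<Rightarrow> real \<Rightarrow> real" where
  "velocity z \<beta> t = snd z - integral {0..t} \<beta>"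

definition trajectory :: "real \<times> real \<Rightarrow> (real \<Rightarrow> real) \<Rightarrow> real \<Rightarrow> real" where
  "trajectory z \<beta> t = fst z + integral {0..t} (velocity z \<beta>)"

lemma velocity_0 [simp]: "velocity z \<beta> 0 = snd z"
  and trajectory_0 [simp]: "trajectory z \<beta> 0 = fst z"
  by (simp_all add: velocity_def trajectory_def)

lemma velocity_deriv:
  assumes "continuous_on {0..T} \<beta>" "t \<in> {0..T}"
  shows "(velocity z \<beta> has_real_derivative - \<beta> t) (at t within {0..T})"
  unfolding velocity_def using assms
  by (auto intro!: derivative_eq_intros integral_has_real_derivative)

lemma continuous_on_velocity:
  assumes "continuous_on {0..T} \<beta>"
  shows "continuous_on {0..T} (velocity z \<beta>)"
  by (rule DERIV_continuous_on[OF velocity_deriv[OF assms]])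

lemma trajectory_deriv:
  assumes "continuous_on {0..T} \<beta>" "t \<in> {0..T}"
  shows "(trajectory z \<beta> has_real_derivative velocity z \<beta> t) (at t within {0..T})"
  unfolding trajectory_def
  using DERIV_add[OF DERIV_const integral_has_real_derivative[OF continuous_on_velocity[OF assms(1)] assms(2)]]
  by simp

lemma continuous_on_trajectory:
  assumes "continuous_on {0..T} \<beta>"
  shows "continuous_on {0..T} (trajectory z \<beta>)"
  by (rule DERIV_continuous_on[OF trajectory_deriv[OF assms]])

lemma velocity_bound:
  assumes "continuous_on {0..T} \<beta>" "\<And>s. \<bar>\<beta> s\<bar> \<le> K" "norm z \<le> R" "t \<in> {0..T}"
  shows "\<bar>velocity z \<beta> t\<bar> \<le> R + K * T"
proof -
  have "continuous_on {0..t} \<beta>" using assms by (auto intro: continuous_on_subset)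
  then have "norm (integral {0..t} \<beta>) \<le> K * (t - 0)"
    using assms by (intro integral_bound) auto
  also have "K * (t - 0) \<le> K * T"
    using assms(4) abs_ge_zero[of "\<beta> 0"] assms(2)[of 0] by (intro mult_left_mono) auto
  finally show ?thesis
    using norm_snd_le[of "snd z" "fst z"] assms(3) by (simp add: velocity_def)
qed

lemma trajectory_bound:
  assumes "continuous_on {0..T} \<beta>" "\<And>s. \<bar>\<beta> s\<bar> \<le> K" "norm z \<le> R" "t \<in> {0..T}"
  shows "\<bar>trajectory z \<beta> t\<bar> \<le> R + (R + K * T) * T"
proof -
  have c: "continuous_on {0..t} (velocity z \<beta>)"
    by (rule continuous_on_subset[OF continuous_on_velocity[OF assms(1)]]) (use assms(4) in auto)
  have "norm (integral {0..t} (velocity z \<beta>)) \<le> (R + K * T) * (t - 0)"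
    using assms c velocity_bound[OF assms(1-3)] by (intro integral_bound) auto
  also have "\<dots> \<le> (R + K * T) * T"
    using assms(4) velocity_bound[OF assms] by (intro mult_left_mono) auto
  finally show ?thesis
    using norm_fst_le[of "fst z" "snd z"] assms(3) by (simp add: trajectory_def)
qed

lemma trajectory_lipschitz:
  assumes "continuous_on {0..T} \<beta>" "\<And>s. \<bar>\<beta> s\<bar> \<le> K" "norm z \<le> R" "s \<in> {0..T}" "t \<in> {0..T}"
  shows "\<bar>trajectory z \<beta> s - trajectory z \<beta> t\<bar> \<le> (R + K * T) * \<bar>s - t\<bar>"
  using field_differentiable_bound[of "{0..T}" "trajectory z \<beta>" "velocity z \<beta>" "R + K * T" s t]
    trajectory_deriv[OF assms(1)] velocity_bound[OF assms(1-3)] assms by auto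

lemma velocity_uniform_limit:
  assumes "T \<ge> 0" "z \<longlonglongrightarrow> z'" "uniform_limit {0..T} \<beta> \<beta>' sequentially"
    "\<And>n. continuous_on {0..T} (\<beta> n)"
  shows "uniform_limit {0..T} (\<lambda>n. velocity (z n) (\<beta> n)) (velocity z' \<beta>') sequentially"
  unfolding velocity_def[abs_def] using assms
  by (intro uniform_limit_intros uniform_limit_of_tendsto tendsto_snd
      uniform_limit_indefinite_integral)

lemma trajectory_uniform_limit:
  assumes "T \<ge> 0" "z \<longlonglongrightarrow> z'" "uniform_limit {0..T} \<beta> \<beta>' sequentially"
    "\<And>n. continuous_on {0..T} (\<beta> n)"
  shows "uniform_limit {0..T} (\<lambda>n. trajectory (z n) (\<beta> n)) (trajectory z' \<beta>') sequentially"
  unfolding trajectory_def[abs_def] using assms velocity_uniform_limit[OF assms]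
  by (intro uniform_limit_intros uniform_limit_of_tendsto tendsto_fst
      uniform_limit_indefinite_integral continuous_on_velocity)

lemma trajectory_cong:
  assumes "\<And>s. 0 \<le> s \<Longrightarrow> s \<le> t \<Longrightarrow> \<beta> s = \<gamma> s"
  shows "trajectory z \<beta> t = trajectory z \<gamma> t"
proof -
  have "velocity z \<beta> r = velocity z \<gamma> r" if "r \<in> {0..t}" for r
    unfolding velocity_def using that assms by (auto intro!: integral_cong)
  then have "integral {0..t} (velocity z \<beta>) = integral {0..t} (velocity z \<gamma>)"
    by (rule integral_cong)
  then show ?thesis by (simp add: trajectory_def)
qed

text \<open>With a delay \<open>d > 0\<close> the Picard iterates become stationary after finitely many steps, so
  the flow exists and is continuous in the initial state although \<open>h\<close> need not be Lipschitz.\<close>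

primrec delay_iter :: "(real \<Rightarrow> real \<Rightarrow> real) \<Rightarrow> real \<Rightarrow> real \<times> real \<Rightarrow> nat \<Rightarrow> real \<Rightarrow> real" where
  "delay_iter h d z 0 = (\<lambda>t. fst z)"
| "delay_iter h d z (Suc k) = trajectory z (\<lambda>s. h s (delay_iter h d z k (max 0 (s - d))))"

lemma continuous_on_delayed:
  fixes h :: "real \<Rightarrow> real \<Rightarrow> real \<Rightarrow> real"
  assumes h: "continuous_on UNIV (\<lambda>(t, x, l). h t x l)"
    and d: "d \<ge> 0" and X: "continuous_on {0..T} X"
  shows "continuous_on {0..T} (\<lambda>s. h s (X (max 0 (s - d))) l)"
proof -
  have "continuous_on {0..T} (\<lambda>s. X (max 0 (s - d)))"
    by (rule continuous_on_compose2[OF X]) (use d in \<open>auto intro!: continuous_intros\<close>)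
  then have "continuous_on {0..T} (\<lambda>s. (\<lambda>(t, x, l). h t x l) (s, X (max 0 (s - d)), l))"
    by (intro continuous_on_compose2[OF h]) (auto intro!: continuous_intros)
  then show ?thesis by simp
qed

lemma continuous_on_delay_iter:
  fixes h :: "real \<Rightarrow> real \<Rightarrow> real \<Rightarrow> real"
  assumes "continuous_on UNIV (\<lambda>(t, x, l). h t x l)" "d \<ge> 0"
  shows "continuous_on {0..T} (delay_iter (\<lambda>t x. h t x l) d z k)"
proof (induction k)
  case (Suc k)
  then show ?case
    using continuous_on_trajectory[OF continuous_on_delayed[OF assms]] by simp
qed simp

text \<open>A trajectory up to time \<open>t\<close> uses the previous iterate only up to
  \<open>max 0 (t - d)\<close>, and all iterates agree at time 0. So each further iteration settles
  another stretch of length \<open>d\<close>.\<close>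

lemma delay_iter_stable:
  assumes "0 \<le> t" "t \<le> real k * d" "d > 0"
  shows "delay_iter h d z (Suc k) t = delay_iter h d z (Suc (Suc k)) t"
  using assms
proof (induction k arbitrary: t)
  case (Suc k)
  have "delay_iter h d z (Suc k) (max 0 (s - d)) = delay_iter h d z (Suc (Suc k)) (max 0 (s - d))"
    if "0 \<le> s" "s \<le> t" for s
    using that Suc.prems by (intro Suc.IH) (auto simp: algebra_simps)
  then show ?case
    unfolding delay_iter.simps(2)[of h d z "Suc k"] delay_iter.simps(2)[of h d z "Suc (Suc k)"]
    by (intro trajectory_cong) simp
qed auto

text \<open>Joint continuity in the initial state and the parameter. It comes by induction over a
  fixed number of iterates, with continuity of \<open>h\<close> in place of a Gronwall
  estimate.\<close>

lemma delay_iter_uniform_limit: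
  fixes h :: "real \<Rightarrow> real \<Rightarrow> real \<Rightarrow> real"
  assumes h: "continuous_on UNIV (\<lambda>(t, x, l). h t x l)" and "d \<ge> 0" "T \<ge> 0"
    and z: "z \<longlonglongrightarrow> z'" and l: "l \<longlonglongrightarrow> l'"
  shows "uniform_limit {0..T} (\<lambda>n. delay_iter (\<lambda>t x. h t x (l n)) d (z n) k)
           (delay_iter (\<lambda>t x. h t x l') d z' k) sequentially"
proof (induction k)
  case 0
  show ?case using z by (auto intro!: uniform_limit_of_tendsto tendsto_intros)
next
  case (Suc k)
  have "uniform_limit {0..T} (\<lambda>n s. delay_iter (\<lambda>t x. h t x (l n)) d (z n) k (max 0 (s - d)))
      (\<lambda>s. delay_iter (\<lambda>t x. h t x l') d z' k (max 0 (s - d))) sequentially"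
    using assms(2,3) by (intro uniform_limit_compose'[OF Suc]) auto
  moreover have "continuous_on {0..T} (\<lambda>s. delay_iter (\<lambda>t x. h t x l') d z' k (max 0 (s - d)))"
    by (rule continuous_on_compose2[OF continuous_on_delay_iter[OF h \<open>d \<ge> 0\<close>, of T]])
       (use \<open>d \<ge> 0\<close> in \<open>auto intro!: continuous_intros\<close>)
  ultimately have "uniform_limit {0..T}
     (\<lambda>n s. h s (delay_iter (\<lambda>t x. h t x (l n)) d (z n) k (max 0 (s - d))) (l n))
     (\<lambda>s. h s (delay_iter (\<lambda>t x. h t x l') d z' k (max 0 (s - d))) l') sequentially"
    by (rule uniform_limit_superposition[OF h _ _ l compact_Icc])
  then show ?case
    unfolding delay_iter.simps
    by (intro trajectory_uniform_limit z \<open>T \<ge> 0\<close> continuous_on_delayed[OF h \<open>d \<ge> 0\<close>]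
        continuous_on_delay_iter[OF h \<open>d \<ge> 0\<close>])
qed

section \<open>Brouwer's theorem for the radially retracted flow\<close>

definition radial_retract :: "real \<Rightarrow> 'a::real_normed_vector \<Rightarrow> 'a" where
  "radial_retract R w = (R / max R (norm w)) *\<^sub>R w"

lemma continuous_on_radial_retract:
  "R > 0 \<Longrightarrow> continuous_on A (radial_retract R)"
  unfolding radial_retract_def[abs_def] by (intro continuous_intros) (auto simp: max_def)

lemma norm_radial_retract: "R > 0 \<Longrightarrow> norm (radial_retract R w) \<le> R"
  by (simp add: radial_retract_def field_simps max_def)

text \<open>The alternative of Poincare and Bohl: if retracting \<open>w\<close> gives
  \<open>z\<close>, then \<open>w\<close> is either \<open>z\<close> itself or an outward multiple
  of \<open>z\<close>, and in the second case \<open>z\<close> lies on the sphere. The factor is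
  \<open>max R (norm w) / R\<close>.\<close>

lemma radial_retract_fixed:
  assumes "R > 0" "radial_retract R w = z"
  obtains c where "c \<ge> 1" "w = c *\<^sub>R z" "c = 1 \<or> norm z = R"
proof
  let ?c = "max R (norm w) / R"
  show "?c \<ge> 1" using assms(1) by simp
  show "w = ?c *\<^sub>R z" using assms by (auto simp: radial_retract_def)
  show "?c = 1 \<or> norm z = R"
    using assms by (cases "w = 0") (auto simp: radial_retract_def max_def)
qed

text \<open>The parameter \<open>l\<close> of the equation (the angular momentum) is allowed to depend on the whole
  solution through a functional \<open>\<Lambda>\<close>, so it is an additional unknown of the shooting map.\<close>

definition admissible_parameter :: "real \<Rightarrow> ((real \<Rightarrow> real) \<Rightarrow> real) \<Rightarrow> bool" where
  "admissible_parameter T \<Lambda> \<longleftrightarrow> (\<forall>x. \<Lambda> x \<in> {0..1}) \<and>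
     (\<forall>X x. (\<forall>n. continuous_on {0..T} (X n)) \<longrightarrow> uniform_limit {0..T} X x sequentially \<longrightarrow>
        (\<lambda>n. \<Lambda> (X n)) \<longlonglongrightarrow> \<Lambda> x)"

lemma admissible_parameterD:
  assumes "admissible_parameter T \<Lambda>"
  shows "\<Lambda> x \<in> {0..1}"
    "(\<And>n. continuous_on {0..T} (X n)) \<Longrightarrow> uniform_limit {0..T} X x sequentially \<Longrightarrow>
      (\<lambda>n. \<Lambda> (X n)) \<longlonglongrightarrow> \<Lambda> x"
  using assms unfolding admissible_parameter_def by blast+

lemma delayed_shooting:
  fixes h :: "real \<Rightarrow> real \<Rightarrow> real \<Rightarrow> real" and \<Lambda> :: "(real \<Rightarrow> real) \<Rightarrow> real"
  assumes h: "continuous_on UNIV (\<lambda>(t, x, l). h t x l)" and "T > 0" "R > 0" "d > 0"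
    and \<Lambda>: "admissible_parameter T \<Lambda>"
  shows "\<exists>z X. norm z \<le> R \<and> continuous_on {0..T} X \<and>
     (\<forall>t\<in>{0..T}. X t = trajectory z (\<lambda>s. h s (X (max 0 (s - d))) (\<Lambda> X)) t) \<and>
     z = radial_retract R (trajectory z (\<lambda>s. h s (X (max 0 (s - d))) (\<Lambda> X)) T,
                           velocity z (\<lambda>s. h s (X (max 0 (s - d))) (\<Lambda> X)) T)"
proof -
  \<comment> \<open>After \<open>m\<close> delays the interval \<open>{0..T}\<close> is covered, so
    iterate \<open>Suc m\<close> already solves the delayed equation there.\<close>
  obtain m :: nat where m: "T \<le> real m * d"
    using \<open>d > 0\<close> ex_less_of_nat_mult less_imp_le by blast
  define X where "X z l = delay_iter (\<lambda>t x. h t x l) d z (Suc m)" for z l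
  define B where "B z l = (\<lambda>s. h s (X z l (max 0 (s - d))) l)" for z l
  have d0: "d \<ge> 0" and T0: "T \<ge> 0" using assms by auto
  have Xcont: "continuous_on {0..T} (X z l)" for z l
    unfolding X_def by (rule continuous_on_delay_iter[OF h d0])
  have Bcont: "continuous_on {0..T} (B z l)" for z l
    unfolding B_def by (rule continuous_on_delayed[OF h d0 Xcont])
  have Xeq: "X z l t = trajectory z (B z l) t" if "t \<in> {0..T}" for z l t
    using delay_iter_stable[of t m d "\<lambda>t x. h t x l" z] that m \<open>d > 0\<close>
    by (simp only: X_def B_def delay_iter.simps(2)[of _ _ _ "Suc m"]) auto
  \<comment> \<open>The retraction keeps the first component in the ball. A fixed second component
    says that the parameter \<open>l\<close> is the value of \<open>\<Lambda>\<close> on the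
    trajectory computed with \<open>l\<close>.\<close>
  define F where
    "F = (\<lambda>(z, l). (radial_retract R (trajectory z (B z l) T, velocity z (B z l) T), \<Lambda> (X z l)))"
  let ?K = "cball (0 :: real \<times> real) R \<times> {0..1 :: real}"
  have "continuous_on ?K F"
    unfolding continuous_on_sequentially
  proof (intro allI ballI impI)
    fix u :: "nat \<Rightarrow> (real \<times> real) \<times> real" and a
    assume "(\<forall>n. u n \<in> ?K) \<and> u \<longlonglongrightarrow> a"
    then have u: "(\<lambda>n. fst (u n)) \<longlonglongrightarrow> fst a" "(\<lambda>n. snd (u n)) \<longlonglongrightarrow> snd a"
      by (auto intro: tendsto_fst tendsto_snd)
    have Xlim: "uniform_limit {0..T} (\<lambda>n. X (fst (u n)) (snd (u n))) (X (fst a) (snd a)) sequentially"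
      unfolding X_def by (rule delay_iter_uniform_limit[OF h d0 T0 u])
    have "uniform_limit {0..T} (\<lambda>n s. X (fst (u n)) (snd (u n)) (max 0 (s - d)))
        (\<lambda>s. X (fst a) (snd a) (max 0 (s - d))) sequentially"
      using d0 T0 by (intro uniform_limit_compose'[OF Xlim]) auto
    moreover have "continuous_on {0..T} (\<lambda>s. X (fst a) (snd a) (max 0 (s - d)))"
      by (rule continuous_on_compose2[OF Xcont]) (use d0 in \<open>auto intro!: continuous_intros\<close>)
    ultimately have Blim: "uniform_limit {0..T} (\<lambda>n. B (fst (u n)) (snd (u n))) (B (fst a) (snd a)) sequentially"
      unfolding B_def by (rule uniform_limit_superposition[OF h _ _ u(2) compact_Icc])
    have "(\<lambda>n. trajectory (fst (u n)) (B (fst (u n)) (snd (u n))) T)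
        \<longlonglongrightarrow> trajectory (fst a) (B (fst a) (snd a)) T"
      using tendsto_uniform_limitI[OF trajectory_uniform_limit[OF T0 u(1) Blim Bcont]] T0 by auto
    moreover have "(\<lambda>n. velocity (fst (u n)) (B (fst (u n)) (snd (u n))) T)
        \<longlonglongrightarrow> velocity (fst a) (B (fst a) (snd a)) T"
      using tendsto_uniform_limitI[OF velocity_uniform_limit[OF T0 u(1) Blim Bcont]] T0 by auto
    moreover have "(\<lambda>n. \<Lambda> (X (fst (u n)) (snd (u n)))) \<longlonglongrightarrow> \<Lambda> (X (fst a) (snd a))"
      by (rule admissible_parameterD(2)[OF \<Lambda> Xcont Xlim])
    ultimately show "(F \<circ> u) \<longlonglongrightarrow> F a"
      unfolding F_def comp_def split_beta
      using \<open>R > 0\<close>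
      by (intro tendsto_Pair continuous_on_tendsto_compose[OF continuous_on_radial_retract[of R UNIV]])
         auto
  qed
  moreover have "F \<in> ?K \<rightarrow> ?K"
    using admissible_parameterD(1)[OF \<Lambda>] \<open>R > 0\<close>
    by (auto simp: F_def dist_norm norm_radial_retract)
  moreover have "compact ?K" "convex ?K" "?K \<noteq> {}"
    using \<open>R > 0\<close> by (auto intro!: compact_Times convex_Times)
  ultimately obtain a where a: "a \<in> ?K" "F a = a" using brouwer by metis
  obtain z l where zl: "a = (z, l)" by (cases a)
  have r: "radial_retract R (trajectory z (B z l) T, velocity z (B z l) T) = z" and l: "\<Lambda> (X z l) = l"
    using a(2) by (simp_all add: F_def zl)
  have B: "(\<lambda>s. h s (X z l (max 0 (s - d))) (\<Lambda> (X z l))) = B z l"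
    by (simp add: B_def l)
  have "norm z \<le> R" using a(1) by (simp add: zl)
  then show ?thesis
    using Xcont Xeq r by (intro exI[of _ z] exI[of _ "X z l"]) (simp add: B)
qed

text \<open>Delayed solutions for \<open>d n\<close> tending to 0 share the bound \<open>K\<close>
  on the acceleration, hence the Lipschitz constant \<open>R + K * T\<close>. A subsequence of the
  positions, initial states and parameters converges, and the acceleration converges with
  them.\<close>

lemma shooting:
  fixes h :: "real \<Rightarrow> real \<Rightarrow> real \<Rightarrow> real" and \<Lambda> :: "(real \<Rightarrow> real) \<Rightarrow> real"
  assumes h: "continuous_on UNIV (\<lambda>(t, x, l). h t x l)" and "T > 0" "R > 0"
    and K: "\<And>t x l. \<bar>h t x l\<bar> \<le> K"
    and \<Lambda>: "admissible_parameter T \<Lambda>"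
  obtains x v c where
    "\<And>t. t \<in> {0..T} \<Longrightarrow> (x has_real_derivative v t) (at t within {0..T})"
    "\<And>t. t \<in> {0..T} \<Longrightarrow> (v has_real_derivative - h t (x t) (\<Lambda> x)) (at t within {0..T})"
    "norm (x 0, v 0) \<le> R" "x T = c * x 0" "v T = c * v 0" "c \<ge> 1" "c = 1 \<or> norm (x 0, v 0) = R"
proof -
  define d where "d n = inverse (real (Suc n))" for n
  have d: "d n > 0" for n by (simp add: d_def)
  have T0: "T \<ge> 0" using \<open>T > 0\<close> by simp
  define P where "P n z X \<longleftrightarrow> norm z \<le> R \<and> continuous_on {0..T} X \<and>
     (\<forall>t\<in>{0..T}. X t = trajectory z (\<lambda>s. h s (X (max 0 (s - d n))) (\<Lambda> X)) t) \<and>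
     z = radial_retract R (trajectory z (\<lambda>s. h s (X (max 0 (s - d n))) (\<Lambda> X)) T,
                           velocity z (\<lambda>s. h s (X (max 0 (s - d n))) (\<Lambda> X)) T)" for n z X
  have "\<exists>z X. P n z X" for n
    unfolding P_def
    by (rule delayed_shooting[of h T R "d n" \<Lambda>, OF h \<open>T > 0\<close> \<open>R > 0\<close> d[of n] \<Lambda>])
  then obtain z X where zX: "\<And>n. P n (z n) (X n)" by metis
  define B where "B n = (\<lambda>s. h s (X n (max 0 (s - d n))) (\<Lambda> (X n)))" for n
  have z: "norm (z n) \<le> R" and Xc: "continuous_on {0..T} (X n)" for n
    using zX[of n] by (auto simp: P_def)
  have Xeq: "X n t = trajectory (z n) (B n) t" if "t \<in> {0..T}" for n t
    using zX[of n] that by (simp add: P_def B_def)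
  have zeq: "z n = radial_retract R (trajectory (z n) (B n) T, velocity (z n) (B n) T)" for n
    using zX[of n] unfolding P_def B_def by blast
  have Bc: "continuous_on {0..T} (B n)" for n
    unfolding B_def using d[of n] by (intro continuous_on_delayed[OF h] Xc) auto
  have Bb: "\<bar>B n s\<bar> \<le> K" for n s by (simp add: B_def K)
  define Lip where "Lip = R + K * T"
  have Lip0: "Lip \<ge> 0"
    using K[of 0 0 0] \<open>R > 0\<close> T0 abs_ge_zero[of "h 0 0 0"] unfolding Lip_def
    by (intro add_nonneg_nonneg mult_nonneg_nonneg) linarith+
  have Xlip: "\<bar>X n s - X n t\<bar> \<le> Lip * \<bar>s - t\<bar>" if "s \<in> {0..T}" "t \<in> {0..T}" for n s t
    using trajectory_lipschitz[OF Bc Bb z that] that by (simp add: Lip_def Xeq)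
  have "compact (cball (0 :: real \<times> real) R \<times> {0..1 :: real})" by (intro compact_Times) auto
  then have "seq_compact (cball (0 :: real \<times> real) R \<times> {0..1 :: real})"
    by (rule compact_imp_seq_compact)
  moreover have "\<forall>n. (z n, \<Lambda> (X n)) \<in> cball 0 R \<times> {0..1}"
    using z admissible_parameterD(1)[OF \<Lambda>] by (simp del: atLeastAtMost_iff)
  ultimately obtain a r1 where r1: "strict_mono (r1 :: nat \<Rightarrow> nat)"
    "((\<lambda>n. (z n, \<Lambda> (X n))) \<circ> r1) \<longlonglongrightarrow> a"
    by (rule seq_compactE)
  have Xb: "norm ((X \<circ> r1) n t) \<le> R + (R + K * T) * T" if "t \<in> {0..T}" for n t
    using trajectory_bound[OF Bc Bb z that] that by (simp add: Xeq)
  have Xl: "norm ((X \<circ> r1) n s - (X \<circ> r1) n t) \<le> Lip * \<bar>s - t\<bar>" if "s \<in> {0..T}" "t \<in> {0..T}" for n s t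
    using Xlip[OF that] by simp
  obtain r2 g where r2: "strict_mono (r2 :: nat \<Rightarrow> nat)" and g: "continuous_on {0..T} g"
    and conv: "uniform_limit {0..T} (\<lambda>n. (X \<circ> r1) (r2 n)) g sequentially"
    by (rule Arzela_Ascoli_Lipschitz[OF Xb Xl])
  define s where "s = r1 \<circ> r2"
  have s: "strict_mono s" using r1 r2 by (simp add: s_def strict_mono_o)
  have Xlim: "uniform_limit {0..T} (\<lambda>n. X (s n)) g sequentially"
    using conv by (simp add: s_def)
  have "((\<lambda>n. (z n, \<Lambda> (X n))) \<circ> s) \<longlonglongrightarrow> a"
    using LIMSEQ_subseq_LIMSEQ[OF r1(2) r2] by (simp add: s_def o_assoc)
  then have zlim: "(\<lambda>n. z (s n)) \<longlonglongrightarrow> fst a" and llim: "(\<lambda>n. \<Lambda> (X (s n))) \<longlonglongrightarrow> snd a"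
    by (auto simp: comp_def dest: tendsto_fst tendsto_snd)
  have \<Lambda>g: "\<Lambda> g = snd a"
    using LIMSEQ_unique[OF admissible_parameterD(2)[OF \<Lambda> Xc Xlim] llim] .
  have dlim: "(\<lambda>n. d (s n)) \<longlonglongrightarrow> 0"
    using LIMSEQ_subseq_LIMSEQ[OF LIMSEQ_inverse_real_of_nat s] by (simp add: d_def comp_def)
  \<comment> \<open>The delay disappears in the limit because one Lipschitz constant serves all
    \<open>X n\<close>: shifting the time by \<open>d\<close> moves the position by at most
    \<open>Lip * d\<close>.\<close>
  have "uniform_limit {0..T} (\<lambda>n t. X (s n) (max 0 (t - d (s n))) - X (s n) t) (\<lambda>t. 0) sequentially"
  proof (rule uniform_limit_null_comparison)
    show "\<forall>\<^sub>F n in sequentially. \<forall>t\<in>{0..T}.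
        norm (X (s n) (max 0 (t - d (s n))) - X (s n) t) \<le> Lip * d (s n)"
    proof (intro always_eventually allI ballI)
      fix n t assume t: "t \<in> {0..T}"
      have "norm (X (s n) (max 0 (t - d (s n))) - X (s n) t) \<le> Lip * \<bar>max 0 (t - d (s n)) - t\<bar>"
        using t d[of "s n"] Xlip[of "max 0 (t - d (s n))" t "s n"] by auto
      also have "\<dots> \<le> Lip * d (s n)"
        using t d[of "s n"] Lip0 by (intro mult_left_mono) auto
      finally show "norm (X (s n) (max 0 (t - d (s n))) - X (s n) t) \<le> Lip * d (s n)" .
    qed
    show "uniform_limit {0..T} (\<lambda>n t. Lip * d (s n)) (\<lambda>t. 0) sequentially"
      using tendsto_mult_right_zero[OF dlim] by (intro uniform_limit_of_tendsto) 
  qed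
  from uniform_limit_add[OF this Xlim]
  have "uniform_limit {0..T} (\<lambda>n t. X (s n) (max 0 (t - d (s n)))) g sequentially"
    by simp
  then have Blim: "uniform_limit {0..T} (\<lambda>n. B (s n)) (\<lambda>t. h t (g t) (\<Lambda> g)) sequentially"
    unfolding B_def \<Lambda>g using g by (intro uniform_limit_superposition[OF h _ _ llim compact_Icc])
  define \<beta> where "\<beta> = (\<lambda>t. h t (g t) (\<Lambda> g))"
  define x v where "x = trajectory (fst a) \<beta>" and "v = velocity (fst a) \<beta>"
  have \<beta>c: "continuous_on {0..T} \<beta>"
    unfolding \<beta>_def by (rule uniform_limit_theorem[OF _ Blim]) (auto simp: Bc)
  have xlim: "uniform_limit {0..T} (\<lambda>n. trajectory (z (s n)) (B (s n))) x sequentially"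
    unfolding x_def \<beta>_def by (rule trajectory_uniform_limit[OF T0 zlim Blim Bc])
  have vlim: "uniform_limit {0..T} (\<lambda>n. velocity (z (s n)) (B (s n))) v sequentially"
    unfolding v_def \<beta>_def by (rule velocity_uniform_limit[OF T0 zlim Blim Bc])
  have gx: "g t = x t" if "t \<in> {0..T}" for t
    using LIMSEQ_unique[OF tendsto_uniform_limitI[OF Xlim that]] tendsto_uniform_limitI[OF xlim that] that
    by (simp add: Xeq)
  \<comment> \<open>\<open>g\<close> and \<open>x\<close> are known to agree on
    \<open>{0..T}\<close> only. Continuity of \<open>\<Lambda>\<close> along the constant sequence
    \<open>g\<close> shows that \<open>\<Lambda>\<close> cannot tell them apart.\<close>
  have "uniform_limit {0..T} (\<lambda>n::nat. g) x sequentially"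
    by (intro uniform_limitI) (simp add: gx)
  then have \<Lambda>x: "\<Lambda> x = \<Lambda> g"
    using admissible_parameterD(2)[OF \<Lambda>, of "\<lambda>n. g" x] g by (simp add: LIMSEQ_const_iff)
  have "(\<lambda>n. radial_retract R (trajectory (z (s n)) (B (s n)) T, velocity (z (s n)) (B (s n)) T))
     \<longlonglongrightarrow> radial_retract R (x T, v T)"
  proof (rule continuous_on_tendsto_compose[OF continuous_on_radial_retract[of R UNIV]])
    show "(\<lambda>n. (trajectory (z (s n)) (B (s n)) T, velocity (z (s n)) (B (s n)) T)) \<longlonglongrightarrow> (x T, v T)"
      using T0 by (intro tendsto_Pair tendsto_uniform_limitI[OF xlim] tendsto_uniform_limitI[OF vlim]) simp_all
  qed (use \<open>R > 0\<close> in simp_all)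
  then have ra: "radial_retract R (x T, v T) = fst a"
    unfolding zeq[symmetric] by (rule LIMSEQ_unique[OF _ zlim])
  then obtain c where c: "c \<ge> 1" "(x T, v T) = c *\<^sub>R fst a" "c = 1 \<or> norm (fst a) = R"
    using radial_retract_fixed[OF \<open>R > 0\<close> ra] by blast
  have a: "(x 0, v 0) = fst a" by (simp add: x_def v_def)
  show thesis
  proof (rule that[of x v c])
    show "(x has_real_derivative v t) (at t within {0..T})" if "t \<in> {0..T}" for t
      unfolding x_def v_def by (rule trajectory_deriv[OF \<beta>c that])
    show "(v has_real_derivative - h t (x t) (\<Lambda> x)) (at t within {0..T})" if "t \<in> {0..T}" for t
      using velocity_deriv[OF \<beta>c that, of "fst a"] gx[OF that] by (simp add: v_def \<beta>_def \<Lambda>x)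
    show "norm (x 0, v 0) \<le> R" using norm_radial_retract[OF \<open>R > 0\<close>, of "(x T, v T)"] ra a by simp
    show "x T = c * x 0" "v T = c * v 0" using c(2) a[symmetric] by auto
    show "c \<ge> 1" "c = 1 \<or> norm (x 0, v 0) = R" using c a by auto
  qed
qed

section \<open>Counting turns\<close>

lemma real_antiderivative:
  fixes f :: "real \<Rightarrow> real"
  assumes "continuous_on UNIV f"
  obtains F where "\<And>x. (F has_real_derivative f x) (at x)"
proof -
  have "\<exists>F. \<forall>x. - \<infinity> < ereal x \<longrightarrow> ereal x < \<infinity> \<longrightarrow> (F has_vector_derivative f x) (at x)"
    using assms by (intro einterval_antiderivative) (auto simp: continuous_on_eq_continuous_at)
  then show thesis
    using that by (auto simp: has_real_derivative_iff_has_vector_derivative)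
qed

lemma mvt_within:
  fixes f :: "real \<Rightarrow> real"
  assumes "a < b" "\<And>t. t \<in> {a..b} \<Longrightarrow> (f has_real_derivative f' t) (at t within {a..b})"
  obtains t where "a < t" "t < b" "f b - f a = f' t * (b - a)"
  using mvt_simple[of a b f "\<lambda>t h. f' t * h"] assms
  by (auto simp: has_field_derivative_def mult_commute_abs)

text \<open>The usual antiderivative \<open>arctan (k * tan \<theta>) / k\<close> breaks at the
  poles of \<open>tan\<close>. By the subtraction formula,
  \<open>arctan (k * tan \<theta>) - \<theta>\<close> is the arctan of the displayed quotient up to
  multiples of \<open>pi\<close>, and this form is smooth for all \<theta> because
  \<open>k > 0\<close>.\<close>

lemma half_turn_antiderivative:
  fixes k \<theta> :: real
  assumes k: "k > 0"
  shows "((\<lambda>\<theta>. (\<theta> + arctan ((k - 1) * sin \<theta> * cos \<theta> / ((cos \<theta>)\<^sup>2 + k * (sin \<theta>)\<^sup>2))) / k)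
    has_real_derivative 1 / ((cos \<theta>)\<^sup>2 + k\<^sup>2 * (sin \<theta>)\<^sup>2)) (at \<theta>)"
proof -
  define s c where "s = sin \<theta>" and "c = cos \<theta>"
  have sc: "s\<^sup>2 + c\<^sup>2 = 1" by (simp add: s_def c_def)
  have pos: "c\<^sup>2 + m * s\<^sup>2 > 0" if "m > 0" for m
  proof (cases "s = 0")
    case False
    then show ?thesis using that by (intro add_nonneg_pos) auto
  qed (use sc in auto)
  define p where "p = c\<^sup>2 + k * s\<^sup>2"
  have p: "p > 0" using pos[OF k] by (simp add: p_def)
  have q: "c\<^sup>2 + k\<^sup>2 * s\<^sup>2 > 0" using pos[of "k\<^sup>2"] k by simp
  define u where "u = (k - 1) * s * c / p"
  define u' where "u' = ((k - 1) * (c * c - s * s) * p - (k - 1) * s * c * (2 * (k - 1) * s * c)) / (p * p)"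
  have du: "((\<lambda>\<theta>. (k - 1) * sin \<theta> * cos \<theta> / ((cos \<theta>)\<^sup>2 + k * (sin \<theta>)\<^sup>2)) has_real_derivative u') (at \<theta>)"
    using p unfolding u'_def p_def s_def c_def
    by (auto intro!: derivative_eq_intros simp: divide_simps power2_eq_square algebra_simps)
  have c2: "c\<^sup>2 = 1 - s\<^sup>2" using sc by simp
  have "u'= (k - 1) * (c\<^sup>2 - k * s\<^sup>2) / p\<^sup>2"
  proof -
    \<comment> \<open>The factor \<open>s\<^sup>2 + c\<^sup>2\<close>, equal to 1, makes both sides
      homogeneous, so that this is a polynomial identity.\<close>
    have "(c * c - s * s) * p - s * c * (2 * (k - 1) * s * c) = (s\<^sup>2 + c\<^sup>2) * (c\<^sup>2 - k * s\<^sup>2)"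
      unfolding p_def by algebra
    then have "(k - 1) * (c * c - s * s) * p - (k - 1) * s * c * (2 * (k - 1) * s * c)
        = (k - 1) * (c\<^sup>2 - k * s\<^sup>2)"
      unfolding sc by (metis (no_types, lifting) mult.assoc mult.left_neutral right_diff_distrib)
    then show ?thesis unfolding u'_def by (simp add: power2_eq_square)
  qed
  moreover have "1 + u\<^sup>2 = (c\<^sup>2 + k\<^sup>2 * s\<^sup>2) / p\<^sup>2"
  proof -
    have "p\<^sup>2 + ((k - 1) * s * c)\<^sup>2 = (s\<^sup>2 + c\<^sup>2) * (c\<^sup>2 + k\<^sup>2 * s\<^sup>2)"
      unfolding p_def by algebra
    then have "p\<^sup>2 + ((k - 1) * s * c)\<^sup>2 = c\<^sup>2 + k\<^sup>2 * s\<^sup>2" unfolding sc by simp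
    then show ?thesis using p by (simp add: u_def power_divide field_simps)
  qed
  ultimately have "u' / (1 + u\<^sup>2) = (k - 1) * (c\<^sup>2 - k * s\<^sup>2) / (c\<^sup>2 + k\<^sup>2 * s\<^sup>2)"
    using p by simp
  also have "\<dots> = k * (s\<^sup>2 + c\<^sup>2) / (c\<^sup>2 + k\<^sup>2 * s\<^sup>2) - 1"
    using q by (simp add: field_simps power2_eq_square)
  finally have fin: "(1 + u' / (1 + u\<^sup>2)) / k = 1 / (c\<^sup>2 + k\<^sup>2 * s\<^sup>2)"
    using k unfolding sc by simp
  have "((\<lambda>\<theta>. (\<theta> + arctan ((k - 1) * sin \<theta> * cos \<theta> / ((cos \<theta>)\<^sup>2 + k * (sin \<theta>)\<^sup>2))) / k)
    has_real_derivative (1 + u' / (1 + u\<^sup>2)) / k) (at \<theta>)"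
    using DERIV_cdivide[OF DERIV_add[OF DERIV_ident DERIV_chain2[OF DERIV_arctan du]], of k]
    unfolding u_def p_def s_def c_def by (simp add: divide_inverse mult.commute)
  then show ?thesis unfolding fin s_def c_def .
qed

text \<open>
  The wall sits at \<open>x = 0\<close> and is replaced by a spring of stiffness \<open>b\<^sup>2\<close> acting on \<open>x < 0\<close>;
  \<open>wall_energy a b\<close> is twice the energy of the oscillator with stiffness \<open>a\<^sup>2\<close> on the free side.
\<close>

definition pos_part :: "real \<Rightarrow> real" where "pos_part x = max 0 x"

definition wall_energy :: "real \<Rightarrow> real \<Rightarrow> real \<Rightarrow> real \<Rightarrow> real" where
  "wall_energy a b x v = v\<^sup>2 + (a * pos_part x)\<^sup>2 + (b * pos_part (- x))\<^sup>2"

lemma wall_energy_scale: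
  assumes "r \<ge> 0"
  shows "wall_energy a b (r * x) (r * v) = r\<^sup>2 * wall_energy a b x v"
proof -
  have "pos_part (r * y) = r * pos_part y" for y
    using assms by (simp add: pos_part_def max_mult_distrib_left)
  from this[of x] this[of "- x"] show ?thesis
    by (simp add: wall_energy_def power_mult_distrib algebra_simps)
qed

lemma wall_energy_pos:
  assumes "a \<noteq> 0" "b \<noteq> 0" "x \<noteq> 0 \<or> v \<noteq> 0"
  shows "wall_energy a b x v > 0"
proof (cases "v = 0")
  case True
  then show ?thesis using assms
    by (cases "x > 0") (auto simp: wall_energy_def pos_part_def)
next
  case False
  then show ?thesis unfolding wall_energy_def by (simp add: add_pos_nonneg)
qed

text \<open>\<open>\<Psi>\<close> turns the polar angle into elapsed time of the piecewise linear oscillator, whose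
  period is \<open>pi / a + pi / b\<close>.\<close>

lemma turn_time:
  fixes a b :: real
  assumes a: "a > 0" and b: "b > 0"
  obtains \<Psi> where "\<And>\<theta>. (\<Psi> has_real_derivative 1 / wall_energy a b (sin \<theta>) (cos \<theta>)) (at \<theta>)"
    "\<And>\<theta> (j::int). \<Psi> (\<theta> + of_int j * (2 * pi)) = \<Psi> \<theta> + of_int j * (pi / a + pi / b)"
proof -
  let ?W = "\<lambda>\<theta>. wall_energy a b (sin \<theta>) (cos \<theta>)"
  have W: "?W \<theta> > 0" for \<theta>
    using a b sin_zero_norm_cos_one[of \<theta>] by (intro wall_energy_pos) auto
  have "continuous_on UNIV (\<lambda>\<theta>. 1 / ?W \<theta>)"
    using W unfolding wall_energy_def pos_part_def
    by (intro continuous_intros) (auto simp: less_imp_neq[symmetric])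
  then obtain \<Psi> where \<Psi>: "\<And>\<theta>. (\<Psi> has_real_derivative 1 / ?W \<theta>) (at \<theta>)"
    by (rule real_antiderivative) blast
  let ?G = "\<lambda>k \<theta>. (\<theta> + arctan ((k - 1) * sin \<theta> * cos \<theta> / ((cos \<theta>)\<^sup>2 + k * (sin \<theta>)\<^sup>2))) / k"
  \<comment> \<open>On a half circle where the sign of \<open>sin\<close> is constant,
    \<open>wall_energy\<close> is a quadratic form, and \<open>\<Psi>\<close> differs from the
    explicit antiderivative by a constant. The half circle with \<open>sin \<ge> 0\<close>
    contributes \<open>pi / a\<close>, the other one \<open>pi / b\<close>.\<close>
  have part: "\<Psi> y - \<Psi> x = ?G k y - ?G k x"
    if "x \<le> y" "k > 0" "\<And>\<theta>. \<theta> \<in> {x..y} \<Longrightarrow> ?W \<theta> = (cos \<theta>)\<^sup>2 + k\<^sup>2 * (sin \<theta>)\<^sup>2" for x y k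
  proof -
    have "((\<lambda>\<theta>. \<Psi> \<theta> - ?G k \<theta>) has_real_derivative 0) (at \<theta> within {x..y})" if "\<theta> \<in> {x..y}" for \<theta>
      using DERIV_diff[OF \<Psi>[of \<theta>] half_turn_antiderivative[OF \<open>k > 0\<close>, of \<theta>]]
        \<open>\<And>\<theta>. \<theta> \<in> {x..y} \<Longrightarrow> _\<close>[OF that] by (simp add: has_field_derivative_at_within)
    then obtain d where "\<forall>\<theta>\<in>{x..y}. \<Psi> \<theta> - ?G k \<theta> = d"
      using has_field_derivative_zero_constant[of "{x..y}" "\<lambda>\<theta>. \<Psi> \<theta> - ?G k \<theta>"] by auto
    then have "\<Psi> y - ?G k y = d" "\<Psi> x - ?G k x = d" using \<open>x \<le> y\<close> by auto
    then show ?thesis by linarith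
  qed
  have "\<Psi> pi - \<Psi> 0 = ?G a pi - ?G a 0"
  proof (rule part[OF _ a])
    fix \<theta> assume "\<theta> \<in> {0..pi}"
    then have "sin \<theta> \<ge> 0" by (simp add: sin_ge_zero)
    then show "?W \<theta> = (cos \<theta>)\<^sup>2 + a\<^sup>2 * (sin \<theta>)\<^sup>2"
      by (simp add: wall_energy_def pos_part_def power_mult_distrib)
  qed simp
  moreover have "\<Psi> (2 * pi) - \<Psi> pi = ?G b (2 * pi) - ?G b pi"
  proof (rule part[OF _ b])
    fix \<theta> assume "\<theta> \<in> {pi..2 * pi}"
    then have "sin \<theta> \<le> 0" using sin_ge_zero[of "\<theta> - pi"] by (simp add: sin_diff)
    then show "?W \<theta> = (cos \<theta>)\<^sup>2 + b\<^sup>2 * (sin \<theta>)\<^sup>2"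
      by (simp add: wall_energy_def pos_part_def power_mult_distrib)
  qed simp
  ultimately have turn0: "\<Psi> (2 * pi) - \<Psi> 0 = pi / a + pi / b"
    by (simp add: diff_divide_distrib[symmetric])
  \<comment> \<open>The integrand is \<open>2 * pi\<close>-periodic, so the gain over a full turn
    does not depend on where the turn starts.\<close>
  have "((\<lambda>\<theta>. \<Psi> (\<theta> + 2 * pi) - \<Psi> \<theta>) has_real_derivative 0) (at \<theta>)" for \<theta>
    using DERIV_diff[OF DERIV_shift[THEN iffD1, OF \<Psi>[of "\<theta> + 2 * pi"]] \<Psi>[of \<theta>]] by simp
  then have turn: "\<Psi> (\<theta> + 2 * pi) = \<Psi> \<theta> + (pi / a + pi / b)" for \<theta>
    using DERIV_isconst_all[of "\<lambda>\<theta>. \<Psi> (\<theta> + 2 * pi) - \<Psi> \<theta>" \<theta> 0] turn0 by auto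
  have turns: "\<Psi> (\<theta> + of_int j * (2 * pi)) = \<Psi> \<theta> + of_int j * (pi / a + pi / b)" for \<theta> and j :: int
  proof (induction j rule: int_induct[where k = 0])
    case (step1 j)
    have "\<theta> + of_int (j + 1) * (2 * pi) = (\<theta> + of_int j * (2 * pi)) + 2 * pi"
      by (simp add: algebra_simps)
    then show ?case using step1 turn[of "\<theta> + of_int j * (2 * pi)"] by (simp add: algebra_simps)
  next
    case (step2 j)
    have "\<theta> + of_int j * (2 * pi) = (\<theta> + of_int (j - 1) * (2 * pi)) + 2 * pi"
      by (simp add: algebra_simps)
    then show ?case using step2 turn[of "\<theta> + of_int (j - 1) * (2 * pi)"] by (simp add: algebra_simps)
  qed simp
  show thesis by (rule that[OF \<Psi> turns])
qed

text \<open>The curve \<open>v + i x\<close> avoids 0, so integrating its logarithmic derivative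
  from \<open>Ln (z 0)\<close> gives a continuous logarithm, whose imaginary part is the angle. With
  \<open>v\<close> as real part the free motion increases the angle.\<close>

lemma polar_angle:
  fixes x v H :: "real \<Rightarrow> real"
  assumes x: "\<And>t. t \<in> {0..T} \<Longrightarrow> (x has_real_derivative v t) (at t within {0..T})"
    and v: "\<And>t. t \<in> {0..T} \<Longrightarrow> (v has_real_derivative - H t) (at t within {0..T})"
    and H: "continuous_on {0..T} H" and T: "T > 0"
    and nz: "\<And>t. t \<in> {0..T} \<Longrightarrow> x t \<noteq> 0 \<or> v t \<noteq> 0"
  obtains \<theta> where
    "\<And>t. t \<in> {0..T} \<Longrightarrow> (\<theta> has_real_derivative ((v t)\<^sup>2 + x t * H t) / ((v t)\<^sup>2 + (x t)\<^sup>2)) (at t within {0..T})"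
    "\<And>t. t \<in> {0..T} \<Longrightarrow> x t = sqrt ((v t)\<^sup>2 + (x t)\<^sup>2) * sin (\<theta> t)"
    "\<And>t. t \<in> {0..T} \<Longrightarrow> v t = sqrt ((v t)\<^sup>2 + (x t)\<^sup>2) * cos (\<theta> t)"
proof -
  define z where "z t = Complex (v t) (x t)" for t
  define z' where "z' t = Complex (- H t) (v t)" for t
  have z: "(z has_vector_derivative z' t) (at t within {0..T})" if "t \<in> {0..T}" for t
    unfolding z_def z'_def using x[OF that] v[OF that]
    by (intro has_vector_derivative_complex_iff[THEN iffD2]) (auto simp: has_real_derivative_iff_has_vector_derivative)
  have z0: "z t \<noteq> 0" if "t \<in> {0..T}" for t
    using nz[OF that] by (auto simp: z_def complex_eq_iff)
  have "continuous_on {0..T} z"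
    by (rule continuous_on_vector_derivative[OF z])
  moreover have "continuous_on {0..T} v" by (rule DERIV_continuous_on[OF v])
  ultimately have cont: "continuous_on {0..T} (\<lambda>t. z' t / z t)"
    unfolding z'_def Complex_eq using H z0 by (intro continuous_intros) auto
  define g where "g t = Ln (z 0) + integral {0..t} (\<lambda>t. z' t / z t)" for t
  have g: "(g has_vector_derivative z' t / z t) (at t within {0..T})" if "t \<in> {0..T}" for t
    unfolding g_def using integral_has_vector_derivative[OF cont that]
    by (auto intro!: derivative_eq_intros)
  have "((\<lambda>t. z t * exp (- g t)) has_vector_derivative 0) (at t within {0..T})" if t: "t \<in> {0..T}" for t
  proof -
    have "((\<lambda>t. exp (- g t)) has_vector_derivative (- (z' t / z t)) * exp (- g t)) (at t within {0..T})"
      using field_vector_diff_chain_within[OF has_vector_derivative_minus[OF g[OF t]], of exp "exp (- g t)"]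
      by (auto simp: comp_def DERIV_exp has_field_derivative_at_within)
    from has_vector_derivative_mult[OF z[OF t] this] show ?thesis
      using z0[OF t] by simp
  qed
  then obtain d where d: "\<And>t. t \<in> {0..T} \<Longrightarrow> z t * exp (- g t) = d"
    using has_vector_derivative_zero_constant[of "{0..T}" "\<lambda>t. z t * exp (- g t)"] by auto
  have "d = 1" using d[of 0] T z0[of 0] by (simp add: g_def exp_minus)
  then have zg: "z t = exp (g t)" if "t \<in> {0..T}" for t
    using d[OF that] by (simp add: exp_minus field_simps)
  have r: "sqrt ((v t)\<^sup>2 + (x t)\<^sup>2) = exp (Re (g t))" if "t \<in> {0..T}" for t
    using norm_exp_eq_Re[of "g t"] by (simp add: zg[OF that, symmetric] z_def cmod_def)
  show thesis
  proof (rule that[of "\<lambda>t. Im (g t)"])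
    fix t assume t: "t \<in> {0..T}"
    have "((\<lambda>t. Im (g t)) has_vector_derivative Im (z' t / z t)) (at t within {0..T})"
      using g[OF t] by (simp add: has_vector_derivative_complex_iff has_real_derivative_iff_has_vector_derivative)
    moreover have "Im (z' t / z t) = ((v t)\<^sup>2 + x t * H t) / ((v t)\<^sup>2 + (x t)\<^sup>2)"
      by (simp add: Im_divide z_def z'_def power2_eq_square algebra_simps)
    ultimately show "((\<lambda>t. Im (g t)) has_real_derivative ((v t)\<^sup>2 + x t * H t) / ((v t)\<^sup>2 + (x t)\<^sup>2)) (at t within {0..T})"
      by (simp add: has_real_derivative_iff_has_vector_derivative)
    have "x t = Im (exp (g t))" "v t = Re (exp (g t))" by (simp_all add: zg[OF t, symmetric] z_def)
    then show "x t = sqrt ((v t)\<^sup>2 + (x t)\<^sup>2) * sin (Im (g t))"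
      "v t = sqrt ((v t)\<^sup>2 + (x t)\<^sup>2) * cos (Im (g t))"
      unfolding r[OF t] by (simp_all add: Im_exp Re_exp)
  qed
qed

text \<open>The factor \<open>c\<close> serves the Poincare-Bohl argument: not only periodic solutions but all solutions
  whose final state is a positive multiple of the initial one perform whole numbers of turns.\<close>

lemma turn_count:
  fixes x v H :: "real \<Rightarrow> real"
  assumes x: "\<And>t. t \<in> {0..T} \<Longrightarrow> (x has_real_derivative v t) (at t within {0..T})"
    and v: "\<And>t. t \<in> {0..T} \<Longrightarrow> (v has_real_derivative - H t) (at t within {0..T})"
    and H: "continuous_on {0..T} H" and T: "T > 0"
    and nz: "\<And>t. t \<in> {0..T} \<Longrightarrow> x t \<noteq> 0 \<or> v t \<noteq> 0"
    and pos: "a1 > 0" "a2 > 0" "b > 0" "c > 0"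
    and per: "x T = c * x 0" "v T = c * v 0"
    and lower: "\<And>t. t \<in> {0..T} \<Longrightarrow> (1 - \<eta>) * wall_energy a1 b (x t) (v t) \<le> (v t)\<^sup>2 + x t * H t"
    and upper: "\<And>t. t \<in> {0..T} \<Longrightarrow> (v t)\<^sup>2 + x t * H t \<le> (1 + \<eta>) * wall_energy a2 b (x t) (v t)"
  obtains j :: int where "(1 - \<eta>) * T \<le> of_int j * (pi / a1 + pi / b)"
    "of_int j * (pi / a2 + pi / b) \<le> (1 + \<eta>) * T"
proof -
  obtain \<theta> where \<theta>: "\<And>t. t \<in> {0..T} \<Longrightarrow>
      (\<theta> has_real_derivative ((v t)\<^sup>2 + x t * H t) / ((v t)\<^sup>2 + (x t)\<^sup>2)) (at t within {0..T})"
    and xs: "\<And>t. t \<in> {0..T} \<Longrightarrow> x t = sqrt ((v t)\<^sup>2 + (x t)\<^sup>2) * sin (\<theta> t)"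
    and vc: "\<And>t. t \<in> {0..T} \<Longrightarrow> v t = sqrt ((v t)\<^sup>2 + (x t)\<^sup>2) * cos (\<theta> t)"
    using polar_angle[OF x v H T nz] by blast
  define r where "r t = sqrt ((v t)\<^sup>2 + (x t)\<^sup>2)" for t
  have r: "r t > 0" "(r t)\<^sup>2 = (v t)\<^sup>2 + (x t)\<^sup>2" if "t \<in> {0..T}" for t
    using nz[OF that] by (auto simp: r_def sum_power2_gt_zero_iff)
  \<comment> \<open>Scaling the state by \<open>c > 0\<close> changes only the radius; hence the
    angles at 0 and \<open>T\<close> differ by a multiple of \<open>2 * pi\<close>.\<close>
  have rT: "r T = c * r 0"
    unfolding r_def per using \<open>c > 0\<close>
    by (simp add: power_mult_distrib distrib_left[symmetric] real_sqrt_mult)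
  have "x 0 = r 0 * sin (\<theta> 0)" "v 0 = r 0 * cos (\<theta> 0)"
    using xs[of 0] vc[of 0] T by (simp_all add: r_def)
  moreover have "c * x 0 = (c * r 0) * sin (\<theta> T)" "c * v 0 = (c * r 0) * cos (\<theta> T)"
    using xs[of T, folded r_def] vc[of T, folded r_def] T by (simp_all only: rT per) auto
  ultimately have "sin (\<theta> T) = sin (\<theta> 0)" "cos (\<theta> T) = cos (\<theta> 0)"
    using T r(1)[of 0] \<open>c > 0\<close> by simp_all
  then obtain j :: int where j: "\<theta> T = \<theta> 0 + of_int j * (2 * pi)"
    using sin_cos_eq_iff[of "\<theta> T" "\<theta> 0"] by (auto simp: algebra_simps)
  \<comment> \<open>The mean value theorem for \<open>\<Psi> \<circ> \<theta>\<close>: after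
    \<open>j\<close> turns this function has grown by \<open>j\<close> oscillator periods, and at
    some instant its speed is the average one. Any \<open>a > 0\<close> is allowed, so
    \<open>a1\<close> can serve the lower and \<open>a2\<close> the upper estimate.\<close>
  have rate: "\<exists>t\<in>{0..T}. of_int j * (pi / a + pi / b) * wall_energy a b (x t) (v t)
      = ((v t)\<^sup>2 + x t * H t) * T \<and> wall_energy a b (x t) (v t) > 0" if a: "a > 0" for a
  proof -
    obtain \<Psi> where \<Psi>: "\<And>\<theta>. (\<Psi> has_real_derivative 1 / wall_energy a b (sin \<theta>) (cos \<theta>)) (at \<theta>)"
      and \<Psi>j: "\<And>\<theta> (j::int). \<Psi> (\<theta> + of_int j * (2 * pi)) = \<Psi> \<theta> + of_int j * (pi / a + pi / b)"
      using turn_time[OF a \<open>b > 0\<close>] by blast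
    obtain t where t: "0 < t" "t < T" and eq: "\<Psi> (\<theta> T) - \<Psi> (\<theta> 0) =
        (1 / wall_energy a b (sin (\<theta> t)) (cos (\<theta> t)) * (((v t)\<^sup>2 + x t * H t) / ((v t)\<^sup>2 + (x t)\<^sup>2))) * (T - 0)"
      using mvt_within[OF T DERIV_chain2[OF \<Psi> \<theta>]] by blast
    have tT: "t \<in> {0..T}" using t by simp
    have "wall_energy a b (x t) (v t) = (r t)\<^sup>2 * wall_energy a b (sin (\<theta> t)) (cos (\<theta> t))"
      using xs[OF tT] vc[OF tT] wall_energy_scale[of "r t" a b "sin (\<theta> t)" "cos (\<theta> t)"] r(1)[OF tT]
      unfolding r_def[symmetric] by simp
    moreover have "wall_energy a b (x t) (v t) > 0"
      using a \<open>b > 0\<close> nz[OF tT] by (intro wall_energy_pos) auto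
    ultimately show ?thesis
      using eq tT r(2)[OF tT] r(1)[OF tT] unfolding j \<Psi>j
      by (intro bexI[of _ t]) (auto simp: field_simps)
  qed
  show thesis
  proof (rule that)
    obtain t where t: "t \<in> {0..T}" and eq: "of_int j * (pi / a1 + pi / b) * wall_energy a1 b (x t) (v t)
      = ((v t)\<^sup>2 + x t * H t) * T" and p: "wall_energy a1 b (x t) (v t) > 0"
      using rate[OF \<open>a1 > 0\<close>] by blast
    have "(1 - \<eta>) * wall_energy a1 b (x t) (v t) * T \<le> ((v t)\<^sup>2 + x t * H t) * T"
      using lower[OF t] T by (intro mult_right_mono) auto
    then have "((1 - \<eta>) * T) * wall_energy a1 b (x t) (v t)
        \<le> (of_int j * (pi / a1 + pi / b)) * wall_energy a1 b (x t) (v t)"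
      using eq by (simp add: mult_ac)
    then show "(1 - \<eta>) * T \<le> of_int j * (pi / a1 + pi / b)" using p by simp
    obtain t where t: "t \<in> {0..T}" and eq: "of_int j * (pi / a2 + pi / b) * wall_energy a2 b (x t) (v t)
      = ((v t)\<^sup>2 + x t * H t) * T" and p: "wall_energy a2 b (x t) (v t) > 0"
      using rate[OF \<open>a2 > 0\<close>] by blast
    have "((v t)\<^sup>2 + x t * H t) * T \<le> (1 + \<eta>) * wall_energy a2 b (x t) (v t) * T"
      using upper[OF t] T by (intro mult_right_mono) auto
    then have "(of_int j * (pi / a2 + pi / b)) * wall_energy a2 b (x t) (v t)
        \<le> ((1 + \<eta>) * T) * wall_energy a2 b (x t) (v t)"
      using eq by (simp add: mult_ac)
    then show "of_int j * (pi / a2 + pi / b) \<le> (1 + \<eta>) * T" using p by simp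
  qed
qed

section \<open>A priori bound\<close>

lemma pos_part_nonneg: "pos_part x \<ge> 0"
  by (simp add: pos_part_def)

lemma continuous_on_pos_part [continuous_intros]:
  "continuous_on S f \<Longrightarrow> continuous_on S (\<lambda>x. pos_part (f x))"
  unfolding pos_part_def by (intro continuous_intros)

text \<open>Squaring removes the kink: at 0 the difference quotient is at most
  \<open>\<bar>h\<bar>\<close>. This makes the wall energy differentiable along solutions.\<close>

lemma DERIV_pos_part_square: "((\<lambda>x. (pos_part x)\<^sup>2) has_real_derivative 2 * pos_part x) (at x)"
proof -
  consider "x > 0" | "x < 0" | "x = 0" by linarith
  then show ?thesis
  proof cases
    case 1
    have "((\<lambda>x. x\<^sup>2) has_real_derivative 2 * pos_part x) (at x)"
      using 1 by (auto intro!: derivative_eq_intros simp: pos_part_def)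
    then show ?thesis
      by (rule has_field_derivative_transform_within_open[of _ _ _ "{0<..}"])
         (use 1 in \<open>auto simp: pos_part_def\<close>)
  next
    case 2
    have "((\<lambda>x. 0) has_real_derivative 2 * pos_part x) (at x)"
      using 2 by (auto simp: pos_part_def)
    then show ?thesis
      by (rule has_field_derivative_transform_within_open[of _ _ _ "{..<0}"])
         (use 2 in \<open>auto simp: pos_part_def\<close>)
  next
    case 3
    have "((\<lambda>h. (pos_part h)\<^sup>2 / h) \<longlongrightarrow> 0) (at 0)"
    proof (rule Lim_null_comparison)
      show "\<forall>\<^sub>F h in at 0. norm ((pos_part h)\<^sup>2 / h) \<le> \<bar>h\<bar>"
        by (intro always_eventually) (auto simp: pos_part_def max_def power2_eq_square)
    qed (auto intro!: tendsto_eq_intros)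
    then show ?thesis using 3 by (simp add: DERIV_def pos_part_def)
  qed
qed

text \<open>The power of the wall spring cancels against the derivative of its stored energy, so
  \<open>b\<close> drops out of the rate. The energy bounds that are uniform in the stiffness rest
  on this.\<close>

lemma wall_energy_deriv:
  assumes x: "(x has_real_derivative v t) (at t within S)"
    and v: "(v has_real_derivative - (g t - b\<^sup>2 * pos_part (- x t))) (at t within S)"
  shows "((\<lambda>t. wall_energy a b (x t) (v t)) has_real_derivative
    2 * v t * (a\<^sup>2 * pos_part (x t) - g t)) (at t within S)"
proof -
  have "((\<lambda>t. (v t)\<^sup>2 + a\<^sup>2 * (pos_part (x t))\<^sup>2 + b\<^sup>2 * (pos_part (- x t))\<^sup>2) has_real_derivative
      2 * v t * - (g t - b\<^sup>2 * pos_part (- x t)) + a\<^sup>2 * (2 * pos_part (x t) * v t)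
      + b\<^sup>2 * (2 * pos_part (- x t) * - v t)) (at t within S)"
    using v by (intro DERIV_add DERIV_cmult DERIV_chain2[OF DERIV_pos_part_square] DERIV_minus x)
      (auto intro!: derivative_eq_intros)
  then show ?thesis
    by (simp add: wall_energy_def power_mult_distrib algebra_simps)
qed

text \<open>Gronwall's inequality, as a Lipschitz bound for \<open>ln (F t)\<close>. The order of
  \<open>s\<close> and \<open>t\<close> is free, so a large value at one instant forces large values
  both before and after it.\<close>

lemma exponential_growth_bound:
  fixes F F' :: "real \<Rightarrow> real"
  assumes F: "\<And>t. t \<in> {0..T} \<Longrightarrow> (F has_real_derivative F' t) (at t within {0..T})"
    and pos: "\<And>t. t \<in> {0..T} \<Longrightarrow> F t > 0" and K: "\<And>t. t \<in> {0..T} \<Longrightarrow> \<bar>F' t\<bar> \<le> K * F t"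
    and s: "s \<in> {0..T}" and t: "t \<in> {0..T}" and K0: "K \<ge> 0"
  shows "F t \<le> F s * exp (K * T)"
proof -
  have "\<bar>ln (F t) - ln (F s)\<bar> \<le> K * \<bar>t - s\<bar>"
  proof (rule field_differentiable_bound[of "{0..T}" "\<lambda>t. ln (F t)" "\<lambda>t. F' t / F t" K, unfolded real_norm_def])
    show "((\<lambda>t. ln (F t)) has_real_derivative F' r / F r) (at r within {0..T})" if "r \<in> {0..T}" for r
      using F[OF that] pos[OF that] by (auto intro!: derivative_eq_intros)
    show "\<bar>F' r / F r\<bar> \<le> K" if "r \<in> {0..T}" for r
      using K[OF that] pos[OF that] by (simp add: abs_divide pos_divide_le_eq)
  qed (use s t in auto)
  also have "\<dots> \<le> K * T" using s t K0 by (intro mult_left_mono) auto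
  finally have "ln (F t) \<le> ln (F s) + K * T" by simp
  then have "exp (ln (F t)) \<le> exp (ln (F s) + K * T)" by simp
  then show ?thesis using pos[OF s] pos[OF t] by (simp add: exp_add)
qed

text \<open>In the limit of a rigid wall, \<open>j \<le> N\<close> turns would take at most
  \<open>N * pi / a1 < T\<close>, and \<open>j \<ge> N + 1\<close> turns at least
  \<open>(N + 1) * pi / a2 > T\<close>. Both gaps survive small perturbations.\<close>

lemma no_turn_count:
  fixes N :: int
  assumes "T > 0" "a1 > 0" "a2 > 0" "of_int N * pi < a1 * T" "a2 * T < (of_int N + 1) * pi"
  obtains \<sigma> where "\<sigma> > 0" "\<And>b (j::int). b > 0 \<Longrightarrow> 1 / b \<le> \<sigma> \<Longrightarrow>
    (1 - \<sigma>) * T \<le> of_int j * (pi / a1 + pi / b) \<Longrightarrow> of_int j * (pi / a2 + pi / b) \<le> (1 + \<sigma>) * T \<Longrightarrow> False"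
proof -
  \<comment> \<open>\<open>g1\<close> and \<open>g2\<close> are the two gaps in time;
    \<open>D\<close> collects the coefficients of \<open>\<sigma>\<close> in all error terms, so
    that \<open>\<sigma> * D\<close> is half of the smaller gap.\<close>
  define g1 g2 where "g1 = T - of_int N * pi / a1" and "g2 = (of_int N + 1) * pi / a2 - T"
  define D where "D = T + (\<bar>of_int N\<bar> + \<bar>of_int N + 1\<bar>) * pi"
  define \<sigma> where "\<sigma> = min g1 g2 / (2 * D)"
  have g: "g1 > 0" "g2 > 0" using assms by (auto simp: g1_def g2_def field_simps)
  have "D \<ge> T" unfolding D_def by simp
  then have D: "D > 0" using assms by linarith
  have \<sigma>: "\<sigma> > 0" using g D by (simp add: \<sigma>_def)
  have "\<sigma> * D = min g1 g2 / 2" using D by (simp add: \<sigma>_def)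
  then have \<sigma>D: "\<sigma> * D < g1" "\<sigma> * D < g2" using g by auto
  have D': "\<sigma> * D = \<sigma> * T + \<sigma> * \<bar>of_int N\<bar> * pi + \<sigma> * \<bar>of_int N + 1\<bar> * pi"
    by (simp add: D_def algebra_simps)
  have nn: "\<sigma> * \<bar>of_int N\<bar> * pi \<ge> 0" "\<sigma> * \<bar>of_int N + 1\<bar> * pi \<ge> 0" using \<sigma> by auto
  have small: "\<bar>r * (pi / b)\<bar> \<le> \<sigma> * \<bar>r\<bar> * pi" if "b > 0" "1 / b \<le> \<sigma>" for b r :: real
  proof -
    have "(1 / b) * (\<bar>r\<bar> * pi) \<le> \<sigma> * (\<bar>r\<bar> * pi)" using that by (intro mult_right_mono) auto
    then show ?thesis using that by (simp add: abs_mult mult_ac)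
  qed
  show thesis
  proof (rule that[OF \<sigma>])
    fix b :: real and j :: int
    assume b: "b > 0" "1 / b \<le> \<sigma>" and j1: "(1 - \<sigma>) * T \<le> of_int j * (pi / a1 + pi / b)"
      and j2: "of_int j * (pi / a2 + pi / b) \<le> (1 + \<sigma>) * T"
    show False
    proof (cases "j \<le> N")
      case True
      have "of_int j * (pi / a1 + pi / b) \<le> of_int N * (pi / a1 + pi / b)"
        using True b assms by (intro mult_right_mono) auto
      also have "\<dots> = of_int N * pi / a1 + of_int N * (pi / b)" by (simp add: algebra_simps)
      also have "\<dots> \<le> of_int N * pi / a1 + \<sigma> * \<bar>of_int N\<bar> * pi"
        using small[OF b, of "of_int N"] by linarith
      finally show False using j1 \<sigma>D D' nn unfolding g1_def by (simp add: algebra_simps)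
    next
      case False
      then have "(of_int N + 1 :: real) \<le> of_int j" by linarith
      then have "(of_int N + 1) * (pi / a2 + pi / b) \<le> of_int j * (pi / a2 + pi / b)"
        using b assms by (intro mult_right_mono) auto
      moreover have "(of_int N + 1) * (pi / a2 + pi / b)
          = (of_int N + 1) * pi / a2 + (of_int N + 1) * (pi / b)"
        by (simp add: distrib_left)
      moreover have "\<dots> \<ge> (of_int N + 1) * pi / a2 - \<sigma> * \<bar>of_int N + 1\<bar> * pi"
        using abs_le_D2[OF small[OF b, of "of_int N + 1"]] by linarith
      ultimately show False using j2 \<sigma>D D' nn unfolding g2_def by (simp add: algebra_simps)
    qed
  qed
qed

lemma wall_energy_compare:
  assumes "\<delta> \<le> 1" "\<delta> \<le> a\<^sup>2"
  shows "\<delta> * wall_energy 1 b x v \<le> wall_energy a b x v"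
proof -
  have "\<delta> * v\<^sup>2 \<le> 1 * v\<^sup>2" "\<delta> * (pos_part x)\<^sup>2 \<le> a\<^sup>2 * (pos_part x)\<^sup>2"
    "\<delta> * (b\<^sup>2 * (pos_part (- x))\<^sup>2) \<le> 1 * (b\<^sup>2 * (pos_part (- x))\<^sup>2)"
    using assms by (intro mult_right_mono; simp)+
  then show "\<delta> * wall_energy 1 b x v \<le> wall_energy a b x v"
    by (simp add: wall_energy_def power_mult_distrib algebra_simps)
qed

lemma norm_le_wall_energy:
  assumes "b\<^sup>2 \<ge> 1"
  shows "x\<^sup>2 + v\<^sup>2 \<le> wall_energy 1 b x v"
proof -
  have "1 * (pos_part (- x))\<^sup>2 \<le> b\<^sup>2 * (pos_part (- x))\<^sup>2"
    using assms by (intro mult_right_mono) auto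
  moreover have "x\<^sup>2 = (pos_part x)\<^sup>2 + (pos_part (- x))\<^sup>2"
    by (auto simp: pos_part_def max_def)
  ultimately show ?thesis unfolding wall_energy_def power_mult_distrib power_one by linarith
qed

text \<open>The rate constant is independent of \<open>b\<close>. The bounded part of
  \<open>g\<close> enters through \<open>2 * \<bar>v\<bar> * C \<le> v\<^sup>2 + C\<^sup>2\<close>,
  which explains the added \<open>C\<^sup>2\<close>; the added 1 keeps the quantity positive for the
  Gronwall argument.\<close>

lemma energy_rate_bound:
  assumes g: "a1\<^sup>2 * pos_part x - C \<le> g" "g \<le> a2\<^sup>2 * pos_part x + C" and C: "C \<ge> 0"
  shows "\<bar>2 * v * (1\<^sup>2 * pos_part x - g)\<bar> \<le> (2 + a1\<^sup>2 + a2\<^sup>2) * (wall_energy 1 b x v + C\<^sup>2 + 1)"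
proof -
  define m where "m = 1 + a1\<^sup>2 + a2\<^sup>2"
  have m: "m \<ge> 1" by (simp add: m_def)
  have p: "pos_part x \<ge> 0" by (rule pos_part_nonneg)
  have "0 \<le> a1\<^sup>2 * pos_part x" "0 \<le> a2\<^sup>2 * pos_part x" using p by auto
  moreover have "m * pos_part x = pos_part x + a1\<^sup>2 * pos_part x + a2\<^sup>2 * pos_part x"
    by (simp add: m_def algebra_simps)
  ultimately have "\<bar>pos_part x - g\<bar> \<le> m * pos_part x + C"
    using g p C by linarith
  then have "\<bar>2 * v * (1\<^sup>2 * pos_part x - g)\<bar> \<le> 2 * \<bar>v\<bar> * (m * pos_part x + C)"
    by (simp add: abs_mult mult_left_mono)
  also have "\<dots> = m * (2 * \<bar>v\<bar> * pos_part x) + 2 * \<bar>v\<bar> * C" by (simp add: algebra_simps)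
  also have "\<dots> \<le> m * (v\<^sup>2 + (pos_part x)\<^sup>2) + (v\<^sup>2 + C\<^sup>2)"
    using m sum_squares_bound[of "\<bar>v\<bar>" "pos_part x"] sum_squares_bound[of "\<bar>v\<bar>" C]
    by (intro add_mono mult_left_mono) auto
  also have "\<dots> \<le> m * wall_energy 1 b x v + (wall_energy 1 b x v + C\<^sup>2)"
    using m by (intro add_mono mult_left_mono) (auto simp: wall_energy_def)
  also have "\<dots> = (m + 1) * wall_energy 1 b x v + 1 * C\<^sup>2" by (simp add: algebra_simps)
  also have "\<dots> \<le> (m + 1) * wall_energy 1 b x v + (m + 1) * (C\<^sup>2 + 1)"
    using m by (intro add_left_mono mult_mono) auto
  finally show ?thesis by (simp add: m_def algebra_simps)
qed

lemma energy_growth: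
  fixes x v g :: "real \<Rightarrow> real"
  assumes "\<And>t. t \<in> {0..T} \<Longrightarrow> (x has_real_derivative v t) (at t within {0..T})"
    and "\<And>t. t \<in> {0..T} \<Longrightarrow> (v has_real_derivative - (g t - b\<^sup>2 * pos_part (- x t))) (at t within {0..T})"
    and "\<And>t. t \<in> {0..T} \<Longrightarrow> a1\<^sup>2 * pos_part (x t) - C \<le> g t"
    and "\<And>t. t \<in> {0..T} \<Longrightarrow> g t \<le> a2\<^sup>2 * pos_part (x t) + C"
    and "C \<ge> 0" "s \<in> {0..T}" "t \<in> {0..T}"
  shows "wall_energy 1 b (x t) (v t) + C\<^sup>2 + 1
    \<le> (wall_energy 1 b (x s) (v s) + C\<^sup>2 + 1) * exp ((2 + a1\<^sup>2 + a2\<^sup>2) * T)"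
proof (rule exponential_growth_bound[of T "\<lambda>t. wall_energy 1 b (x t) (v t) + C\<^sup>2 + 1"
      "\<lambda>t. 2 * v t * (1\<^sup>2 * pos_part (x t) - g t)"])
  show "((\<lambda>t. wall_energy 1 b (x t) (v t) + C\<^sup>2 + 1) has_real_derivative
      2 * v t * (1\<^sup>2 * pos_part (x t) - g t)) (at t within {0..T})" if "t \<in> {0..T}" for t
    using wall_energy_deriv[of x v t "{0..T}" g b 1, OF assms(1,2)[OF that]]
    by (auto intro!: derivative_eq_intros)
  show "wall_energy 1 b (x t) (v t) + C\<^sup>2 + 1 > 0" for t
    by (simp add: wall_energy_def add_nonneg_pos)
  show "\<bar>2 * v t * (1\<^sup>2 * pos_part (x t) - g t)\<bar>
      \<le> (2 + a1\<^sup>2 + a2\<^sup>2) * (wall_energy 1 b (x t) (v t) + C\<^sup>2 + 1)" if "t \<in> {0..T}" for t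
    by (rule energy_rate_bound[OF assms(3,4)[OF that] assms(5)])
qed (use assms in auto)

text \<open>If the energy exceeded \<open>M\<close> at one instant, it would exceed \<open>m\<close>
  during the whole period. Then the bounded perturbation is a relative error of at most
  \<open>\<sigma>\<close> in the angular speed, and \<open>turn_count\<close> yields a number of
  turns that \<open>no_turn_count\<close> excludes.\<close>

lemma a_priori_bound:
  fixes N :: int
  assumes T: "T > 0" and a: "a1 > 0" "a2 > 0" and N: "of_int N * pi < a1 * T" "a2 * T < (of_int N + 1) * pi"
    and C: "C \<ge> 0"
  obtains M b0 where "M > 0" "b0 \<ge> 1"
    "\<And>b x v g c t. b \<ge> b0 \<Longrightarrow> c > 0 \<Longrightarrow>
      (\<And>t. t \<in> {0..T} \<Longrightarrow> (x has_real_derivative v t) (at t within {0..T})) \<Longrightarrow>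
      (\<And>t. t \<in> {0..T} \<Longrightarrow>
        (v has_real_derivative - (g t - b\<^sup>2 * pos_part (- x t))) (at t within {0..T})) \<Longrightarrow>
      continuous_on {0..T} g \<Longrightarrow>
      (\<And>t. t \<in> {0..T} \<Longrightarrow> a1\<^sup>2 * pos_part (x t) - C \<le> g t) \<Longrightarrow>
      (\<And>t. t \<in> {0..T} \<Longrightarrow> g t \<le> a2\<^sup>2 * pos_part (x t) + C) \<Longrightarrow>
      x T = c * x 0 \<Longrightarrow> v T = c * v 0 \<Longrightarrow> t \<in> {0..T} \<Longrightarrow> wall_energy 1 b (x t) (v t) \<le> M"
proof -
  obtain \<sigma> where \<sigma>: "\<sigma> > 0" and no: "\<And>b (j::int). b > 0 \<Longrightarrow> 1 / b \<le> \<sigma> \<Longrightarrow>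
    (1 - \<sigma>) * T \<le> of_int j * (pi / a1 + pi / b) \<Longrightarrow> of_int j * (pi / a2 + pi / b) \<le> (1 + \<sigma>) * T \<Longrightarrow> False"
    using no_turn_count[OF T a N] by blast
  \<comment> \<open>\<open>\<delta>\<close> compares \<open>wall_energy 1 b\<close> with
    \<open>wall_energy a1 b\<close> and \<open>wall_energy a2 b\<close>. From
    \<open>m \<le> E\<close> and \<open>\<bar>x\<bar> \<le> sqrt E\<close> it follows that
    \<open>C * \<bar>x\<bar> \<le> \<sigma> * \<delta> * E\<close>.\<close>
  define \<delta> where "\<delta> = min 1 (min (a1\<^sup>2) (a2\<^sup>2))"
  have \<delta>: "\<delta> > 0" "\<delta> \<le> 1" "\<delta> \<le> a1\<^sup>2" "\<delta> \<le> a2\<^sup>2" using a by (auto simp: \<delta>_def)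
  define m where "m = (C / (\<sigma> * \<delta>))\<^sup>2"
  \<comment> \<open>Chosen so that dividing by the Gronwall factor and subtracting
    \<open>C\<^sup>2 + 1\<close> leaves \<open>m + 1\<close>.\<close>
  define M where "M = (m + 2 + C\<^sup>2) * exp ((2 + a1\<^sup>2 + a2\<^sup>2) * T)"
  have "m \<ge> 0" by (simp add: m_def)
  then have M: "M > 0" by (simp add: M_def add_nonneg_pos add_pos_nonneg)
  show thesis
  proof (rule that[OF M, of "max 1 (1 / \<sigma>)"])
    fix b x v g c t
    assume b: "b \<ge> max 1 (1 / \<sigma>)" and c: "c > 0"
      and x: "\<And>t. t \<in> {0..T} \<Longrightarrow> (x has_real_derivative v t) (at t within {0..T})"
      and v: "\<And>t. t \<in> {0..T} \<Longrightarrow>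
        (v has_real_derivative - (g t - b\<^sup>2 * pos_part (- x t))) (at t within {0..T})"
      and g: "continuous_on {0..T} g"
      and g1: "\<And>t. t \<in> {0..T} \<Longrightarrow> a1\<^sup>2 * pos_part (x t) - C \<le> g t"
      and g2: "\<And>t. t \<in> {0..T} \<Longrightarrow> g t \<le> a2\<^sup>2 * pos_part (x t) + C"
      and per: "x T = c * x 0" "v T = c * v 0" and t: "t \<in> {0..T}"
    define E where "E t = wall_energy 1 b (x t) (v t)" for t
    have b1: "b > 0" "b\<^sup>2 \<ge> 1" "1 / b \<le> \<sigma>" using b \<sigma> by (auto simp: field_simps)
    show "wall_energy 1 b (x t) (v t) \<le> M"
    proof (rule ccontr)
      assume "\<not> ?thesis"
      then have big: "M < E t" by (simp add: E_def)
      have Es: "E s \<ge> m + 1" if s: "s \<in> {0..T}" for s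
      proof -
        have "M < (E s + C\<^sup>2 + 1) * exp ((2 + a1\<^sup>2 + a2\<^sup>2) * T)"
          using energy_growth[OF x v g1 g2 C s t] big unfolding E_def
          by (smt (verit) zero_le_power2)
        then show ?thesis by (simp add: M_def)
      qed
      have err: "C * \<bar>x s\<bar> \<le> \<sigma> * wall_energy a b (x s) (v s)"
        if s: "s \<in> {0..T}" and "\<delta> \<le> a\<^sup>2" for s a
      proof -
        have E: "E s > 0" "m \<le> E s" using Es[OF s] \<open>m \<ge> 0\<close> by auto
        then have "C / (\<sigma> * \<delta>) \<le> sqrt (E s)"
          unfolding m_def by (intro real_le_rsqrt)
        then have "C \<le> \<sigma> * \<delta> * sqrt (E s)" using \<sigma> \<delta> by (simp add: field_simps)
        moreover have "\<bar>x s\<bar> \<le> sqrt (E s)"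
        proof (rule real_le_rsqrt)
          have "(x s)\<^sup>2 \<le> E s"
            using order_trans[OF _ norm_le_wall_energy[OF b1(2), of "x s" "v s"], of "(x s)\<^sup>2"]
            by (simp add: E_def)
          then show "\<bar>x s\<bar>\<^sup>2 \<le> E s" by simp
        qed
        ultimately have "C * \<bar>x s\<bar> \<le> (\<sigma> * \<delta> * sqrt (E s)) * sqrt (E s)"
          using C by (intro mult_mono) auto
        also have "\<dots> = \<sigma> * (\<delta> * E s)" using E by simp
        also have "\<dots> \<le> \<sigma> * wall_energy a b (x s) (v s)"
          using \<sigma> wall_energy_compare[OF \<delta>(2) that(2), of b "x s" "v s"]
          by (intro mult_left_mono) (auto simp: E_def)
        finally show ?thesis .
      qed
      \<comment> \<open>The spring contributes exactly
        \<open>b\<^sup>2 * (pos_part (- x s))\<^sup>2\<close>, the same term as in the energy; only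
        \<open>g\<close> produces an error.\<close>
      have torque: "a1\<^sup>2 * (pos_part (x s))\<^sup>2 + b\<^sup>2 * (pos_part (- x s))\<^sup>2 - C * \<bar>x s\<bar>
          \<le> x s * (g s - b\<^sup>2 * pos_part (- x s))"
        "x s * (g s - b\<^sup>2 * pos_part (- x s))
          \<le> a2\<^sup>2 * (pos_part (x s))\<^sup>2 + b\<^sup>2 * (pos_part (- x s))\<^sup>2 + C * \<bar>x s\<bar>"
        if s: "s \<in> {0..T}" for s
      proof -
        have "x s \<ge> 0 \<Longrightarrow> x s * (a1\<^sup>2 * x s - C) \<le> x s * g s \<and> x s * g s \<le> x s * (a2\<^sup>2 * x s + C)"
          using g1[OF s] g2[OF s] by (auto simp: pos_part_def intro!: mult_left_mono)
        moreover have "x s * C \<le> x s * g s \<and> x s * g s \<le> x s * (- C)" if neg: "x s < 0"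
        proof -
          have "- C \<le> g s" "g s \<le> C" using g1[OF s] g2[OF s] neg by (auto simp: pos_part_def)
          then show ?thesis
            using neg mult_left_mono_neg[of "- C" "g s" "x s"] mult_left_mono_neg[of "g s" C "x s"] by simp
        qed
        ultimately show "a1\<^sup>2 * (pos_part (x s))\<^sup>2 + b\<^sup>2 * (pos_part (- x s))\<^sup>2 - C * \<bar>x s\<bar>
          \<le> x s * (g s - b\<^sup>2 * pos_part (- x s))"
         "x s * (g s - b\<^sup>2 * pos_part (- x s))
          \<le> a2\<^sup>2 * (pos_part (x s))\<^sup>2 + b\<^sup>2 * (pos_part (- x s))\<^sup>2 + C * \<bar>x s\<bar>"
          by (cases "x s \<ge> 0"; simp add: pos_part_def power2_eq_square algebra_simps)+
      qed
      have xc: "continuous_on {0..T} x" by (rule DERIV_continuous_on[OF x])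
      have H: "continuous_on {0..T} (\<lambda>t. g t - b\<^sup>2 * pos_part (- x t))"
        using g xc by (intro continuous_intros)
      have nz: "x s \<noteq> 0 \<or> v s \<noteq> 0" if "s \<in> {0..T}" for s
        using Es[OF that] \<open>m \<ge> 0\<close> by (auto simp: E_def wall_energy_def pos_part_def)
      have lo: "(1 - \<sigma>) * wall_energy a1 b (x s) (v s) \<le> (v s)\<^sup>2 + x s * (g s - b\<^sup>2 * pos_part (- x s))"
        if s: "s \<in> {0..T}" for s
        using torque(1)[OF s] err[OF s \<delta>(3)]
        by (simp add: wall_energy_def power_mult_distrib algebra_simps)
      have hi: "(v s)\<^sup>2 + x s * (g s - b\<^sup>2 * pos_part (- x s)) \<le> (1 + \<sigma>) * wall_energy a2 b (x s) (v s)"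
        if s: "s \<in> {0..T}" for s
        using torque(2)[OF s] err[OF s \<delta>(4)]
        by (simp add: wall_energy_def power_mult_distrib algebra_simps)
      obtain j :: int where "(1 - \<sigma>) * T \<le> of_int j * (pi / a1 + pi / b)"
        "of_int j * (pi / a2 + pi / b) \<le> (1 + \<sigma>) * T"
        using turn_count[OF x v H T nz a b1(1) c per lo hi] by blast
      then show False using no b1 by blast
    qed
  qed simp
qed

section \<open>Periodic solutions of the penalised equation\<close>

definition periodic_ext :: "real \<Rightarrow> (real \<Rightarrow> real) \<Rightarrow> real \<Rightarrow> real" where
  "periodic_ext T x t = x (t - T * of_int \<lfloor>t / T\<rfloor>)"

text \<open>At the right endpoint the floor has already jumped to \<open>k + 1\<close>; there
  \<open>x T = x 0\<close> closes the gap, so that adjacent closed intervals overlap in a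
  point.\<close>

lemma periodic_ext_eq:
  assumes "T > 0" "x T = x 0" "t \<in> {T * of_int k..T * of_int k + T}"
  shows "periodic_ext T x t = x (t - T * of_int k)"
proof (cases "t = T * of_int k + T")
  case True
  then have "t / T = of_int (k + 1)" using assms(1) by (simp add: field_simps)
  then have "\<lfloor>t / T\<rfloor> = k + 1" by (metis floor_of_int)
  then show ?thesis using True assms(2) by (simp add: periodic_ext_def algebra_simps)
next
  case False
  then have "\<lfloor>t / T\<rfloor> = k"
    using assms by (intro floor_unique) (auto simp: field_simps)
  then show ?thesis by (simp add: periodic_ext_def)
qed

lemma periodic_ext_base:
  "T > 0 \<Longrightarrow> x T = x 0 \<Longrightarrow> t \<in> {0..T} \<Longrightarrow> periodic_ext T x t = x t"
  using periodic_ext_eq[of T x t 0] by simp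

lemma periodic_ext_periodic: "T > 0 \<Longrightarrow> periodic_ext T x (t + T) = periodic_ext T x t"
  by (simp add: periodic_ext_def add_divide_distrib algebra_simps)

lemma floor_quotient_remainder:
  fixes T t :: real
  assumes "T > 0"
  shows "t - T * of_int \<lfloor>t / T\<rfloor> \<in> {0..<T}"
proof -
  have "of_int \<lfloor>t / T\<rfloor> \<le> t / T" "t / T < of_int \<lfloor>t / T\<rfloor> + 1" by linarith+
  then have "of_int \<lfloor>t / T\<rfloor> * T \<le> t" "t < (of_int \<lfloor>t / T\<rfloor> + 1) * T"
    using assms by (simp_all only: pos_le_divide_eq pos_divide_less_eq)
  then show ?thesis by (simp add: algebra_simps)
qed

text \<open>At a multiple of \<open>T\<close> the derivatives within the two adjacent closed
  intervals agree because \<open>x' T = x' 0\<close>, and their union is a neighbourhood.\<close>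

lemma periodic_ext_deriv:
  assumes T: "T > 0"
    and x: "\<And>t. t \<in> {0..T} \<Longrightarrow> (x has_real_derivative x' t) (at t within {0..T})"
    and per: "x T = x 0" "x' T = x' 0"
  shows "(periodic_ext T x has_real_derivative periodic_ext T x' t) (at t)"
proof -
  have piece: "(periodic_ext T x has_real_derivative periodic_ext T x' t)
      (at t within {T * of_int k..T * of_int k + T})"
    if t: "t \<in> {T * of_int k..T * of_int k + T}" for k :: int
  proof -
    let ?S = "{T * of_int k..T * of_int k + T}"
    have shift: "((\<lambda>s. s - T * of_int k) has_real_derivative 1) (at t within ?S)"
      by (auto intro!: derivative_eq_intros)
    have "(\<lambda>s. s - T * of_int k) ` ?S \<subseteq> {0..T}" "t - T * of_int k \<in> {0..T}" using t by auto
    then have "(x has_real_derivative x' (t - T * of_int k))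
        (at (t - T * of_int k) within (\<lambda>s. s - T * of_int k) ` ?S)"
      by (blast intro: DERIV_subset[OF x])
    from DERIV_image_chain[OF this shift]
    have "((\<lambda>s. x (s - T * of_int k)) has_real_derivative x' (t - T * of_int k)) (at t within ?S)"
      by (simp only: comp_def mult_1_right)
    then have "((\<lambda>s. x (s - T * of_int k)) has_real_derivative periodic_ext T x' t) (at t within ?S)"
      using periodic_ext_eq[OF T per(2) t] by simp
    then show ?thesis
      by (rule has_field_derivative_transform_within[of _ _ _ _ 1])
        (use t periodic_ext_eq[OF T per(1)] in auto)
  qed
  define k where "k = \<lfloor>t / T\<rfloor>"
  have k: "T * of_int k \<le> t" "t < T * of_int k + T"
    using floor_quotient_remainder[OF T, of t] by (auto simp: k_def)
  show ?thesis
  proof (cases "t = T * of_int k")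
    case False
    with k have "t \<in> interior {T * of_int k..T * of_int k + T}"
      unfolding interior_atLeastAtMost_real by auto
    moreover have "t \<in> {T * of_int k..T * of_int k + T}" using k by auto
    ultimately show ?thesis
      using piece[of k] at_within_interior by metis
  next
    case True
    let ?S = "{T * of_int k..T * of_int k + T}" and ?S' = "{T * of_int (k - 1)..T * of_int (k - 1) + T}"
    have tS: "t \<in> ?S" "t \<in> ?S'" using True T by (simp_all add: algebra_simps)
    have "(periodic_ext T x has_real_derivative periodic_ext T x' t) (at t within ?S \<union> ?S')"
      using piece[OF tS(1)] piece[OF tS(2)] unfolding has_field_derivative_iff by (rule Lim_Un)
    moreover have "?S \<union> ?S' = {T * of_int (k - 1)..T * of_int k + T}"
      using T by (auto simp: algebra_simps)
    moreover have "t \<in> interior {T * of_int (k - 1)..T * of_int k + T}"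
      unfolding interior_atLeastAtMost_real using True T by (auto simp: algebra_simps)
    ultimately show ?thesis by (metis at_within_interior)
  qed
qed

lemma periodic_int_multiple:
  fixes F :: "real \<Rightarrow> 'a"
  assumes "\<And>t. F (t + T) = F t"
  shows "F (t + T * of_int k) = F t"
proof (induction k rule: int_induct[where k = 0])
  case (step1 i)
  then show ?case using assms[of "t + T * of_int i"] by (simp add: algebra_simps)
next
  case (step2 i)
  then show ?case using assms[of "t + T * of_int (i - 1)"] by (simp add: algebra_simps)
qed simp

definition clamp_abs :: "real \<Rightarrow> real \<Rightarrow> real" where
  "clamp_abs r x = max (- r) (min r x)"

lemma clamp_abs_simps:
  "r \<ge> 0 \<Longrightarrow> \<bar>clamp_abs r x\<bar> \<le> r" "r \<ge> 0 \<Longrightarrow> \<bar>clamp_abs r x\<bar> \<le> \<bar>x\<bar>"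
  "\<bar>x\<bar> \<le> r \<Longrightarrow> clamp_abs r x = x"
  by (auto simp: clamp_abs_def)

text \<open>A crude bound whose constants may depend on the stiffness; it only serves to place the
  truncation of the force out of reach.\<close>

lemma state_growth:
  fixes x v h :: "real \<Rightarrow> real"
  assumes x: "\<And>t. t \<in> {0..T} \<Longrightarrow> (x has_real_derivative v t) (at t within {0..T})"
    and v: "\<And>t. t \<in> {0..T} \<Longrightarrow> (v has_real_derivative - h t) (at t within {0..T})"
    and h: "\<And>t. t \<in> {0..T} \<Longrightarrow> \<bar>h t\<bar> \<le> A * \<bar>x t\<bar> + C" and "A \<ge> 0" "C \<ge> 0" and t: "t \<in> {0..T}"
  shows "(x t)\<^sup>2 + (v t)\<^sup>2 + 1 \<le> ((x 0)\<^sup>2 + (v 0)\<^sup>2 + 1) * exp ((1 + A + C) * T)"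
proof (rule exponential_growth_bound[of T "\<lambda>t. (x t)\<^sup>2 + (v t)\<^sup>2 + 1" "\<lambda>t. 2 * x t * v t + 2 * v t * (- h t)"])
  show "((\<lambda>t. (x t)\<^sup>2 + (v t)\<^sup>2 + 1) has_real_derivative 2 * x t * v t + 2 * v t * (- h t)) (at t within {0..T})"
    if "t \<in> {0..T}" for t
    using x[OF that] v[OF that] by (auto intro!: derivative_eq_intros)
  show "(x t)\<^sup>2 + (v t)\<^sup>2 + 1 > 0" for t by (simp add: add_nonneg_pos)
  show "\<bar>2 * x t * v t + 2 * v t * (- h t)\<bar> \<le> (1 + A + C) * ((x t)\<^sup>2 + (v t)\<^sup>2 + 1)" if "t \<in> {0..T}" for t
  proof -
    have xv: "2 * \<bar>x t\<bar> * \<bar>v t\<bar> \<le> (x t)\<^sup>2 + (v t)\<^sup>2"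
      using sum_squares_bound[of "\<bar>x t\<bar>" "\<bar>v t\<bar>"] by simp
    have v1: "2 * \<bar>v t\<bar> * 1 \<le> (v t)\<^sup>2 + 1"
      using sum_squares_bound[of "\<bar>v t\<bar>" 1] by simp
    have "\<bar>2 * x t * v t + 2 * v t * (- h t)\<bar> \<le> 2 * \<bar>x t\<bar> * \<bar>v t\<bar> + 2 * \<bar>v t\<bar> * \<bar>h t\<bar>"
      using abs_triangle_ineq[of "2 * x t * v t" "2 * v t * (- h t)"] by (simp add: abs_mult)
    also have "\<dots> \<le> 2 * \<bar>x t\<bar> * \<bar>v t\<bar> + 2 * \<bar>v t\<bar> * (A * \<bar>x t\<bar> + C)"
      using h[OF that] by (intro add_left_mono mult_left_mono) auto
    also have "\<dots> = (1 + A) * (2 * \<bar>x t\<bar> * \<bar>v t\<bar>) + C * (2 * \<bar>v t\<bar> * 1)" by (simp add: algebra_simps)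
    also have "\<dots> \<le> (1 + A) * ((x t)\<^sup>2 + (v t)\<^sup>2 + 1) + C * ((x t)\<^sup>2 + (v t)\<^sup>2 + 1)"
      using xv v1 assms(4,5) zero_le_power2[of "x t"] by (intro add_mono mult_left_mono) linarith+
    finally show ?thesis by (simp add: algebra_simps)
  qed
qed (use assms in auto)

text \<open>\<open>shooting\<close> asks for a bounded force, so the state is clamped at a level
  that the solution found never exceeds. \<open>M\<close> and \<open>b0\<close> are fixed before
  \<open>\<Lambda>\<close> and \<open>b\<close>, as both later limits require.\<close>

lemma penalised_periodic_solution:
  fixes g :: "real \<Rightarrow> real \<Rightarrow> real \<Rightarrow> real" and N :: int
  assumes T: "T > 0" and a: "a1 > 0" "a2 > 0"
    and N: "of_int N * pi < a1 * T" "a2 * T < (of_int N + 1) * pi" and C: "C \<ge> 0"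
    and g: "continuous_on UNIV (\<lambda>(t, x, l). g t x l)" and gper: "\<And>t x l. g (t + T) x l = g t x l"
    and g1: "\<And>t x l. l \<in> {0..1} \<Longrightarrow> a1\<^sup>2 * pos_part x - C \<le> g t x l"
    and g2: "\<And>t x l. l \<in> {0..1} \<Longrightarrow> g t x l \<le> a2\<^sup>2 * pos_part x + C"
  obtains M b0 where "M > 0" "b0 \<ge> 1"
    "\<And>\<Lambda> b. b \<ge> b0 \<Longrightarrow> admissible_parameter T \<Lambda> \<Longrightarrow>
      \<exists>x v. (\<forall>t. (x has_real_derivative v t) (at t)) \<and>
        (\<forall>t. (v has_real_derivative - (g t (x t) (\<Lambda> x) - b\<^sup>2 * pos_part (- x t))) (at t)) \<and>
        (\<forall>t. x (t + T) = x t) \<and> (\<forall>t. v (t + T) = v t) \<and> (\<forall>t. wall_energy 1 b (x t) (v t) \<le> M)"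
proof -
  obtain M b0 where M: "M > 0" and b0: "b0 \<ge> 1" and bound:
    "\<And>b x v g c t. b \<ge> b0 \<Longrightarrow> c > 0 \<Longrightarrow>
      (\<And>t. t \<in> {0..T} \<Longrightarrow> (x has_real_derivative v t) (at t within {0..T})) \<Longrightarrow>
      (\<And>t. t \<in> {0..T} \<Longrightarrow>
        (v has_real_derivative - (g t - b\<^sup>2 * pos_part (- x t))) (at t within {0..T})) \<Longrightarrow>
      continuous_on {0..T} g \<Longrightarrow>
      (\<And>t. t \<in> {0..T} \<Longrightarrow> a1\<^sup>2 * pos_part (x t) - C \<le> g t) \<Longrightarrow>
      (\<And>t. t \<in> {0..T} \<Longrightarrow> g t \<le> a2\<^sup>2 * pos_part (x t) + C) \<Longrightarrow>
      x T = c * x 0 \<Longrightarrow> v T = c * v 0 \<Longrightarrow> t \<in> {0..T} \<Longrightarrow> wall_energy 1 b (x t) (v t) \<le> M"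
    using a_priori_bound[OF T a N C] by blast
  show thesis
  proof (rule that[OF M b0])
    fix \<Lambda> :: "(real \<Rightarrow> real) \<Rightarrow> real" and b :: real
    assume b: "b \<ge> b0" and adm: "admissible_parameter T \<Lambda>"
    note \<Lambda> = admissible_parameterD(1)[OF adm]
    have b1: "b\<^sup>2 \<ge> 1" using b b0 by simp
    define A where "A = a1\<^sup>2 + a2\<^sup>2 + b\<^sup>2"
    have A0: "A \<ge> 0" by (simp add: A_def)
    \<comment> \<open>Initial states of solutions that return to a positive multiple of themselves
      have norm at most \<open>sqrt M\<close>, so none lies on the sphere of radius
      \<open>R\<close>, and the alternative \<open>c = 1\<close> remains.\<close>
    define R where "R = sqrt M + 1"
    have R: "R > 0" using M by (simp add: R_def add_nonneg_pos)
    \<comment> \<open>The clamped force satisfies the same linear growth bound, so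
      \<open>state_growth\<close> confines every clamped solution starting in the ball of radius
      \<open>R\<close> to \<open>\<bar>x\<bar> \<le> r\<close>, where the clamp is the
      identity.\<close>
    define r where "r = sqrt ((R\<^sup>2 + 1) * exp ((1 + A + C) * T))"
    have r0: "r \<ge> 0" by (simp add: r_def)
    define h0 where "h0 t x l = g t x l - b\<^sup>2 * pos_part (- x)" for t x l
    define h where "h t x l = h0 t (clamp_abs r x) (max 0 (min 1 l))" for t x l
    have h0b: "\<bar>h0 t x l\<bar> \<le> A * \<bar>x\<bar> + C" if "l \<in> {0..1}" for t x l
    proof -
      have p: "pos_part x \<le> \<bar>x\<bar>" "pos_part x \<ge> 0" "pos_part (- x) \<le> \<bar>x\<bar>" "pos_part (- x) \<ge> 0"
        by (auto simp: pos_part_def)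
      have "a1\<^sup>2 * pos_part x \<ge> 0" "a2\<^sup>2 * pos_part x \<le> a2\<^sup>2 * \<bar>x\<bar>"
        "b\<^sup>2 * pos_part (- x) \<le> b\<^sup>2 * \<bar>x\<bar>" "b\<^sup>2 * pos_part (- x) \<ge> 0"
        "a1\<^sup>2 * \<bar>x\<bar> \<ge> 0" "a2\<^sup>2 * \<bar>x\<bar> \<ge> 0" "b\<^sup>2 * \<bar>x\<bar> \<ge> 0"
        using p by (auto intro!: mult_left_mono mult_nonneg_nonneg)
      moreover have "A * \<bar>x\<bar> = a1\<^sup>2 * \<bar>x\<bar> + a2\<^sup>2 * \<bar>x\<bar> + b\<^sup>2 * \<bar>x\<bar>" by (simp add: A_def algebra_simps)
      ultimately show ?thesis
        using g1[OF that, of x t] g2[OF that, of t x] unfolding h0_def abs_le_iff by linarith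
    qed
    have hb: "\<bar>h t x l\<bar> \<le> A * \<bar>clamp_abs r x\<bar> + C" for t x l
      unfolding h_def by (rule h0b) auto
    have hK: "\<bar>h t x l\<bar> \<le> A * r + C" for t x l
      using hb[of t x l] mult_left_mono[OF clamp_abs_simps(1)[OF r0] A0, of x] by linarith
    have hx: "\<bar>h t x l\<bar> \<le> A * \<bar>x\<bar> + C" for t x l
      using hb[of t x l] mult_left_mono[OF clamp_abs_simps(2)[OF r0] A0, of x] by linarith
    have hcont: "continuous_on UNIV (\<lambda>(t, x, l). h t x l)"
    proof -
      have "continuous_on UNIV (\<lambda>p. (\<lambda>(t, x, l). g t x l)
          (fst p, clamp_abs r (fst (snd p)), max 0 (min 1 (snd (snd p)))))"
        by (rule continuous_on_compose2[OF g])
           (auto simp: clamp_abs_def intro!: continuous_intros)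
      moreover have "continuous_on UNIV (\<lambda>p :: real \<times> real \<times> real. b\<^sup>2 * pos_part (- clamp_abs r (fst (snd p))))"
        unfolding clamp_abs_def by (intro continuous_intros)
      ultimately show ?thesis
        unfolding h_def h0_def split_beta by (auto intro: continuous_on_diff)
    qed
    obtain x v c where x: "\<And>t. t \<in> {0..T} \<Longrightarrow> (x has_real_derivative v t) (at t within {0..T})"
      and v: "\<And>t. t \<in> {0..T} \<Longrightarrow> (v has_real_derivative - h t (x t) (\<Lambda> x)) (at t within {0..T})"
      and init: "norm (x 0, v 0) \<le> R" and per: "x T = c * x 0" "v T = c * v 0"
      and c: "c \<ge> 1" "c = 1 \<or> norm (x 0, v 0) = R"
      using shooting[of h T R "A * r + C" \<Lambda>, OF hcont T R hK adm] by blast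
    have small: "\<bar>x t\<bar> \<le> r" if t: "t \<in> {0..T}" for t
    proof -
      have "(x 0)\<^sup>2 + (v 0)\<^sup>2 \<le> R\<^sup>2"
        using init by (simp add: norm_Pair real_sqrt_le_iff sqrt_le_D)
      have "(x t)\<^sup>2 + (v t)\<^sup>2 + 1 \<le> ((x 0)\<^sup>2 + (v 0)\<^sup>2 + 1) * exp ((1 + A + C) * T)"
        by (rule state_growth[OF x v hx A0 C t])
      also have "\<dots> \<le> (R\<^sup>2 + 1) * exp ((1 + A + C) * T)"
        using \<open>(x 0)\<^sup>2 + (v 0)\<^sup>2 \<le> R\<^sup>2\<close> by (intro mult_right_mono) auto
      finally have "(x t)\<^sup>2 \<le> (R\<^sup>2 + 1) * exp ((1 + A + C) * T)"
        using zero_le_power2[of "v t"] by linarith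
      then show ?thesis unfolding r_def by (intro real_le_rsqrt) simp
    qed
    have hh0: "h t (x t) (\<Lambda> x) = h0 t (x t) (\<Lambda> x)" if "t \<in> {0..T}" for t
      using \<Lambda>[of x] clamp_abs_simps(3)[OF small[OF that]] by (simp add: h_def)
    have v': "(v has_real_derivative - (g t (x t) (\<Lambda> x) - b\<^sup>2 * pos_part (- x t))) (at t within {0..T})"
      if "t \<in> {0..T}" for t
      using v[OF that] hh0[OF that] by (simp add: h0_def)
    have xc: "continuous_on {0..T} x" by (rule DERIV_continuous_on[OF x])
    have "continuous_on {0..T} (\<lambda>t. (\<lambda>(t, x, l). g t x l) (t, x t, \<Lambda> x))"
      by (rule continuous_on_compose2[OF g]) (auto intro!: continuous_intros xc)
    then have gc: "continuous_on {0..T} (\<lambda>t. g t (x t) (\<Lambda> x))" by simp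
    \<comment> \<open>\<open>bound\<close> allows any factor \<open>c > 0\<close>, so it applies
      before \<open>c = 1\<close> is known.\<close>
    have energy: "wall_energy 1 b (x t) (v t) \<le> M" if "t \<in> {0..T}" for t
      using c by (intro bound[of b c x v "\<lambda>t. g t (x t) (\<Lambda> x)", OF b _ x v' gc g1[OF \<Lambda>] g2[OF \<Lambda>] per that]) auto
    have "(norm (x 0, v 0))\<^sup>2 \<le> wall_energy 1 b (x 0) (v 0)"
      using norm_le_wall_energy[OF b1] by (simp add: norm_Pair)
    also have "\<dots> \<le> M" using energy T by simp
    finally have "norm (x 0, v 0) \<le> sqrt M" by (rule real_le_rsqrt)
    then have "c = 1" using c by (simp add: R_def)
    then have per1: "x T = x 0" "v T = v 0" using per by auto
    let ?X = "periodic_ext T x" and ?V = "periodic_ext T v"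
    have Xx: "?X t = x t" if "t \<in> {0..T}" for t by (rule periodic_ext_base[OF T per1(1) that])
    have "uniform_limit {0..T} (\<lambda>n::nat. x) ?X sequentially"
      by (intro uniform_limitI) (simp add: Xx)
    then have \<Lambda>X: "\<Lambda> ?X = \<Lambda> x"
      using admissible_parameterD(2)[OF adm, of "\<lambda>n. x" ?X] xc by (simp add: LIMSEQ_const_iff)
    show "\<exists>x v. (\<forall>t. (x has_real_derivative v t) (at t)) \<and>
        (\<forall>t. (v has_real_derivative - (g t (x t) (\<Lambda> x) - b\<^sup>2 * pos_part (- x t))) (at t)) \<and>
        (\<forall>t. x (t + T) = x t) \<and> (\<forall>t. v (t + T) = v t) \<and> (\<forall>t. wall_energy 1 b (x t) (v t) \<le> M)"
    proof (rule exI[of _ ?X], rule exI[of _ ?V], intro conjI allI)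
      fix t
      show "(?X has_real_derivative ?V t) (at t)" by (rule periodic_ext_deriv[OF T x per1])
      let ?a = "\<lambda>t. - (g t (x t) (\<Lambda> x) - b\<^sup>2 * pos_part (- x t))"
      have "?a T = ?a 0" using gper[of 0] per1 by simp
      then have "(?V has_real_derivative periodic_ext T ?a t) (at t)"
        using periodic_ext_deriv[of T v ?a, OF T v' per1(2)] by blast
      moreover have "periodic_ext T ?a t = - (g t (?X t) (\<Lambda> ?X) - b\<^sup>2 * pos_part (- ?X t))"
        unfolding \<Lambda>X using periodic_int_multiple[of g T "t - T * of_int \<lfloor>t / T\<rfloor>" "\<lfloor>t / T\<rfloor>"] gper
        by (simp add: periodic_ext_def fun_eq_iff)
      ultimately show "(?V has_real_derivative - (g t (?X t) (\<Lambda> ?X) - b\<^sup>2 * pos_part (- ?X t))) (at t)"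
        by simp
      show "?X (t + T) = ?X t" "?V (t + T) = ?V t" by (rule periodic_ext_periodic[OF T])+
      show "wall_energy 1 b (?X t) (?V t) \<le> M"
        unfolding periodic_ext_def by (rule energy) (use floor_quotient_remainder[OF T, of t] in simp)
    qed
  qed
qed

section \<open>The limit of infinitely stiff walls\<close>

lemma uniformly_positive_subinterval:
  fixes f :: "real \<Rightarrow> real"
  assumes cd: "c < d" and t: "t \<in> {c..d}" and f: "continuous_on UNIV f" and pos: "f t > 0"
  obtains c' d' \<kappa> where "c' < d'" "{c'..d'} \<subseteq> {c..d}" "\<kappa> > 0" "\<And>s. s \<in> {c'..d'} \<Longrightarrow> f s \<ge> \<kappa>"
proof -
  have "f t / 2 > 0" using pos by simp
  then obtain \<delta> where \<delta>: "\<delta> > 0" "\<And>s. \<bar>s - t\<bar> < \<delta> \<Longrightarrow> \<bar>f s - f t\<bar> < f t / 2"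
    using f unfolding continuous_on_iff dist_real_def by (metis UNIV_I)
  define c' d' where "c' = max c (t - \<delta> / 2)" and "d' = min d (t + \<delta> / 2)"
  show thesis
  proof (rule that[of c' d' "f t / 2"])
    show "c' < d'" "{c'..d'} \<subseteq> {c..d}" using cd t \<delta>(1) by (auto simp: c'_def d'_def)
    show "f s \<ge> f t / 2" if "s \<in> {c'..d'}" for s
    proof -
      have "\<bar>s - t\<bar> < \<delta>" using that \<delta>(1) by (auto simp: c'_def d'_def abs_less_iff)
      from \<delta>(2)[OF this] show ?thesis by linarith
    qed
  qed (use pos in simp)
qed

text \<open>\<open>E\<close> is the limit of twice the kinetic plus wall energy. These are Lipschitz uniformly in the
  stiffness, since the wall is elastic, and the continuity of \<open>E\<close> is what makes the limit \<open>X\<close> bounce elastically.\<close>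

locale penalised_limit =
  fixes g :: "real \<Rightarrow> real \<Rightarrow> real \<Rightarrow> real" and x v :: "nat \<Rightarrow> real \<Rightarrow> real"
    and b l :: "nat \<Rightarrow> real" and X E :: "real \<Rightarrow> real" and L G M :: real
  assumes x_deriv: "(x n has_real_derivative v n t) (at t)"
    and v_deriv: "(v n has_real_derivative - (g t (x n t) (l n) - (b n)\<^sup>2 * pos_part (- x n t))) (at t)"
    and g_cont: "continuous_on UNIV (\<lambda>(t, x, l). g t x l)"
    and g_bound: "\<bar>g t (x n t) (l n)\<bar> \<le> G"
    and b_pos: "b n > 0" and b_lim: "filterlim b at_top sequentially"
    and v_bound: "\<bar>v n t\<bar> \<le> M" and penal_bound: "b n * pos_part (- x n t) \<le> M"
    and x_lim: "uniform_limit UNIV x X sequentially"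
    and e_lim: "uniform_limit UNIV (\<lambda>n t. (v n t)\<^sup>2 + (b n * pos_part (- x n t))\<^sup>2) E sequentially"
    and l_lim: "l \<longlonglongrightarrow> L"
begin

lemma x_cont: "continuous_on S (x n)"
  by (rule DERIV_continuous_on[OF has_field_derivative_at_within[OF x_deriv]])

lemma v_cont: "continuous_on S (v n)"
  by (rule DERIV_continuous_on[OF has_field_derivative_at_within[OF v_deriv]])

lemma X_cont: "continuous_on S X"
  by (rule continuous_on_subset[OF uniform_limit_theorem[OF _ x_lim]]) (auto simp: x_cont)

lemma E_cont: "continuous_on S E"
  by (rule continuous_on_subset[OF uniform_limit_theorem[OF _ e_lim]])
     (auto intro!: always_eventually continuous_intros x_cont v_cont)

lemma x_tendsto: "(\<lambda>n. x n t) \<longlonglongrightarrow> X t"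
  by (rule tendsto_uniform_limitI[OF x_lim]) simp

lemma e_tendsto: "(\<lambda>n. (v n t)\<^sup>2 + (b n * pos_part (- x n t))\<^sup>2) \<longlonglongrightarrow> E t"
  by (rule tendsto_uniform_limitI[OF e_lim]) simp

lemma E_nonneg: "E t \<ge> 0"
  by (rule LIMSEQ_le_const[OF e_tendsto]) auto

lemma M_nonneg: "M \<ge> 0" using v_bound[of 0 0] by linarith

lemma G_nonneg: "G \<ge> 0" using g_bound[of 0 0] by linarith

text \<open>The penetration depth is at most \<open>M / b n\<close>, which tends to 0.\<close>

lemma X_nonneg: "X t \<ge> 0"
proof -
  have "(\<lambda>n. - (M / b n)) \<longlonglongrightarrow> - 0"
    using real_tendsto_divide_at_top[OF tendsto_const b_lim] by (intro tendsto_minus) 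
  moreover have "- (M / b n) \<le> x n t" for n
  proof -
    have "b n * (- x n t) \<le> b n * pos_part (- x n t)"
      using b_pos[of n] by (intro mult_left_mono) (auto simp: pos_part_def)
    then show ?thesis using penal_bound[of n t] b_pos[of n] by (simp add: field_simps)
  qed
  ultimately show ?thesis using LIMSEQ_le[OF _ x_tendsto, of "\<lambda>n. - (M / b n)"] by auto
qed

lemma acceleration_lim:
  "uniform_limit {c..d} (\<lambda>n t. g t (x n t) (l n)) (\<lambda>t. g t (X t) L) sequentially"
  by (rule uniform_limit_superposition[OF g_cont uniform_limit_on_subset[OF x_lim] X_cont l_lim compact_Icc]) simp

lemma g_comp_cont:
  assumes "continuous_on S y"
  shows "continuous_on S (\<lambda>t. g t (y t) m)"
proof -
  have "continuous_on S (\<lambda>t. (\<lambda>(t, x, l). g t x l) (t, y t, m))"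
    using assms by (intro continuous_on_compose2[OF g_cont]) (auto intro!: continuous_intros)
  then show ?thesis by simp
qed

text \<open>\<open>X\<close> has a positive minimum on the interval, so eventually the
  \<open>x n\<close> do not touch the wall there. Without wall force the velocities are uniformly
  Lipschitz, and a subsequence converges uniformly. The wall part of the energy is then 0, hence
  \<open>(W t)\<^sup>2 = E t\<close>.\<close>

lemma free_flight_interval:
  assumes cd: "c < d" and pos: "\<And>t. t \<in> {c..d} \<Longrightarrow> X t > 0"
  obtains W where "\<And>t. t \<in> {c..d} \<Longrightarrow> (X has_real_derivative W t) (at t within {c..d})"
    "\<And>t. t \<in> {c..d} \<Longrightarrow> (W has_real_derivative - g t (X t) L) (at t within {c..d})"
    "\<And>t. t \<in> {c..d} \<Longrightarrow> (W t)\<^sup>2 = E t"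
proof -
  obtain s where s: "s \<in> {c..d}" "\<And>t. t \<in> {c..d} \<Longrightarrow> X s \<le> X t"
    using continuous_attains_inf[of "{c..d}" X] cd X_cont by auto
  have "\<forall>\<^sub>F n in sequentially. \<forall>t\<in>UNIV. dist (x n t) (X t) < X s"
    using pos[OF s(1)] by (intro uniform_limitD[OF x_lim])
  then obtain n0 where n0: "\<And>n t. n \<ge> n0 \<Longrightarrow> dist (x n t) (X t) < X s"
    unfolding eventually_sequentially by auto
  have free: "pos_part (- x n t) = 0" if "n \<ge> n0" "t \<in> {c..d}" for n t
    using n0[OF that(1), of t] s(2)[OF that(2)] by (auto simp: dist_real_def pos_part_def abs_less_iff)
  have dv: "(v (n + n0) has_real_derivative - g t (x (n + n0) t) (l (n + n0))) (at t within {c..d})"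
    if "t \<in> {c..d}" for n t
    using has_field_derivative_at_within[OF v_deriv[of "n + n0" t], of "{c..d}"] free[OF _ that] by simp
  have vlip: "\<bar>v (n + n0) s - v (n + n0) t\<bar> \<le> G * \<bar>s - t\<bar>" if "s \<in> {c..d}" "t \<in> {c..d}" for n s t
    using field_differentiable_bound[of "{c..d}" "v (n + n0)" "\<lambda>t. - g t (x (n + n0) t) (l (n + n0))" G s t]
      dv g_bound that by auto
  obtain k W where k: "strict_mono (k :: nat \<Rightarrow> nat)" and W: "continuous_on {c..d} W"
    and vlim: "uniform_limit {c..d} (\<lambda>n. v (k n + n0)) W sequentially"
    using Arzela_Ascoli_Lipschitz[of c d "\<lambda>n. v (n + n0)" M G] v_bound vlip
    unfolding real_norm_def by blast
  have kn: "filterlim (\<lambda>n. k n + n0) sequentially sequentially"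
    by (rule filterlim_compose[OF filterlim_add_const_nat_at_top filterlim_subseq[OF k]])
  \<comment> \<open>The equations pass to the limit in integrated form and are differentiated again
    at the end.\<close>
  have X_eq: "X t = X c + integral {c..t} W" if t: "t \<in> {c..d}" for t
  proof -
    have "x (k n + n0) t = x (k n + n0) c + integral {c..t} (v (k n + n0))" for n
    proof -
      have "(v (k n + n0) has_integral (x (k n + n0) t - x (k n + n0) c)) {c..t}"
        using t x_deriv by (intro fundamental_theorem_of_calculus)
          (auto simp: has_real_derivative_iff_has_vector_derivative[symmetric] intro: has_field_derivative_at_within)
      then show ?thesis by (simp add: integral_unique)
    qed
    moreover have "(\<lambda>n. x (k n + n0) c + integral {c..t} (v (k n + n0))) \<longlonglongrightarrow> X c + integral {c..t} W"
      using tendsto_uniform_limitI[OF uniform_limit_indefinite_integral[OF vlim v_cont] t] cd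
      by (intro tendsto_add filterlim_compose[OF x_tendsto kn]) auto
    ultimately show ?thesis
      using LIMSEQ_unique[OF filterlim_compose[OF x_tendsto[of t] kn]] by simp
  qed
  define gX where "gX = (\<lambda>t. g t (X t) L)"
  have gX: "continuous_on {c..d} gX" unfolding gX_def by (intro g_comp_cont X_cont)
  have W_eq: "W t = W c - integral {c..t} gX" if t: "t \<in> {c..d}" for t
  proof -
    let ?g = "\<lambda>n t. g t (x (k n + n0) t) (l (k n + n0))"
    have "v (k n + n0) t = v (k n + n0) c - integral {c..t} (?g n)" for n
    proof -
      have "((\<lambda>t. - ?g n t) has_integral (v (k n + n0) t - v (k n + n0) c)) {c..t}"
        using t by (intro fundamental_theorem_of_calculus)
          (auto simp: has_real_derivative_iff_has_vector_derivative[symmetric] intro!: DERIV_subset[OF dv])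
      then have "integral {c..t} (\<lambda>t. - ?g n t) = v (k n + n0) t - v (k n + n0) c"
        by (rule integral_unique)
      then show ?thesis by simp
    qed
    moreover have "uniform_limit {c..d} ?g gX sequentially"
      unfolding gX_def by (rule filterlim_compose[OF acceleration_lim kn])
    then have "(\<lambda>n. v (k n + n0) c - integral {c..t} (?g n)) \<longlonglongrightarrow> W c - integral {c..t} gX"
      using t cd tendsto_uniform_limitI[OF vlim, of c]
      by (intro tendsto_diff tendsto_uniform_limitI[OF uniform_limit_indefinite_integral t] g_comp_cont x_cont) auto
    ultimately show ?thesis
      using LIMSEQ_unique[OF tendsto_uniform_limitI[OF vlim t]] by simp
  qed
  show thesis
  proof (rule that[of W])
    fix t assume t: "t \<in> {c..d}"
    have "((\<lambda>t. X c + integral {c..t} W) has_real_derivative W t) (at t within {c..d})"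
      using integral_has_real_derivative[OF W t] by (auto intro!: derivative_eq_intros)
    then show "(X has_real_derivative W t) (at t within {c..d})"
      by (rule has_field_derivative_transform_within[of _ _ _ _ 1])
        (use t in \<open>auto simp: X_eq[symmetric]\<close>)
    have "((\<lambda>t. W c - integral {c..t} gX) has_real_derivative - gX t) (at t within {c..d})"
      using integral_has_real_derivative[OF gX t] by (auto intro!: derivative_eq_intros)
    then have "(W has_real_derivative - gX t) (at t within {c..d})"
      by (rule has_field_derivative_transform_within[of _ _ _ _ 1])
        (use t in \<open>auto simp: W_eq[symmetric]\<close>)
    then show "(W has_real_derivative - g t (X t) L) (at t within {c..d})"
      by (simp add: gX_def)
    have "(\<lambda>n. (v (k n + n0) t)\<^sup>2) \<longlonglongrightarrow> E t"
      using filterlim_compose[OF e_tendsto[of t] kn] free[OF _ t] by simp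
    moreover have "(\<lambda>n. (v (k n + n0) t)\<^sup>2) \<longlonglongrightarrow> (W t)\<^sup>2"
      by (intro tendsto_power tendsto_uniform_limitI[OF vlim t])
    ultimately show "(W t)\<^sup>2 = E t" by (rule LIMSEQ_unique[symmetric])
  qed
qed

lemma free_flight:
  assumes "X t > 0"
  shows "(X has_real_derivative deriv X t) (at t)" "(deriv X t)\<^sup>2 = E t"
    "\<forall>\<^sub>F s in nhds t. X differentiable (at s)"
    "(deriv X has_real_derivative - g t (X t) L) (at t)"
proof -
  have "\<forall>\<^sub>F s in nhds t. X s > 0"
    using X_cont[of UNIV] assms
    by (intro order_tendstoD(1)[of X "X t"]) (auto simp: continuous_on_eq_continuous_at isCont_def tendsto_at_iff_tendsto_nhds)
  then obtain \<delta> where \<delta>: "\<delta> > 0" "\<And>s. dist s t < \<delta> \<Longrightarrow> X s > 0"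
    unfolding eventually_nhds_metric by blast
  define c d where "c = t - \<delta> / 2" and "d = t + \<delta> / 2"
  have cd: "c < d" "t \<in> {c<..<d}" using \<delta>(1) by (auto simp: c_def d_def)
  have "X s > 0" if "s \<in> {c..d}" for s
    using that \<delta>(1) by (intro \<delta>(2)) (auto simp: c_def d_def dist_real_def abs_less_iff)
  then obtain W where W: "\<And>t. t \<in> {c..d} \<Longrightarrow> (X has_real_derivative W t) (at t within {c..d})"
    "\<And>t. t \<in> {c..d} \<Longrightarrow> (W has_real_derivative - g t (X t) L) (at t within {c..d})"
    "\<And>t. t \<in> {c..d} \<Longrightarrow> (W t)\<^sup>2 = E t"
    using free_flight_interval[OF cd(1)] by blast
  have at: "at s within {c..d} = at s" if "s \<in> {c<..<d}" for s
    using that by (intro at_within_interior) (simp add: interior_atLeastAtMost_real)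
  have dX: "(X has_real_derivative W s) (at s)" if "s \<in> {c<..<d}" for s
    using W(1)[of s] at[OF that] that by simp
  then have DX: "deriv X s = W s" if "s \<in> {c<..<d}" for s
    using that by (auto intro: DERIV_imp_deriv)
  show "(X has_real_derivative deriv X t) (at t)" "(deriv X t)\<^sup>2 = E t"
    using dX[OF cd(2)] DX[OF cd(2)] W(3)[of t] cd(2) by auto
  have near: "\<forall>\<^sub>F s in nhds t. s \<in> {c<..<d}"
    using cd(2) by (intro eventually_nhds_in_open) auto
  then show "\<forall>\<^sub>F s in nhds t. X differentiable (at s)"
    by eventually_elim (use dX real_differentiable_def in blast)
  have "(W has_real_derivative - g t (X t) L) (at t)" using W(2)[of t] at[OF cd(2)] cd(2) by simp
  then show "(deriv X has_real_derivative - g t (X t) L) (at t)"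
    by (rule has_field_derivative_transform_within_open[of _ _ _ "{c<..<d}"]) (use cd DX in auto)
qed

text \<open>The mean value theorem with \<open>\<bar>X'\<bar> = sqrt E\<close> off the wall; squares
  and segments treat both sides of the impact at once, and the sign is fixed by
  \<open>X s > 0\<close>.\<close>

lemma ballistic_segment:
  assumes t: "X t = 0" and s: "s \<noteq> t" and pos: "\<And>r. r \<in> closed_segment t s \<Longrightarrow> r \<noteq> t \<Longrightarrow> X r > 0"
  obtains r where "r \<in> open_segment t s" "X s = sqrt (E r) * \<bar>s - t\<bar>"
proof -
  have Xs: "X s > 0" using pos[of s] s by simp
  have mvt: "\<exists>r. p < r \<and> r < q \<and> (X q - X p)\<^sup>2 = E r * (q - p)\<^sup>2"
    if "p < q" and pq: "\<And>r. p < r \<Longrightarrow> r < q \<Longrightarrow> X r > 0" for p q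
  proof -
    have diff: "X differentiable (at r)" if "p < r" "r < q" for r
      using free_flight(1)[OF pq[OF that]] by (auto simp: real_differentiable_def)
    obtain D r where r: "p < r" "r < q" "(X has_real_derivative D) (at r)" "X q - X p = (q - p) * D"
      using MVT[OF \<open>p < q\<close> X_cont diff] by blast
    then have "D = deriv X r" by (simp add: DERIV_imp_deriv)
    then show ?thesis using r free_flight(2)[OF pq[OF r(1,2)]]
      by (intro exI[of _ r]) (simp add: power_mult_distrib mult.commute)
  qed
  consider "t < s" | "s < t" using s by linarith
  then obtain r where r: "r \<in> open_segment t s" "(X s)\<^sup>2 = E r * (s - t)\<^sup>2"
  proof cases
    case 1
    have "\<exists>r. t < r \<and> r < s \<and> (X s - X t)\<^sup>2 = E r * (s - t)\<^sup>2"
      by (rule mvt[OF 1]) (use pos 1 in \<open>auto simp: closed_segment_eq_real_ivl\<close>)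
    then show thesis using that 1 t by (auto simp: open_segment_eq_real_ivl)
  next
    case 2
    have "\<exists>r. s < r \<and> r < t \<and> (X t - X s)\<^sup>2 = E r * (t - s)\<^sup>2"
      by (rule mvt[OF 2]) (use pos 2 in \<open>auto simp: closed_segment_eq_real_ivl\<close>)
    then show thesis using that 2 t by (auto simp: open_segment_eq_real_ivl power2_commute)
  qed
  have "X s = sqrt ((X s)\<^sup>2)" using Xs by simp
  also have "\<dots> = sqrt (E r) * \<bar>s - t\<bar>" unfolding r(2) by (simp add: real_sqrt_mult)
  finally show thesis using that r(1) by blast
qed

text \<open>The elastic law: the intermediate points of \<open>ballistic_segment\<close> tend to
  \<open>t\<close>, and continuity of \<open>E\<close> gives the same speed
  \<open>sqrt (E t)\<close> before and after the impact.\<close>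

lemma one_sided_derivative:
  assumes t: "X t = 0" and S: "S \<in> {{t<..}, {..<t}}" and ev: "\<forall>\<^sub>F s in at t within S. X s > 0"
  shows "((\<lambda>s. X s / \<bar>s - t\<bar>) \<longlongrightarrow> sqrt (E t)) (at t within S)"
proof (rule tendstoI)
  fix e :: real assume e: "e > 0"
  have "isCont (\<lambda>r. sqrt (E r)) t"
    using E_cont[of UNIV] by (intro continuous_intros) (simp add: continuous_on_eq_continuous_at)
  then obtain \<delta> where \<delta>: "\<delta> > 0" "\<And>r. \<bar>r - t\<bar> < \<delta> \<Longrightarrow> dist (sqrt (E r)) (sqrt (E t)) < e"
    using e unfolding continuous_at_eps_delta dist_real_def by blast
  obtain \<eta> where \<eta>: "\<eta> > 0" "\<And>s. s \<in> S \<Longrightarrow> s \<noteq> t \<Longrightarrow> dist s t < \<eta> \<Longrightarrow> X s > 0"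
    using ev unfolding eventually_at by blast
  show "\<forall>\<^sub>F s in at t within S. dist (X s / \<bar>s - t\<bar>) (sqrt (E t)) < e"
    unfolding eventually_at
  proof (intro exI[of _ "min \<delta> \<eta>"] conjI ballI impI)
    fix s assume s: "s \<in> S" and st: "s \<noteq> t \<and> dist s t < min \<delta> \<eta>"
    have "X r > 0" if "r \<in> closed_segment t s" "r \<noteq> t" for r
      using that s st S by (intro \<eta>(2))
        (auto simp: closed_segment_eq_real_ivl dist_real_def abs_if split: if_splits)
    then obtain r where r: "r \<in> open_segment t s" "X s = sqrt (E r) * \<bar>s - t\<bar>"
      using ballistic_segment[OF t] st by blast
    then have "\<bar>r - t\<bar> < \<delta>"
      using st by (auto simp: open_segment_eq_real_ivl dist_real_def abs_if split: if_splits)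
    then show "dist (X s / \<bar>s - t\<bar>) (sqrt (E t)) < e" using r(2) st \<delta>(2) by simp
  qed (use \<delta> \<eta> in simp)
qed

lemma right_derivative:
  assumes "X t = 0" "\<forall>\<^sub>F s in at_right t. X s > 0"
  shows "(X has_real_derivative sqrt (E t)) (at_right t)"
proof -
  have "((\<lambda>s. X s / \<bar>s - t\<bar>) \<longlongrightarrow> sqrt (E t)) (at_right t)"
    using one_sided_derivative[of t "{t<..}"] assms by simp
  then show ?thesis
    unfolding has_field_derivative_iff
    by (rule Lim_transform_eventually) (auto simp: eventually_at_filter assms(1))
qed

lemma left_derivative:
  assumes "X t = 0" "\<forall>\<^sub>F s in at_left t. X s > 0"
  shows "(X has_real_derivative - sqrt (E t)) (at_left t)"
proof -
  have "((\<lambda>s. - (X s / \<bar>s - t\<bar>)) \<longlongrightarrow> - sqrt (E t)) (at_left t)"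
    using one_sided_derivative[of t "{..<t}"] assms by (intro tendsto_minus) simp
  then show ?thesis
    unfolding has_field_derivative_iff
  proof (rule Lim_transform_eventually)
    have "- (X s / \<bar>s - t\<bar>) = (X s - X t) / (s - t)" if "s < t" for s
      using that by (simp add: assms(1) divide_simps, simp add: algebra_simps)
    then show "\<forall>\<^sub>F s in at_left t. - (X s / \<bar>s - t\<bar>) = (X s - X t) / (s - t)"
      by (simp add: eventually_at_filter)
  qed
qed

section \<open>Intervals of rest at the wall\<close>

lemma uniformly_small:
  assumes "\<And>t. t \<in> {c..d} \<Longrightarrow> X t = 0" "\<epsilon> > 0"
  shows "\<forall>\<^sub>F n in sequentially. \<forall>t\<in>{c..d}. \<bar>x n t\<bar> < \<epsilon>"
proof -
  have "\<forall>\<^sub>F n in sequentially. \<forall>t\<in>UNIV. dist (x n t) (X t) < \<epsilon>"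
    by (rule uniform_limitD[OF x_lim assms(2)])
  then show ?thesis
  proof eventually_elim
    case (elim n)
    show ?case
    proof
      fix t assume "t \<in> {c..d}"
      moreover have "dist (x n t) (X t) < \<epsilon>" using elim by simp
      ultimately show "\<bar>x n t\<bar> < \<epsilon>" using assms(1) by (simp add: dist_real_def)
    qed
  qed
qed

text \<open>The derivative of \<open>x v + 2 \<epsilon> v\<close> dominates the energy density up to \<open>O(\<epsilon>)\<close> as long as
  \<open>\<bar>x\<bar> < \<epsilon>\<close>, while the function itself is \<open>O(\<epsilon>)\<close>.\<close>

lemma no_energy_at_rest:
  assumes cd: "c < d" and rest: "\<And>t. t \<in> {c..d} \<Longrightarrow> X t = 0" and t: "t \<in> {c..d}"
  shows "E t = 0"
proof (rule ccontr)
  assume "E t \<noteq> 0"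
  then have "E t > 0" using E_nonneg[of t] by linarith
  then obtain c' d' \<kappa> where c': "c' < d'" "{c'..d'} \<subseteq> {c..d}" and \<kappa>: "\<kappa> > 0" "\<And>s. s \<in> {c'..d'} \<Longrightarrow> E s \<ge> \<kappa>"
    using uniformly_positive_subinterval[OF cd t E_cont] by blast
  \<comment> \<open>In units of \<epsilon>, \<open>6 * M\<close> bounds the change of the test
    function \<open>\<Phi>\<close>, \<open>3 * G * (d' - c')\<close> the work of the bounded force,
    and 1 makes the final inequality strict.\<close>
  define Q where "Q = 6 * M + 3 * G * (d' - c') + 1"
  have Q: "Q > 0" using M_nonneg G_nonneg c' by (simp add: Q_def add_nonneg_pos)
  define \<epsilon> where "\<epsilon> = \<kappa> / 2 * (d' - c') / Q"
  have \<epsilon>: "\<epsilon> > 0" using \<kappa> c' Q by (simp add: \<epsilon>_def)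
  have "\<forall>\<^sub>F n in sequentially. \<forall>t\<in>{c..d}. \<bar>x n t\<bar> < \<epsilon>" by (rule uniformly_small[OF rest \<epsilon>])
  moreover have "\<forall>\<^sub>F n in sequentially. \<forall>t\<in>UNIV. dist ((v n t)\<^sup>2 + (b n * pos_part (- x n t))\<^sup>2) (E t) < \<kappa> / 2"
    using \<kappa> by (intro uniform_limitD[OF e_lim]) simp
  ultimately have "\<forall>\<^sub>F n in sequentially. (\<forall>t\<in>{c..d}. \<bar>x n t\<bar> < \<epsilon>) \<and>
      (\<forall>t\<in>UNIV. dist ((v n t)\<^sup>2 + (b n * pos_part (- x n t))\<^sup>2) (E t) < \<kappa> / 2)"
    by (rule eventually_conj)
  from eventually_happens'[OF sequentially_bot this]
  obtain n where "(\<forall>t\<in>{c..d}. \<bar>x n t\<bar> < \<epsilon>) \<and>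
      (\<forall>t\<in>UNIV. dist ((v n t)\<^sup>2 + (b n * pos_part (- x n t))\<^sup>2) (E t) < \<kappa> / 2)"
    by blast
  then have n: "\<And>t. t \<in> {c..d} \<Longrightarrow> \<bar>x n t\<bar> < \<epsilon>"
    "\<And>t. \<bar>((v n t)\<^sup>2 + (b n * pos_part (- x n t))\<^sup>2) - E t\<bar> < \<kappa> / 2"
    by (auto simp: dist_real_def)
  define \<Phi> where "\<Phi> t = x n t * v n t + 2 * \<epsilon> * v n t" for t
  have d\<Phi>: "(\<Phi> has_real_derivative v n t * v n t + (x n t + 2 * \<epsilon>) *
      - (g t (x n t) (l n) - (b n)\<^sup>2 * pos_part (- x n t))) (at t)" for t
    unfolding \<Phi>_def using x_deriv[of n t] v_deriv[of n t]
    by (auto intro!: derivative_eq_intros simp: algebra_simps)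
  obtain s where s: "c' < s" "s < d'" and eq: "\<Phi> d' - \<Phi> c' = (d' - c') *
      (v n s * v n s + (x n s + 2 * \<epsilon>) * - (g s (x n s) (l n) - (b n)\<^sup>2 * pos_part (- x n s)))"
    using MVT2[OF c'(1) d\<Phi>] by blast
  have scd: "s \<in> {c..d}" and s': "s \<in> {c'..d'}" using s c' by auto
  define P where "P = (b n)\<^sup>2 * pos_part (- x n s)"
  have P: "P \<ge> 0" by (simp add: P_def pos_part_nonneg)
  have xs: "\<bar>x n s\<bar> < \<epsilon>" using n(1)[OF scd] .
  have "\<kappa> / 2 < (v n s)\<^sup>2 + (b n * pos_part (- x n s))\<^sup>2"
    using n(2)[of s] \<kappa>(2)[OF s'] by linarith
  also have "(b n * pos_part (- x n s))\<^sup>2 = pos_part (- x n s) * P"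
    by (simp add: P_def power2_eq_square)
  \<comment> \<open>\<open>\<bar>x\<bar> < \<epsilon>\<close> puts the penetration depth below
    \<epsilon> and \<open>x + 2 * \<epsilon>\<close> above it. This is the purpose of the shift by
    \<open>2 * \<epsilon>\<close> in \<open>\<Phi>\<close>.\<close>
  also have "\<dots> \<le> (x n s + 2 * \<epsilon>) * P"
    using xs P by (intro mult_right_mono) (auto simp: pos_part_def)
  finally have "\<kappa> / 2 < (v n s)\<^sup>2 + (x n s + 2 * \<epsilon>) * P" by simp
  moreover have "(x n s + 2 * \<epsilon>) * g s (x n s) (l n) \<le> \<bar>x n s + 2 * \<epsilon>\<bar> * \<bar>g s (x n s) (l n)\<bar>"
    by (simp add: abs_mult[symmetric])
  moreover have "\<dots> \<le> (3 * \<epsilon>) * G"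
    using xs \<epsilon> g_bound by (intro mult_mono) auto
  ultimately have lower: "\<kappa> / 2 - 3 * \<epsilon> * G < v n s * v n s + (x n s + 2 * \<epsilon>) * - (g s (x n s) (l n) - P)"
    by (simp add: power2_eq_square algebra_simps)
  have "\<bar>\<Phi> r\<bar> \<le> 3 * \<epsilon> * M" if r: "r \<in> {c'..d'}" for r
  proof -
    have "\<bar>x n r\<bar> < \<epsilon>" using n(1) c' r by blast
    then have "\<bar>x n r + 2 * \<epsilon>\<bar> * \<bar>v n r\<bar> \<le> (3 * \<epsilon>) * M"
      using \<epsilon> v_bound by (intro mult_mono) auto
    then show ?thesis by (simp add: \<Phi>_def abs_mult[symmetric] algebra_simps)
  qed
  from this[of c'] this[of d'] have "\<Phi> d' - \<Phi> c' \<le> 6 * \<epsilon> * M" using c' by auto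
  moreover have "(d' - c') * (\<kappa> / 2 - 3 * \<epsilon> * G) < \<Phi> d' - \<Phi> c'"
    unfolding eq P_def[symmetric] using lower c' by (intro mult_strict_left_mono) auto
  ultimately have "\<kappa> / 2 * (d' - c') < \<epsilon> * (Q - 1)" by (simp add: Q_def algebra_simps)
  also have "\<dots> < \<epsilon> * Q" using \<epsilon> by simp
  also have "\<dots> = \<kappa> / 2 * (d' - c')" using Q by (simp add: \<epsilon>_def)
  finally show False by simp
qed

text \<open>If \<open>g\<close> were negative on a subinterval, the \<open>x n\<close> would
  eventually accelerate away from the wall at rate at least \<open>\<kappa> / 2\<close> there, as
  the spring only adds to this. The mean velocities on its first and last third would then differ by
  a fixed amount, although \<open>x n\<close> tends to 0 uniformly.\<close>

lemma attraction_at_rest: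
  assumes cd: "c < d" and rest: "\<And>t. t \<in> {c..d} \<Longrightarrow> X t = 0" and t: "t \<in> {c..d}"
  shows "g t 0 L \<ge> 0"
proof (rule ccontr)
  assume "\<not> ?thesis"
  then have "- g t 0 L > 0" by simp
  moreover have "continuous_on UNIV (\<lambda>t. - g t 0 L)" by (intro continuous_intros g_comp_cont)
  ultimately obtain c' d' \<kappa> where c': "c' < d'" "{c'..d'} \<subseteq> {c..d}"
    and \<kappa>: "\<kappa> > 0" "\<And>s. s \<in> {c'..d'} \<Longrightarrow> - g s 0 L \<ge> \<kappa>"
    using uniformly_positive_subinterval[OF cd t] by blast
  define h where "h = (d' - c') / 3"
  have h: "h > 0" using c' by (simp add: h_def)
  \<comment> \<open>Four values of \<open>x n\<close>, each below \<epsilon>, must not add up to the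
    displacement \<open>h * (h * (\<kappa> / 2))\<close> forced by the acceleration.\<close>
  define \<epsilon> where "\<epsilon> = \<kappa> / 2 * h\<^sup>2 / 4"
  have \<epsilon>: "\<epsilon> > 0" using \<kappa> h by (simp add: \<epsilon>_def)
  have "\<forall>\<^sub>F n in sequentially. \<forall>t\<in>{c..d}. \<bar>x n t\<bar> < \<epsilon>" by (rule uniformly_small[OF rest \<epsilon>])
  moreover have "\<forall>\<^sub>F n in sequentially. \<forall>t\<in>{c..d}. dist (g t (x n t) (l n)) (g t (X t) L) < \<kappa> / 2"
    using \<kappa> by (intro uniform_limitD[OF acceleration_lim]) simp
  ultimately have "\<forall>\<^sub>F n in sequentially. (\<forall>t\<in>{c..d}. \<bar>x n t\<bar> < \<epsilon>) \<and>
      (\<forall>t\<in>{c..d}. dist (g t (x n t) (l n)) (g t (X t) L) < \<kappa> / 2)"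
    by (rule eventually_conj)
  from eventually_happens'[OF sequentially_bot this]
  obtain n where n: "\<And>t. t \<in> {c..d} \<Longrightarrow> \<bar>x n t\<bar> < \<epsilon>"
    "\<And>t. t \<in> {c..d} \<Longrightarrow> dist (g t (x n t) (l n)) (g t (X t) L) < \<kappa> / 2"
    by blast
  obtain r1 where r1: "c' < r1" "r1 < c' + h" "x n (c' + h) - x n c' = (c' + h - c') * v n r1"
    using MVT2[of c' "c' + h" "x n" "v n"] h x_deriv by auto
  obtain r2 where r2: "c' + 2 * h < r2" "r2 < d'" "x n d' - x n (c' + 2 * h) = (d' - (c' + 2 * h)) * v n r2"
    using MVT2[of "c' + 2 * h" d' "x n" "v n"] h x_deriv by (auto simp: h_def field_simps)
  have d': "d' - (c' + 2 * h) = h" "d' = c' + 3 * h" by (simp_all add: h_def field_simps)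
  obtain s where s: "r1 < s" "s < r2"
    "v n r2 - v n r1 = (r2 - r1) * - (g s (x n s) (l n) - (b n)\<^sup>2 * pos_part (- x n s))"
    using MVT2[of r1 r2 "v n"] r1 r2 v_deriv h by force
  have s': "s \<in> {c'..d'}" using s r1 r2 by auto
  have scd: "s \<in> {c..d}" using s' c' by blast
  have "\<kappa> / 2 \<le> - g s (x n s) (l n)"
    using n(2)[OF scd] \<kappa>(2)[OF s'] unfolding rest[OF scd] dist_real_def by linarith
  moreover have "(b n)\<^sup>2 * pos_part (- x n s) \<ge> 0" by (simp add: pos_part_nonneg)
  ultimately have acc: "\<kappa> / 2 \<le> - (g s (x n s) (l n) - (b n)\<^sup>2 * pos_part (- x n s))" by linarith
  have "h * (\<kappa> / 2) \<le> (r2 - r1) * - (g s (x n s) (l n) - (b n)\<^sup>2 * pos_part (- x n s))"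
    using acc r1 r2 h \<kappa> by (intro mult_mono) auto
  then have "h * (h * (\<kappa> / 2)) \<le> h * (v n r2 - v n r1)"
    using h s(3) by (intro mult_left_mono) auto
  also have "\<dots> = (x n d' - x n (c' + 2 * h)) - (x n (c' + h) - x n c')"
    using r1(3) r2(3) d'(1) by (simp add: algebra_simps)
  also have "\<dots> < 4 * \<epsilon>"
  proof -
    have "{c', c' + h, c' + 2 * h, d'} \<subseteq> {c'..d'}" using h d'(2) by auto
    then have "\<bar>x n c'\<bar> < \<epsilon>" "\<bar>x n (c' + h)\<bar> < \<epsilon>" "\<bar>x n (c' + 2 * h)\<bar> < \<epsilon>" "\<bar>x n d'\<bar> < \<epsilon>"
      using n(1) c'(2) by blast+
    then show ?thesis by linarith
  qed
  finally show False by (simp add: \<epsilon>_def power2_eq_square algebra_simps)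
qed

text \<open>The maximum of \<open>X\<close> over \<open>{p..q}\<close> is either 0, so that
  \<open>X\<close> rests and \<open>E\<close> vanishes by \<open>no_energy_at_rest\<close>, or it is
  attained in the interior, where \<open>(deriv X u)\<^sup>2 = E u\<close> is 0.\<close>

lemma no_zero_pair:
  assumes "p < q" "X p = 0" "X q = 0" "\<And>r. r \<in> {p..q} \<Longrightarrow> E r > 0"
  shows False
proof -
  obtain u where u: "u \<in> {p..q}" "\<And>r. r \<in> {p..q} \<Longrightarrow> X r \<le> X u"
    using continuous_attains_sup[of "{p..q}" X] assms(1) X_cont by auto
  show False
  proof (cases "X u = 0")
    case True
    then have "X r = 0" if "r \<in> {p..q}" for r
      using u(2)[OF that] X_nonneg[of r] by simp
    then have "E p = 0" using assms(1) by (intro no_energy_at_rest[OF assms(1)]) auto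
    then show False using assms(1) assms(4)[of p] by simp
  next
    case False
    then have Xu: "X u > 0" using X_nonneg[of u] by linarith
    then have "u \<noteq> p" "u \<noteq> q" using assms by auto
    then have pu: "p < u" "u < q" using u by auto
    have "deriv X u = 0"
    proof (rule DERIV_local_max[OF free_flight(1)[OF Xu]])
      show "0 < min (u - p) (q - u)" using pu by simp
      show "\<forall>r. \<bar>u - r\<bar> < min (u - p) (q - u) \<longrightarrow> X r \<le> X u"
        by (auto intro!: u(2))
    qed
    then show False using free_flight(2)[OF Xu] assms(4)[OF u(1)] by simp
  qed
qed

text \<open>Continuity keeps \<open>E\<close> positive near \<open>t\<close>, so a second zero there
  would contradict \<open>no_zero_pair\<close>.\<close>

lemma isolated_zero:
  assumes "X t = 0" "E t > 0"
  shows "\<forall>\<^sub>F s in at t. X s > 0"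
proof -
  have "\<forall>\<^sub>F s in nhds t. E s > 0"
    using E_cont[of UNIV] assms
    by (intro order_tendstoD(1)[of E "E t"]) (auto simp: continuous_on_eq_continuous_at isCont_def tendsto_at_iff_tendsto_nhds)
  then obtain \<delta> where \<delta>: "\<delta> > 0" "\<And>s. dist s t < \<delta> \<Longrightarrow> E s > 0"
    unfolding eventually_nhds_metric by blast
  show ?thesis
    unfolding eventually_at
  proof (intro exI[of _ \<delta>] conjI ballI impI \<delta>(1))
    fix s assume s: "s \<noteq> t \<and> dist s t < \<delta>"
    show "X s > 0"
    proof (rule ccontr)
      assume "\<not> ?thesis"
      then have Xs: "X s = 0" using X_nonneg[of s] by linarith
      have E: "E r > 0" if "r \<in> {s..t} \<or> r \<in> {t..s}" for r
        using that s by (intro \<delta>(2)) (auto simp: dist_real_def)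
      show False
        using no_zero_pair[of s t] no_zero_pair[of t s] Xs assms(1) E s by (cases "s < t") auto
    qed
  qed
qed

lemma positive_if_one_sided_derivative:
  assumes "(X has_real_derivative D) (at t within S)" "D \<noteq> 0" "X t = 0"
  shows "\<forall>\<^sub>F s in at t within S. X s > 0"
proof -
  have "((\<lambda>s. (X s - X t) / (s - t)) \<longlongrightarrow> D) (at t within S)"
    using assms(1) by (simp add: has_field_derivative_iff)
  then have "\<forall>\<^sub>F s in at t within S. (X s - X t) / (s - t) \<noteq> 0"
    using assms(2) by (rule tendsto_imp_eventually_ne)
  then show ?thesis
    by eventually_elim (use assms(3) X_nonneg in \<open>auto simp: less_le\<close>)
qed

text \<open>By uniqueness of limits \<open>D\<close> is \<open>sqrt (E t)\<close> up to sign. Thus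
  information from one side gives positive energy, and \<open>isolated_zero\<close> turns this into
  positivity on both sides, as condition (iii) demands.\<close>

lemma energy_of_one_sided_derivative:
  assumes "X t = 0" "D \<noteq> 0"
    and "(X has_real_derivative D) (at_left t) \<or> (X has_real_derivative D) (at_right t)"
  shows "E t > 0"
  using assms(3)
proof
  assume D: "(X has_real_derivative D) (at_left t)"
  have "(X has_real_derivative - sqrt (E t)) (at_left t)"
    by (rule left_derivative[OF assms(1) positive_if_one_sided_derivative[OF D assms(2,1)]])
  then have "D = - sqrt (E t)"
    using D tendsto_unique[of "at_left t"] unfolding has_field_derivative_iff by auto
  then show ?thesis using assms(2) E_nonneg[of t] by (auto simp: less_le)
next
  assume D: "(X has_real_derivative D) (at_right t)"
  have "(X has_real_derivative sqrt (E t)) (at_right t)"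
    by (rule right_derivative[OF assms(1) positive_if_one_sided_derivative[OF D assms(2,1)]])
  then have "D = sqrt (E t)"
    using D tendsto_unique[of "at_right t"] unfolding has_field_derivative_iff by auto
  then show ?thesis using assms(2) E_nonneg[of t] by (auto simp: less_le)
qed

lemma bouncing_limit:
  assumes p: "\<And>t y. y \<ge> 0 \<Longrightarrow> p t (w + y) = g t y L"
  shows "bouncing_solution w p (- \<infinity>) \<infinity> (\<lambda>t. w + X t)"
proof -
  have shift: "((\<lambda>t. w + X t) has_real_derivative D) (at t within S) \<longleftrightarrow> (X has_real_derivative D) (at t within S)"
    for D t S
    using DERIV_diff[of "\<lambda>t. w + X t" D t S "\<lambda>t. w" 0] DERIV_add[of "\<lambda>t. w" 0 t S X D] by auto
  have D: "deriv (\<lambda>t. w + X t) = deriv X"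
    unfolding deriv_def shift ..
  have diff: "(\<lambda>t. w + X t) differentiable (at t within S) \<longleftrightarrow> X differentiable (at t within S)" for t S
    unfolding real_differentiable_def shift ..
  have UN: "einterval (- \<infinity>) \<infinity> = UNIV" by (auto simp: einterval_def)
  have E2: "\<exists>dl dr. (X has_real_derivative dl) (at_left t) \<and> (X has_real_derivative dr) (at_right t) \<and> dl = - dr"
    if "X t = 0" "\<forall>\<^sub>F s in at t. X s > 0" for t
    using left_derivative[OF that(1)] right_derivative[OF that(1)] that(2)
    unfolding eventually_at_split by blast
  \<comment> \<open>\<open>I\<close> need not be closed, and \<open>t\<close> may be an endpoint;
    joining \<open>t\<close> to another point of \<open>I\<close> gives a closed interval of contact
    for \<open>attraction_at_rest\<close>.\<close>
  have E4: "p t w \<ge> 0" if I: "is_interval I" "s1 \<in> I" "s2 \<in> I" "s1 < s2" "\<forall>t\<in>I. X t = 0" "t \<in> I" for I s1 s2 t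
  proof -
    obtain s where s: "s \<in> I" "s \<noteq> t" using I(2-4) by (cases "s1 = t") auto
    define c d where "c = min s t" and "d = max s t"
    have cd: "c \<in> I" "d \<in> I" "c < d" "t \<in> {c..d}"
      using s I(6) by (auto simp: c_def d_def min_def max_def)
    have "X r = 0" if "r \<in> {c..d}" for r
      using I(1,5) cd(1,2) that unfolding is_interval_1 by (metis atLeastAtMost_iff)
    then have "g t 0 L \<ge> 0"
      using cd(3,4) by (intro attraction_at_rest[of c d]) auto
    then show ?thesis using p[of 0 t] by simp
  qed
  show ?thesis
    unfolding bouncing_solution_def UN shift D diff
  proof (intro conjI ballI allI impI)
    show "continuous_on UNIV (\<lambda>t. w + X t)" by (intro continuous_intros X_cont)
    show "w \<le> w + X t" for t using X_nonneg by simp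
    fix t
    show "\<forall>\<^sub>F s in nhds t. X differentiable (at s)" "deriv X differentiable (at t)"
      "deriv (deriv X) t + p t (w + X t) = 0" if "w < w + X t"
    proof -
      have Xt: "X t > 0" using that by simp
      show "\<forall>\<^sub>F s in nhds t. X differentiable (at s)" by (rule free_flight(3)[OF Xt])
      show "deriv X differentiable (at t)"
        using free_flight(4)[OF Xt] unfolding real_differentiable_def by blast
      show "deriv (deriv X) t + p t (w + X t) = 0"
        unfolding DERIV_imp_deriv[OF free_flight(4)[OF Xt]] using p[of "X t" t] Xt by simp
    qed
    show "\<exists>dl dr. (X has_real_derivative dl) (at_left t) \<and> (X has_real_derivative dr) (at_right t) \<and> dl = - dr"
      if "w + X t = w \<and> (\<forall>\<^sub>F s in at t. w < w + X s)"
      using E2[of t] that by simp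
    show "\<forall>\<^sub>F s in at t. w < w + X s"
      if asm: "w + X t = w \<and> ((\<exists>d. (X has_real_derivative d) (at_left t) \<and> d \<noteq> 0) \<or>
        (\<exists>d. (X has_real_derivative d) (at_right t) \<and> d \<noteq> 0))"
    proof -
      have "X t = 0" using asm by simp
      moreover obtain d where "d \<noteq> 0"
        "(X has_real_derivative d) (at_left t) \<or> (X has_real_derivative d) (at_right t)"
        using asm by blast
      ultimately have "E t > 0" by (rule energy_of_one_sided_derivative)
      then show ?thesis using isolated_zero \<open>X t = 0\<close> by simp
    qed
    show "0 \<le> p t w" if I: "is_interval I \<and> I \<subseteq> UNIV \<and> (\<exists>s\<in>I. \<exists>t\<in>I. s < t) \<and> (\<forall>t\<in>I. w + X t = w)" "t \<in> I" for I
    proof -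
      obtain s1 s2 where "s1 \<in> I" "s2 \<in> I" "s1 < s2" using I(1) by blast
      then show ?thesis using E4[of I s1 s2 t] I by simp
    qed
  qed simp
qed

end

section \<open>Existence of bouncing solutions\<close>

lemma periodic_Arzela_Ascoli:
  fixes F :: "nat \<Rightarrow> real \<Rightarrow> 'a::euclidean_space"
  assumes T: "T > 0" and per: "\<And>n t. F n (t + T) = F n t"
    and B: "\<And>n t. norm (F n t) \<le> B" and K: "\<And>n s t. norm (F n s - F n t) \<le> K * \<bar>s - t\<bar>"
  obtains k \<Phi> where "strict_mono (k :: nat \<Rightarrow> nat)" "uniform_limit UNIV (\<lambda>n. F (k n)) \<Phi> sequentially"
    "\<And>t. \<Phi> (t + T) = \<Phi> t"
proof -
  obtain k \<phi> where k: "strict_mono (k :: nat \<Rightarrow> nat)"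
    and conv: "uniform_limit {0..T} (\<lambda>n. F (k n)) \<phi> sequentially"
    by (rule Arzela_Ascoli_Lipschitz[of 0 T F B K, OF B K]) (rule that)
  define \<Phi> where "\<Phi> t = \<phi> (t - T * of_int \<lfloor>t / T\<rfloor>)" for t
  have lim: "uniform_limit UNIV (\<lambda>n. F (k n)) \<Phi> sequentially"
    unfolding uniform_limit_sequentially_iff
  proof (intro allI impI)
    fix e :: real assume "e > 0"
    then obtain N where N: "\<And>n t. n \<ge> N \<Longrightarrow> t \<in> {0..T} \<Longrightarrow> dist (F (k n) t) (\<phi> t) < e"
      using conv unfolding uniform_limit_sequentially_iff by blast
    have "dist (F (k n) t) (\<Phi> t) < e" if "n \<ge> N" for n t
    proof -
      have "F (k n) t = F (k n) (t - T * of_int \<lfloor>t / T\<rfloor>)"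
        using periodic_int_multiple[of "F (k n)" T "t - T * of_int \<lfloor>t / T\<rfloor>" "\<lfloor>t / T\<rfloor>"] per by simp
      then show ?thesis
        using N[OF that, of "t - T * of_int \<lfloor>t / T\<rfloor>"] floor_quotient_remainder[OF T, of t]
        by (simp add: \<Phi>_def)
    qed
    then show "\<exists>N. \<forall>n\<ge>N. \<forall>t\<in>UNIV. dist (F (k n) t) (\<Phi> t) < e" by blast
  qed
  have "\<Phi> (t + T) = \<Phi> t" for t
    using LIMSEQ_unique[OF tendsto_uniform_limitI[OF lim, of "t + T"] _] tendsto_uniform_limitI[OF lim, of t] per
    by simp
  then show thesis using that k lim by blast
qed

text \<open>Strictness of \<open>m1 < \<mu>1\<close> and \<open>\<mu>2 < m2\<close> absorbs the
  tolerance of the limits for large radii; the remaining radii form a compact set over one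
  period.\<close>

lemma linear_growth:
  fixes f :: "real \<Rightarrow> real \<Rightarrow> real"
  assumes "T > 0" "R0 > 0" and f: "continuous_on (UNIV \<times> {R0..}) (\<lambda>(t, r). f t r)"
    and per: "\<And>t r. r \<ge> R0 \<Longrightarrow> f (t + T) r = f t r"
    and lo: "le_liminf_uniformly \<mu>1 (\<lambda>t r. f t r / r)" and hi: "limsup_le_uniformly (\<lambda>t r. f t r / r) \<mu>2"
    and m: "0 \<le> m1" "m1 < \<mu>1" "\<mu>2 < m2" "0 \<le> m2"
  obtains C where "C \<ge> 0" "\<And>t y. y \<ge> 0 \<Longrightarrow> m1 * y - C \<le> f t (R0 + y)" "\<And>t y. y \<ge> 0 \<Longrightarrow> f t (R0 + y) \<le> m2 * y + C"
proof -
  have "\<forall>\<^sub>F r in at_top. \<forall>t. m1 \<le> f t r / r" "\<forall>\<^sub>F r in at_top. \<forall>t. f t r / r \<le> m2"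
    using lo[unfolded le_liminf_uniformly_def, rule_format, of "\<mu>1 - m1"]
      hi[unfolded limsup_le_uniformly_def, rule_format, of "m2 - \<mu>2"] m by simp_all
  then obtain r1 r2 where r1: "\<And>r t. r \<ge> r1 \<Longrightarrow> m1 \<le> f t r / r" and r2: "\<And>r t. r \<ge> r2 \<Longrightarrow> f t r / r \<le> m2"
    unfolding eventually_at_top_linorder by blast
  define R where "R = max R0 (max r1 r2)"
  have R: "R \<ge> R0" "R \<ge> r1" "R \<ge> r2" "R > 0" using assms(2) by (auto simp: R_def)
  have "bounded ((\<lambda>(t, r). f t r) ` ({0..T} \<times> {R0..R}))"
    by (intro compact_imp_bounded compact_continuous_image continuous_on_subset[OF f] compact_Times) auto
  then obtain C0 where C0: "\<And>t r. t \<in> {0..T} \<Longrightarrow> r \<in> {R0..R} \<Longrightarrow> \<bar>f t r\<bar> \<le> C0"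
    unfolding bounded_iff by fastforce
  have C0': "\<bar>f t r\<bar> \<le> C0" if r: "r \<in> {R0..R}" for t r
  proof -
    have "f t r = f (t - T * of_int \<lfloor>t / T\<rfloor>) r"
      using periodic_int_multiple[of "\<lambda>t. f t r" T "t - T * of_int \<lfloor>t / T\<rfloor>" "\<lfloor>t / T\<rfloor>"] per r by simp
    then show ?thesis
      using C0[of "t - T * of_int \<lfloor>t / T\<rfloor>" r] r floor_quotient_remainder[OF assms(1), of t] by simp
  qed
  have C00: "C0 \<ge> 0" using C0'[of R0 0] R by simp
  \<comment> \<open>\<open>C0\<close> bounds \<open>f\<close> on the compact strip,
    \<open>m2 * R0\<close> pays for writing the radius as \<open>R0 + y\<close> in the upper bound,
    and \<open>m1 * R\<close> covers the lower bound on the strip.\<close>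
  define C where "C = C0 + m2 * R0 + m1 * R"
  have nn: "m2 * R0 \<ge> 0" "m1 * R \<ge> 0" using m R assms(2) by auto
  show thesis
  proof (rule that[of C])
    show "C \<ge> 0" using C00 nn by (simp add: C_def)
    fix t y :: real assume y: "y \<ge> 0"
    have my: "m1 * y \<ge> 0" "m2 * y \<ge> 0" using m y by auto
    show "m1 * y - C \<le> f t (R0 + y)"
    proof (cases "R0 + y \<le> R")
      case True
      then have "m1 * y \<le> m1 * R" using m assms(2) by (intro mult_left_mono) auto
      then show ?thesis using C0'[of "R0 + y" t] True y nn C00 unfolding C_def by (auto simp: abs_le_iff)
    next
      case False
      then have "m1 * (R0 + y) \<le> f t (R0 + y)"
        using r1[of "R0 + y" t] R y assms(2) by (simp add: pos_le_divide_eq)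
      moreover have "m1 * R0 \<ge> 0" using m assms(2) by simp
      ultimately show ?thesis using nn C00 unfolding C_def by (simp add: algebra_simps)
    qed
    show "f t (R0 + y) \<le> m2 * y + C"
    proof (cases "R0 + y \<le> R")
      case True
      then show ?thesis using C0'[of "R0 + y" t] y nn C00 my unfolding C_def by (auto simp: abs_le_iff)
    next
      case False
      then have "f t (R0 + y) \<le> m2 * (R0 + y)"
        using r2[of "R0 + y" t] R y assms(2) by (simp add: pos_divide_le_eq)
      then show ?thesis using nn C00 unfolding C_def by (simp add: algebra_simps)
    qed
  qed
qed

text \<open>The angle swept in one period per unit of angular momentum. \<open>pos_part\<close>
  keeps the radius at least \<open>R0\<close> for penalised solutions, which dip below the
  wall.\<close>

definition inverse_square_integral :: "real \<Rightarrow> real \<Rightarrow> (real \<Rightarrow> real) \<Rightarrow> real" where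
  "inverse_square_integral R0 T x = integral {0..T} (\<lambda>t. 1 / (R0 + pos_part (x t))\<^sup>2)"

lemma radius_pos: "R0 > 0 \<Longrightarrow> R0 + pos_part y > 0"
  by (simp add: pos_part_def add_pos_nonneg)

lemma continuous_on_inverse_square:
  assumes "R0 > 0" "continuous_on S x"
  shows "continuous_on S (\<lambda>t. 1 / (R0 + pos_part (x t))\<^sup>2)"
  using assms(2) radius_pos[OF assms(1)] by (intro continuous_intros) (auto simp: less_imp_neq[symmetric])

lemma inverse_square_integral_lower:
  assumes "T > 0" "R0 > 0" "continuous_on {0..T} x" "\<And>t. t \<in> {0..T} \<Longrightarrow> pos_part (x t) \<le> B"
  shows "T / (R0 + B)\<^sup>2 \<le> inverse_square_integral R0 T x"
proof -
  have "integral {0..T} (\<lambda>t. 1 / (R0 + B)\<^sup>2) \<le> inverse_square_integral R0 T x"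
    unfolding inverse_square_integral_def
  proof (rule integral_le)
    show "(\<lambda>t. 1 / (R0 + pos_part (x t))\<^sup>2) integrable_on {0..T}"
      using assms by (intro integrable_continuous_real continuous_on_inverse_square)
    show "1 / (R0 + B)\<^sup>2 \<le> 1 / (R0 + pos_part (x t))\<^sup>2" if "t \<in> {0..T}" for t
      using assms(4)[OF that] radius_pos[OF assms(2), of "x t"]
      by (intro divide_left_mono power_mono mult_pos_pos) auto
  qed (rule integrable_const_ivl)
  then show ?thesis using assms(1) by simp
qed

lemma inverse_square_integral_tendsto:
  assumes "T > 0" "R0 > 0" and X: "\<And>n. continuous_on {0..T} (X n)"
    and lim: "uniform_limit {0..T} X x sequentially"
  shows "(\<lambda>n. inverse_square_integral R0 T (X n)) \<longlonglongrightarrow> inverse_square_integral R0 T x"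
proof -
  have x: "continuous_on {0..T} x" by (rule uniform_limit_theorem[OF _ lim]) (auto simp: X)
  have "uniform_limit {0..T} (\<lambda>n t. 1 / (R0 + pos_part (X n t))\<^sup>2) (\<lambda>t. 1 / (R0 + pos_part (x t))\<^sup>2) sequentially"
    by (rule uniform_limit_continuous_compose[OF continuous_on_inverse_square[OF assms(2) continuous_on_id]
        compact_Icc lim x])
  then show ?thesis
    unfolding inverse_square_integral_def using assms(1)
    by (intro tendsto_uniform_limitI[OF uniform_limit_indefinite_integral[where a = 0 and b = T]]
        continuous_on_inverse_square assms(2) X) auto
qed

lemma inverse_square_integral_pos:
  assumes "T > 0" "R0 > 0" and x: "continuous_on {0..T} x"
  shows "inverse_square_integral R0 T x > 0"
proof -
  have "continuous_on {0..T} (\<lambda>t. pos_part (x t))" using x by (intro continuous_intros)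
  then obtain s where s: "s \<in> {0..T}" "\<And>t. t \<in> {0..T} \<Longrightarrow> pos_part (x t) \<le> pos_part (x s)"
    using continuous_attains_sup[of "{0..T}" "\<lambda>t. pos_part (x t)"] assms(1) by auto
  have "T / (R0 + pos_part (x s))\<^sup>2 > 0" using assms(1) radius_pos[OF assms(2), of "x s"] by simp
  also have "\<dots> \<le> inverse_square_integral R0 T x"
    by (rule inverse_square_integral_lower[OF assms s(2)])
  finally show ?thesis .
qed

lemma wall_energy_bounds:
  assumes "wall_energy 1 b x v \<le> M" "b \<ge> 1"
  shows "\<bar>v\<bar> \<le> sqrt M" "b * pos_part (- x) \<le> sqrt M" "\<bar>x\<bar> \<le> sqrt M" "v\<^sup>2 + (b * pos_part (- x))\<^sup>2 \<le> M"
proof -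
  have sq: "v\<^sup>2 + (pos_part x)\<^sup>2 + (b * pos_part (- x))\<^sup>2 \<le> M"
    using assms(1) by (simp add: wall_energy_def)
  then show "v\<^sup>2 + (b * pos_part (- x))\<^sup>2 \<le> M" using zero_le_power2[of "pos_part x"] by linarith
  show "\<bar>v\<bar> \<le> sqrt M" "b * pos_part (- x) \<le> sqrt M"
    using sq by (auto intro!: real_le_rsqrt intro: order_trans[rotated] add_increasing add_increasing2)
  have "x\<^sup>2 \<le> wall_energy 1 b x v"
    using norm_le_wall_energy[of b x v] assms(2) zero_le_power2[of v] one_le_power[of b 2] by linarith
  then show "\<bar>x\<bar> \<le> sqrt M" using assms(1) by (intro real_le_rsqrt) simp
qed

text \<open>Velocities may jump in the limit, so compactness is applied to the triple of position,
  energy density \<open>e\<close> and parameter \<open>l\<close>. By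
  \<open>wall_energy_deriv\<close> with \<open>a = 0\<close>, \<open>e\<close> is Lipschitz
  uniformly in the stiffness.\<close>

lemma penalised_compactness:
  fixes g :: "real \<Rightarrow> real \<Rightarrow> real \<Rightarrow> real"
  assumes T: "T > 0" and g: "continuous_on UNIV (\<lambda>(t, x, l). g t x l)"
    and b: "\<And>n. b n \<ge> 1" "filterlim b at_top sequentially"
    and x: "\<And>n t. (x n has_real_derivative v n t) (at t)"
    and v: "\<And>n t. (v n has_real_derivative - (g t (x n t) (l n) - (b n)\<^sup>2 * pos_part (- x n t))) (at t)"
    and per: "\<And>n t. x n (t + T) = x n t" "\<And>n t. v n (t + T) = v n t"
    and M: "\<And>n t. wall_energy 1 (b n) (x n t) (v n t) \<le> M"
    and G: "\<And>n t. \<bar>g t (x n t) (l n)\<bar> \<le> G" and l: "\<And>n. l n \<in> {0..1}"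
  obtains k X E L where "strict_mono k" "uniform_limit UNIV (\<lambda>n. x (k n)) X sequentially"
    "\<And>t. X (t + T) = X t"
    "penalised_limit g (\<lambda>n. x (k n)) (\<lambda>n. v (k n)) (\<lambda>n. b (k n)) (\<lambda>n. l (k n)) X E L G (sqrt M)"
proof -
  define e where "e n t = (v n t)\<^sup>2 + (b n * pos_part (- x n t))\<^sup>2" for n t
  define F where "F n t = (x n t, e n t, l n)" for n t
  have e: "\<bar>e n t\<bar> \<le> M" for n t
    using wall_energy_bounds(4)[OF M b(1)] by (simp add: e_def)
  have M0: "M \<ge> 0" using e[of 0 0] by linarith
  have G0: "G \<ge> 0" using G[of 0 0] by linarith
  have xlip: "\<bar>x n s - x n t\<bar> \<le> sqrt M * \<bar>s - t\<bar>" for n s t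
    using field_differentiable_bound[of UNIV "x n" "v n" "sqrt M" s t] x
      wall_energy_bounds(1)[OF M b(1)] by auto
  have elip: "\<bar>e n s - e n t\<bar> \<le> 2 * sqrt M * G * \<bar>s - t\<bar>" for n s t
  proof -
    have de: "(e n has_real_derivative 2 * v n t * (0\<^sup>2 * pos_part (x n t) - g t (x n t) (l n))) (at t)" for t
      using wall_energy_deriv[of "x n" "v n" t UNIV "\<lambda>t. g t (x n t) (l n)" "b n" 0, OF x v]
      by (simp add: e_def[abs_def] wall_energy_def)
    have "norm (2 * v n t * (0\<^sup>2 * pos_part (x n t) - g t (x n t) (l n))) \<le> 2 * sqrt M * G" for t
    proof -
      have "\<bar>v n t\<bar> * \<bar>g t (x n t) (l n)\<bar> \<le> sqrt M * G"
        using M0 by (intro mult_mono wall_energy_bounds(1)[OF M b(1)] G) auto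
      then show ?thesis by (simp add: abs_mult)
    qed
    from field_differentiable_bound[OF convex_UNIV de this UNIV_I UNIV_I, where x = s and y = t]
    show ?thesis by simp
  qed
  have triple: "norm (p, q, r) \<le> \<bar>p\<bar> + \<bar>q\<bar> + \<bar>r\<bar>" for p q r :: real
    using norm_Pair_le[of p "(q, r)"] norm_Pair_le[of q r] by simp
  obtain k \<Phi> where k: "strict_mono (k :: nat \<Rightarrow> nat)"
    and lim: "uniform_limit UNIV (\<lambda>n. F (k n)) \<Phi> sequentially" and \<Phi>: "\<And>t. \<Phi> (t + T) = \<Phi> t"
  proof (rule periodic_Arzela_Ascoli[OF T, of F "sqrt M + M + 1" "sqrt M + 2 * sqrt M * G"])
    show "F n (t + T) = F n t" for n t by (simp add: F_def e_def per)
    show "norm (F n t) \<le> sqrt M + M + 1" for n t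
      using triple[of "x n t" "e n t" "l n"] wall_energy_bounds(3)[OF M b(1), of n t] e[of n t] l[of n]
      by (simp add: F_def)
    show "norm (F n s - F n t) \<le> (sqrt M + 2 * sqrt M * G) * \<bar>s - t\<bar>" for n s t
      using triple[of "x n s - x n t" "e n s - e n t" 0] xlip[of n s t] elip[of n s t]
      by (simp add: F_def algebra_simps)
  qed (rule that)
  define X E L where "X t = fst (\<Phi> t)" and "E t = fst (snd (\<Phi> t))" and "L = snd (snd (\<Phi> 0))" for t
  have xlim: "uniform_limit UNIV (\<lambda>n. x (k n)) X sequentially"
    using bounded_linear.uniform_limit[OF bounded_linear_fst lim] by (simp add: F_def X_def[abs_def])
  have slim: "uniform_limit UNIV (\<lambda>n t. snd (F (k n) t)) (\<lambda>t. snd (\<Phi> t)) sequentially"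
    by (rule bounded_linear.uniform_limit[OF bounded_linear_snd lim])
  have elim: "uniform_limit UNIV (\<lambda>n. e (k n)) E sequentially"
    using bounded_linear.uniform_limit[OF bounded_linear_fst slim] by (simp add: F_def E_def[abs_def])
  have "uniform_limit UNIV (\<lambda>n t. l (k n)) (\<lambda>t. snd (snd (\<Phi> t))) sequentially"
    using bounded_linear.uniform_limit[OF bounded_linear_snd slim] by (simp add: F_def)
  then have llim: "(\<lambda>n. l (k n)) \<longlonglongrightarrow> L"
    unfolding L_def by (rule tendsto_uniform_limitI) simp
  show thesis
  proof (rule that[OF k xlim])
    show "X (t + T) = X t" for t by (simp add: X_def \<Phi>)
    show "penalised_limit g (\<lambda>n. x (k n)) (\<lambda>n. v (k n)) (\<lambda>n. b (k n)) (\<lambda>n. l (k n)) X E L G (sqrt M)"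
    proof
      show "b (k n) > 0" for n using b(1)[of "k n"] by linarith
      show "filterlim (\<lambda>n. b (k n)) at_top sequentially"
        by (rule filterlim_compose[OF b(2) filterlim_subseq[OF k]])
      show "\<bar>v (k n) t\<bar> \<le> sqrt M" "b (k n) * pos_part (- x (k n) t) \<le> sqrt M" for n t
        by (rule wall_energy_bounds[OF M b(1)])+
      show "uniform_limit UNIV (\<lambda>n t. (v (k n) t)\<^sup>2 + (b (k n) * pos_part (- x (k n) t))\<^sup>2) E sequentially"
        using elim by (simp add: e_def[abs_def])
    qed (fact x v g G xlim llim)+
  qed
qed

lemma periodic_bouncing_solution:
  fixes T R0 \<mu>1 \<mu>2 :: real and N :: int and f :: "real \<Rightarrow> real \<Rightarrow> real"
  assumes T: "T > 0" and R0: "R0 > 0"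
    and f: "continuous_on (UNIV \<times> {R0..}) (\<lambda>(t, r). f t r)"
    and per: "\<And>t r. r \<ge> R0 \<Longrightarrow> f (t + T) r = f t r"
    and lo: "le_liminf_uniformly \<mu>1 (\<lambda>t r. f t r / r)"
    and hi: "limsup_le_uniformly (\<lambda>t r. f t r / r) \<mu>2"
    and N: "(of_int N * pi / T)\<^sup>2 < \<mu>1" "\<mu>1 \<le> \<mu>2" "\<mu>2 < (of_int (N + 1) * pi / T)\<^sup>2"
  obtains \<epsilon>0 where "\<epsilon>0 > 0"
    "\<And>\<epsilon>. 0 < \<epsilon> \<Longrightarrow> \<epsilon> \<le> \<epsilon>0 \<Longrightarrow> \<exists>L \<rho> \<theta>. bouncing_solution_system R0 L f (- \<infinity>) \<infinity> \<rho> \<theta> \<and>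
      (\<forall>t. \<rho> (t + T) = \<rho> t) \<and> (\<forall>t. \<theta> (t + T) = \<theta> t + \<epsilon>)"
proof -
  \<comment> \<open>The hypotheses force \<open>N \<ge> 0\<close>, which permits taking roots in the
    upper nonresonance bound.\<close>
  have "(of_int N * (pi / T))\<^sup>2 < (of_int (N + 1) * (pi / T))\<^sup>2" using N by simp
  then have "(of_int N :: real)\<^sup>2 < (of_int (N + 1))\<^sup>2"
    using T by (simp only: power_mult_distrib mult_less_cancel_right) auto
  then have "(0 :: real) < of_int (2 * N + 1)" by (simp add: power2_eq_square algebra_simps)
  then have N0: "N \<ge> 0" by linarith
  obtain m1 m2 where m: "(of_int N * pi / T)\<^sup>2 < m1" "m1 < \<mu>1" "\<mu>2 < m2" "m2 < (of_int (N + 1) * pi / T)\<^sup>2"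
    using dense N(1,3) by metis
  have m0: "m1 > 0" "m2 > 0" using m N(2) zero_le_power2[of "of_int N * pi / T"] by linarith+
  define a1 a2 where "a1 = sqrt m1" and "a2 = sqrt m2"
  have a: "a1 > 0" "a2 > 0" "a1\<^sup>2 = m1" "a2\<^sup>2 = m2" using m0 by (auto simp: a1_def a2_def)
  have "of_int N * pi / T < a1" unfolding a1_def using m(1) by (rule real_less_rsqrt)
  then have Na1: "of_int N * pi < a1 * T" using T by (simp add: field_simps)
  have "a2 < of_int (N + 1) * pi / T"
    unfolding a2_def using m(4) N0 T by (intro real_less_lsqrt) auto
  then have Na2: "a2 * T < (of_int N + 1) * pi" using T by (simp add: field_simps)
  obtain C0 where C0: "C0 \<ge> 0" and f1: "\<And>t y. y \<ge> 0 \<Longrightarrow> m1 * y - C0 \<le> f t (R0 + y)"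
    and f2: "\<And>t y. y \<ge> 0 \<Longrightarrow> f t (R0 + y) \<le> m2 * y + C0"
    using linear_growth[OF T R0 f per lo hi] m m0 by (metis less_imp_le)
  define C where "C = C0 + 1 / R0 ^ 3"
  have C: "C \<ge> 0" using C0 R0 by (simp add: C_def)
  \<comment> \<open>The wall is shifted to \<open>y = 0\<close>, and below it the force keeps its
    value at the wall.\<close>
  define g where "g t y l = - (l\<^sup>2 / (R0 + pos_part y) ^ 3) + f t (R0 + pos_part y)" for t y l
  have gcont: "continuous_on UNIV (\<lambda>(t, y, l). g t y l)"
  proof -
    have "continuous_on UNIV (\<lambda>p :: real \<times> real \<times> real. (\<lambda>(t, r). f t r) (fst p, R0 + pos_part (fst (snd p))))"
      by (rule continuous_on_compose2[OF f]) (auto simp: pos_part_def intro!: continuous_intros)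
    moreover have "continuous_on UNIV (\<lambda>p :: real \<times> real \<times> real. (snd (snd p))\<^sup>2 / (R0 + pos_part (fst (snd p))) ^ 3)"
      using radius_pos[OF R0] by (intro continuous_intros) (auto simp: less_imp_neq[symmetric])
    ultimately show ?thesis
      unfolding g_def split_beta by (simp add: continuous_on_diff)
  qed
  have gper: "g (t + T) y l = g t y l" for t y l
    using per[of "R0 + pos_part y" t] by (simp add: g_def pos_part_nonneg)
  have centrifugal: "0 \<le> l\<^sup>2 / (R0 + pos_part y) ^ 3" "l\<^sup>2 / (R0 + pos_part y) ^ 3 \<le> 1 / R0 ^ 3"
    if "l \<in> {0..1}" for l y
  proof -
    show "0 \<le> l\<^sup>2 / (R0 + pos_part y) ^ 3" using radius_pos[OF R0, of y] by simp
    show "l\<^sup>2 / (R0 + pos_part y) ^ 3 \<le> 1 / R0 ^ 3"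
      using that R0 by (intro frac_le power_mono power_le_one) (auto simp: pos_part_def)
  qed
  have g1: "a1\<^sup>2 * pos_part y - C \<le> g t y l" if "l \<in> {0..1}" for t y l
    using f1[of "pos_part y" t] centrifugal[OF that, of y] by (simp add: g_def C_def a pos_part_nonneg)
  have g2: "g t y l \<le> a2\<^sup>2 * pos_part y + C" if "l \<in> {0..1}" for t y l
    using f2[OF pos_part_nonneg, of t y] order_trans[OF centrifugal[OF that, of y]] centrifugal(1)[OF that, of y]
    unfolding g_def C_def a by linarith
  obtain M b0 where M: "M > 0" and b0: "b0 \<ge> 1" and sol:
    "\<And>\<Lambda> b. b \<ge> b0 \<Longrightarrow> admissible_parameter T \<Lambda> \<Longrightarrow>
      \<exists>x v. (\<forall>t. (x has_real_derivative v t) (at t)) \<and>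
        (\<forall>t. (v has_real_derivative - (g t (x t) (\<Lambda> x) - b\<^sup>2 * pos_part (- x t))) (at t)) \<and>
        (\<forall>t. x (t + T) = x t) \<and> (\<forall>t. v (t + T) = v t) \<and> (\<forall>t. wall_energy 1 b (x t) (v t) \<le> M)"
    by (rule penalised_periodic_solution[OF T a(1,2) Na1 Na2 C gcont gper])
       (erule g1, erule g2, rule that)
  define B where "B = R0 + sqrt M"
  have B: "B > 0" using R0 M by (simp add: B_def add_pos_nonneg)
  \<comment> \<open>\<open>B\<close> bounds all radii uniformly in \<epsilon>, so
    \<open>T / B\<^sup>2\<close> is a lower bound for \<open>J X\<close> and the largest increment
    for which \<open>\<epsilon> / J X \<le> 1\<close> is guaranteed.\<close>
  show thesis
  proof (rule that[of "T / B\<^sup>2"])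
    show "T / B\<^sup>2 > 0" using T B by simp
    fix \<epsilon> :: real assume \<epsilon>: "0 < \<epsilon>" "\<epsilon> \<le> T / B\<^sup>2"
    define J where "J = inverse_square_integral R0 T"
    define \<Lambda> where "\<Lambda> x = max 0 (min 1 (\<epsilon> / J x))" for x
    have \<Lambda>: "\<Lambda> x \<in> {0..1}" for x by (simp add: \<Lambda>_def)
    have \<Lambda>lim: "(\<lambda>n. \<Lambda> (X n)) \<longlonglongrightarrow> \<Lambda> x"
      if "\<And>n. continuous_on {0..T} (X n)" "uniform_limit {0..T} X x sequentially" for X x
    proof -
      have "continuous_on {0..T} x" by (rule uniform_limit_theorem[OF _ that(2)]) (auto simp: that(1))
      then have "J x \<noteq> 0" using inverse_square_integral_pos[OF T R0, of x] by (simp add: J_def)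
      moreover have "(\<lambda>n. J (X n)) \<longlonglongrightarrow> J x"
        unfolding J_def by (rule inverse_square_integral_tendsto[OF T R0 that])
      ultimately show ?thesis unfolding \<Lambda>_def by (intro tendsto_intros)
    qed
    define b where "b n = b0 + real n" for n
    have "\<exists>x v. (\<forall>t. (x has_real_derivative v t) (at t)) \<and>
        (\<forall>t. (v has_real_derivative - (g t (x t) (\<Lambda> x) - (b n)\<^sup>2 * pos_part (- x t))) (at t)) \<and>
        (\<forall>t. x (t + T) = x t) \<and> (\<forall>t. v (t + T) = v t) \<and> (\<forall>t. wall_energy 1 (b n) (x t) (v t) \<le> M)" for n
      using \<Lambda> \<Lambda>lim by (intro sol) (simp_all add: b_def admissible_parameter_def)
    then obtain x v where x: "\<And>n t. (x n has_real_derivative v n t) (at t)"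
      and v: "\<And>n t. (v n has_real_derivative - (g t (x n t) (\<Lambda> (x n)) - (b n)\<^sup>2 * pos_part (- x n t))) (at t)"
      and xper: "\<And>n t. x n (t + T) = x n t" and vper: "\<And>n t. v n (t + T) = v n t"
      and energy: "\<And>n t. wall_energy 1 (b n) (x n t) (v n t) \<le> M"
      by metis
    have b1: "b n \<ge> 1" for n using b0 by (simp add: b_def)
    have blim: "filterlim b at_top sequentially"
      unfolding b_def[abs_def] by (rule filterlim_tendsto_add_at_top[OF tendsto_const filterlim_real_sequentially])
    define G where "G = (m1 + m2) * sqrt M + C"
    have G: "\<bar>g t (x n t) (\<Lambda> (x n))\<bar> \<le> G" for n t
    proof -
      have "pos_part (x n t) \<le> sqrt M"
        using wall_energy_bounds(3)[OF energy b1, of n t] M by (simp add: pos_part_def)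
      then have "m1 * pos_part (x n t) \<ge> 0" "m2 * pos_part (x n t) \<le> m2 * sqrt M" "m1 * sqrt M \<ge> 0" "m2 * sqrt M \<ge> 0"
        using m0 M by (auto simp: pos_part_nonneg)
      then show ?thesis
        using g1[OF \<Lambda>[of "x n"], of "x n t" t] g2[OF \<Lambda>[of "x n"], of t "x n t"]
        by (simp add: G_def a distrib_right abs_le_iff)
    qed
    obtain k X E L where k: "strict_mono k" and xlim: "uniform_limit UNIV (\<lambda>n. x (k n)) X sequentially"
      and Xper: "\<And>t. X (t + T) = X t"
      and "penalised_limit g (\<lambda>n. x (k n)) (\<lambda>n. v (k n)) (\<lambda>n. b (k n)) (\<lambda>n. \<Lambda> (x (k n))) X E L G (sqrt M)"
      by (rule penalised_compactness[OF T gcont b1 blim x v xper vper energy G \<Lambda>]) (rule that)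
    then interpret penalised_limit g "\<lambda>n. x (k n)" "\<lambda>n. v (k n)" "\<lambda>n. b (k n)" "\<lambda>n. \<Lambda> (x (k n))" X E L G "sqrt M"
      by simp
    have "(\<lambda>n. \<Lambda> (x (k n))) \<longlonglongrightarrow> \<Lambda> X"
      by (rule \<Lambda>lim[OF x_cont uniform_limit_on_subset[OF xlim]]) simp
    then have L: "L = \<Lambda> X" using LIMSEQ_unique l_lim by blast
    have "X t \<le> sqrt M" for t
      using wall_energy_bounds(3)[OF energy b1] by (intro LIMSEQ_le_const2[OF x_tendsto]) (auto simp: abs_le_iff)
    then have "T / B\<^sup>2 \<le> J X"
      unfolding B_def J_def using M by (intro inverse_square_integral_lower[OF T R0 X_cont]) (auto simp: pos_part_def)
    moreover have "T / B\<^sup>2 > 0" using T B by simp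
    ultimately have J: "J X > 0" "\<epsilon> \<le> J X" using \<epsilon> by linarith+
    \<comment> \<open>The quotient \<open>\<epsilon> / J X\<close> lies in \<open>[0, 1]\<close>, so
      the truncation in \<open>\<Lambda>\<close> is the identity here.\<close>
    then have LJ: "L * J X = \<epsilon>" using \<epsilon>(1) by (simp add: L \<Lambda>_def)
    define \<rho> where "\<rho> t = R0 + X t" for t
    have \<rho>: "\<rho> t > 0" for t using R0 X_nonneg[of t] by (simp add: \<rho>_def)
    have rate: "continuous_on UNIV (\<lambda>t. L / (\<rho> t)\<^sup>2)"
      using \<rho> unfolding \<rho>_def by (intro continuous_intros X_cont) (auto simp: less_imp_neq[symmetric])
    obtain \<theta> where \<theta>: "\<And>t. (\<theta> has_real_derivative L / (\<rho> t)\<^sup>2) (at t)"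
      by (rule real_antiderivative[OF rate]) blast
    have turn0: "\<theta> T - \<theta> 0 = \<epsilon>"
    proof -
      have "((\<lambda>t. L / (\<rho> t)\<^sup>2) has_integral (\<theta> T - \<theta> 0)) {0..T}"
        using T \<theta> by (intro fundamental_theorem_of_calculus)
          (auto simp: has_real_derivative_iff_has_vector_derivative[symmetric] intro: has_field_derivative_at_within)
      then have "\<theta> T - \<theta> 0 = integral {0..T} (\<lambda>t. L * (1 / (\<rho> t)\<^sup>2))"
        by (simp add: integral_unique)
      also have "\<dots> = L * integral {0..T} (\<lambda>t. 1 / (\<rho> t)\<^sup>2)" by (rule integral_mult_right)
      also have "integral {0..T} (\<lambda>t. 1 / (\<rho> t)\<^sup>2) = J X"
        using X_nonneg by (simp add: J_def inverse_square_integral_def \<rho>_def pos_part_def max_absorb2)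
      finally show ?thesis by (simp add: LJ)
    qed
    have \<rho>per: "\<rho> (t + T) = \<rho> t" for t by (simp add: \<rho>_def Xper)
    have "((\<lambda>t. \<theta> (t + T) - \<theta> t) has_real_derivative 0) (at t)" for t
      using DERIV_diff[OF DERIV_shift[THEN iffD1, OF \<theta>[of "t + T"]] \<theta>[of t]] \<rho>per by simp
    then have turn: "\<theta> (t + T) = \<theta> t + \<epsilon>" for t
      using DERIV_isconst_all[of "\<lambda>t. \<theta> (t + T) - \<theta> t" t 0] turn0 by auto
    have "bouncing_solution R0 (\<lambda>t r. - (L\<^sup>2 / r ^ 3) + f t r) (- \<infinity>) \<infinity> \<rho>"
      unfolding \<rho>_def by (rule bouncing_limit) (simp add: g_def pos_part_def)
    moreover have "\<theta> differentiable (at t) \<and> (\<rho> t)\<^sup>2 * deriv \<theta> t = L" for t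
      using \<theta>[of t] \<rho>[of t] by (auto simp: real_differentiable_def DERIV_imp_deriv[OF \<theta>])
    ultimately show "\<exists>L \<rho> \<theta>. bouncing_solution_system R0 L f (- \<infinity>) \<infinity> \<rho> \<theta> \<and>
      (\<forall>t. \<rho> (t + T) = \<rho> t) \<and> (\<forall>t. \<theta> (t + T) = \<theta> t + \<epsilon>)"
      unfolding bouncing_solution_system_def using \<rho>per turn by blast
  qed
qed

theorem theorem1p1:
  fixes T R0 \<mu>1 \<mu>2 :: real and N :: int and f :: "real \<Rightarrow> real \<Rightarrow> real"
  assumes "T > 0" and "R0 > 0"
    and "continuous_on (UNIV \<times> {R0..}) (\<lambda>(t, r). f t r)"
    and "\<And>t r. r \<ge> R0 \<Longrightarrow> f (t + T) r = f t r"
    and "le_liminf_uniformly \<mu>1 (\<lambda>t r. f t r / r)"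
    and "limsup_le_uniformly (\<lambda>t r. f t r / r) \<mu>2"
    and "(of_int N * pi / T)\<^sup>2 < \<mu>1" and "\<mu>1 \<le> \<mu>2"
    and "\<mu>2 < (of_int (N + 1) * pi / T)\<^sup>2"
  shows "\<forall>\<nu>::int. \<nu> > 0 \<longrightarrow> (\<exists>k\<^sub>\<nu>::int. k\<^sub>\<nu> > 0 \<and> (\<forall>k::int. k \<ge> k\<^sub>\<nu> \<longrightarrow>
           (\<exists>(L::real) \<rho> \<theta>. bouncing_solution_system R0 L f (-\<infinity>) \<infinity> \<rho> \<theta> \<and>
              (\<forall>t. \<rho> (t + T) = \<rho> t) \<and>
              (\<forall>t. \<theta> (t + of_int k * T) = \<theta> t + 2 * pi * of_int \<nu>))))"
proof (intro allI impI)
  fix \<nu> :: int assume \<nu>: "\<nu> > 0"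
  obtain \<epsilon>0 where \<epsilon>0: "\<epsilon>0 > 0" and sol:
    "\<And>\<epsilon>. 0 < \<epsilon> \<Longrightarrow> \<epsilon> \<le> \<epsilon>0 \<Longrightarrow> \<exists>L \<rho> \<theta>. bouncing_solution_system R0 L f (- \<infinity>) \<infinity> \<rho> \<theta> \<and>
      (\<forall>t. \<rho> (t + T) = \<rho> t) \<and> (\<forall>t. \<theta> (t + T) = \<theta> t + \<epsilon>)"
    using periodic_bouncing_solution[OF assms] by blast
  \<comment> \<open>The least positive \<open>k\<close> for which the increment per period
    \<open>2 * pi * \<nu> / k\<close> is at most \<open>\<epsilon>0\<close>.\<close>
  define k0 where "k0 = max 1 \<lceil>2 * pi * of_int \<nu> / \<epsilon>0\<rceil>"
  show "\<exists>k\<^sub>\<nu>::int. k\<^sub>\<nu> > 0 \<and> (\<forall>k::int. k \<ge> k\<^sub>\<nu> \<longrightarrow>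
           (\<exists>(L::real) \<rho> \<theta>. bouncing_solution_system R0 L f (-\<infinity>) \<infinity> \<rho> \<theta> \<and>
              (\<forall>t. \<rho> (t + T) = \<rho> t) \<and>
              (\<forall>t. \<theta> (t + of_int k * T) = \<theta> t + 2 * pi * of_int \<nu>)))"
  proof (intro exI[of _ k0] conjI allI impI)
    show "k0 > 0" by (simp add: k0_def)
    fix k :: int assume k: "k \<ge> k0"
    define \<epsilon> where "\<epsilon> = 2 * pi * of_int \<nu> / of_int k"
    have k1: "k > 0" "2 * pi * of_int \<nu> / \<epsilon>0 \<le> of_int k"
      using k by (auto simp: k0_def ceiling_le_iff)
    have "\<epsilon> > 0" "\<epsilon> \<le> \<epsilon>0" using k1 \<nu> \<epsilon>0 by (auto simp: \<epsilon>_def field_simps)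
    then obtain L \<rho> \<theta> where s: "bouncing_solution_system R0 L f (- \<infinity>) \<infinity> \<rho> \<theta>" "\<forall>t. \<rho> (t + T) = \<rho> t"
      and \<theta>: "\<And>t. \<theta> (t + T) = \<theta> t + \<epsilon>"
      using sol by blast
    have "\<theta> (t + of_int k * T) = \<theta> t + 2 * pi * of_int \<nu>" for t
    proof -
      \<comment> \<open>Subtracting the mean rotation makes the angle \<open>T\<close>-periodic, so
        the step from one period to \<open>k\<close> periods is an instance of periodicity.\<close>
      have "\<theta> (t + T * of_int k) - \<epsilon> / T * (t + T * of_int k) = \<theta> t - \<epsilon> / T * t"
        by (rule periodic_int_multiple[of "\<lambda>t. \<theta> t - \<epsilon> / T * t"])
          (use assms(1) \<theta> in \<open>simp add: field_simps\<close>)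
      moreover have "\<epsilon> / T * (t + T * of_int k) = \<epsilon> / T * t + \<epsilon> * of_int k"
        using assms(1) by (simp add: distrib_left)
      moreover have "\<epsilon> * of_int k = 2 * pi * of_int \<nu>" using k1(1) by (simp add: \<epsilon>_def)
      ultimately show ?thesis by (simp add: mult.commute)
    qed
    then show "\<exists>(L::real) \<rho> \<theta>. bouncing_solution_system R0 L f (-\<infinity>) \<infinity> \<rho> \<theta> \<and>
              (\<forall>t. \<rho> (t + T) = \<rho> t) \<and>
              (\<forall>t. \<theta> (t + of_int k * T) = \<theta> t + 2 * pi * of_int \<nu>)"
      using s by blast
  qed
qed

end
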